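(* Let $\alpha\neq0$ and $\beta$ be real numbers, let $s\geq\frac14$, let $u_0\in H^s(\mathbb{R})$, and let $u$ be the solution of the Kawahara equation $$u_t+\alpha\partial_x^5u+\beta\partial_x^3u+\partial_x(u^2)=0,\qquad u(x,0)=u_0(x).$$ Then $$\lim_{t\to0}u(x,t)=u_0(x)\qquad\text{for almost every }x\in\mathbb{R}.$$
   Context: $H^s(\mathbb{R})$ has norm $\|f\|_{H^s}=\|\langle\xi\rangle^s\mathscr{F}_xf\|_{L^2_\xi}$, where $\langle\xi\rangle=(1+|\xi|^2)^{1/2}$ and $\mathscr{F}_xf(\xi)=\frac{1}{\sqrt{2\pi}}\int_{\mathbb{R}}e^{-ix\xi}f(x)\,dx$. Let $\phi(\xi)=\alpha\xi^5-\beta\xi^3$ and $U(t)f=\frac{1}{\sqrt{2\pi}}\int_{\mathbb{R}}e^{ix\xi-it\phi(\xi)}\mathscr{F}_xf(\xi)\,d\xi$. Let $\eta$ be a smooth function on $\mathbb{R}$ with $\eta=1$ for $|t|\leq1$ and $\eta=0$ for $|t|>2$. $X_{s,b}$ is the completion of the Schwartz functions on $\mathbb{R}^2$ in the norm $\|u\|_{X_{s,b}}=\|\langle\xi\rangle^s\langle\tau+\phi(\xi)\rangle^b\mathscr{F}u\|_{L^2_{\xi\tau}}$, with $\mathscr{F}u(\xi,\tau)=\frac{1}{2\pi}\int_{\mathbb{R}^2}e^{-ix\xi-it\tau}u(x,t)\,dx\,dt$. The solution: fix a sufficiently small $\epsilon>0$ and put $b=\frac12+\frac\epsilon2$. There is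 a constant $C_0\ge 1$ such that $\|\eta(t)U(t)f\|_{X_{s,b}}\le C_0\|f\|_{H^s}$ and $\|\eta(t/T)\int_0^tU(t-t')\partial_x(vw)(t')\,dt'\|_{X_{s,b}}\le C_0T^{3\epsilon/2}\|v\|_{X_{s,b}}\|w\|_{X_{s,b}}$ for $0<T<1$. For $T\in(0,1)$ with $8C_0^2T^{3\epsilon/2}\|u_0\|_{H^s}\le1$, the solution $u$ on the time interval $[-T,T]$ is the unique $u\in X_{s,b}$ with $\|u\|_{X_{s,b}}\le2C_0\|u_0\|_{H^s}$ satisfying $$u(t)=\eta(t)U(t)u_0-\eta\Big(\frac tT\Big)\int_0^tU(t-t')\partial_x(u^2)(t')\,dt'.$$ Since $u$ is a priori defined only almost everywhere in $(x,t)$, the pointwise assertion means that $u$ has a representative (equal to $u$ almost everywhere on $\mathbb{R}\times(-T,T)$) for which the stated limit holds. *)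

theory Defs
  imports "HOL-Analysis.Analysis"
begin

section \<open>Square-integrable functions, Schwartz functions and the Fourier transform\<close>

text \<open>Elements of \<open>L\<^sup>2\<close> are represented by Borel functions; every class has such a
  representative. \<open>L2_norm\<close> is meaningful only on square-integrable functions.\<close>

definition sq_integrable :: "('a::euclidean_space \<Rightarrow> complex) \<Rightarrow> bool" where
  "sq_integrable f \<longleftrightarrow> f \<in> borel_measurable borel \<and> integrable lborel (\<lambda>x. (cmod (f x))\<^sup>2)"

definition L2_norm :: "('a::euclidean_space \<Rightarrow> complex) \<Rightarrow> real" where
  "L2_norm f = sqrt (\<integral>x. (cmod (f x))\<^sup>2 \<partial>lborel)"

fun iter_dderiv :: "'a::euclidean_space list \<Rightarrow> ('a \<Rightarrow> complex) \<Rightarrow> 'a \<Rightarrow> complex" where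
  "iter_dderiv [] f = f"
| "iter_dderiv (v # vs) f = (\<lambda>x. frechet_derivative (iter_dderiv vs f) (at x) v)"

definition schwartz :: "('a::euclidean_space \<Rightarrow> complex) \<Rightarrow> bool" where
  "schwartz f \<longleftrightarrow>
     (\<forall>vs k. set vs \<subseteq> Basis \<longrightarrow>
        (\<forall>x. iter_dderiv vs f differentiable (at x)) \<and>
        bounded (range (\<lambda>x. complex_of_real (norm x ^ k) * iter_dderiv vs f x)))"

text \<open>On \<open>real\<close> the normalising factor is \<open>(2\<pi>)\<close> to the power \<open>-1/2\<close>, on
  \<open>real \<times> real\<close> it is \<open>1/(2\<pi>)\<close>.\<close>

definition fourier :: "('a::euclidean_space \<Rightarrow> complex) \<Rightarrow> 'a \<Rightarrow> complex" where
  "fourier f \<xi> = complex_of_real ((2 * pi) powr (- real DIM('a) / 2)) *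
     (\<integral>x. exp (- (\<i> * complex_of_real (x \<bullet> \<xi>))) * f x \<partial>lborel)"

text \<open>The extension of the Fourier transform from Schwartz functions to \<open>L\<^sup>2\<close> by
  continuity (Plancherel). The transform is determined almost everywhere only, so it is given
  as a relation, and \<open>fourier_L2\<close> picks a representative.\<close>

definition has_fourier_L2 ::
    "('a::euclidean_space \<Rightarrow> complex) \<Rightarrow> ('a \<Rightarrow> complex) \<Rightarrow> bool" where
  "has_fourier_L2 f g \<longleftrightarrow> sq_integrable f \<and> sq_integrable g \<and>
     (\<exists>F :: nat \<Rightarrow> 'a \<Rightarrow> complex. (\<forall>n. schwartz (F n)) \<and>
        (\<lambda>n. L2_norm (\<lambda>x. F n x - f x)) \<longlonglongrightarrow> 0 \<and>
        (\<lambda>n. L2_norm (\<lambda>\<xi>. fourier (F n) \<xi> - g \<xi>)) \<longlonglongrightarrow> 0)"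

definition fourier_L2 :: "('a::euclidean_space \<Rightarrow> complex) \<Rightarrow> 'a \<Rightarrow> complex" where
  "fourier_L2 f = (SOME g. has_fourier_L2 f g)"


section \<open>The spaces \<open>H\<^sup>s\<close> and \<open>X\<^bsub>s,b\<^esub>\<close>\<close>

definition jbracket :: "real \<Rightarrow> real" where
  "jbracket y = sqrt (1 + y\<^sup>2)"

text \<open>For \<open>s \<ge> 0\<close>, the only case in which this is used, \<open>H\<^sup>s\<close> is contained in \<open>L\<^sup>2\<close>.\<close>

definition Hs_norm :: "real \<Rightarrow> (real \<Rightarrow> complex) \<Rightarrow> real" where
  "Hs_norm s f = L2_norm (\<lambda>\<xi>. complex_of_real (jbracket \<xi> powr s) * fourier_L2 f \<xi>)"

definition Hs :: "real \<Rightarrow> (real \<Rightarrow> complex) set" where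
  "Hs s = {f. (\<exists>g. has_fourier_L2 f g) \<and>
     sq_integrable (\<lambda>\<xi>. complex_of_real (jbracket \<xi> powr s) * fourier_L2 f \<xi>)}"

definition phase :: "real \<Rightarrow> real \<Rightarrow> real \<Rightarrow> real" where
  "phase \<alpha> \<beta> \<xi> = \<alpha> * \<xi> ^ 5 - \<beta> * \<xi> ^ 3"

text \<open>Functions on space-time are functions of the pair \<open>(x, t)\<close>, their Fourier transforms
  functions of the pair \<open>(\<xi>, \<tau>)\<close>.\<close>

definition Xsb_norm_schwartz ::
    "real \<Rightarrow> real \<Rightarrow> real \<Rightarrow> real \<Rightarrow> (real \<times> real \<Rightarrow> complex) \<Rightarrow> real" where
  "Xsb_norm_schwartz \<alpha> \<beta> s b u =
     L2_norm (\<lambda>(\<xi>, \<tau>).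
       complex_of_real (jbracket \<xi> powr s * jbracket (\<tau> + phase \<alpha> \<beta> \<xi>) powr b) *
       fourier u (\<xi>, \<tau>))"

text \<open>For \<open>s, b \<ge> 0\<close> (the only case in which this is used) the norm dominates the
  \<open>L\<^sup>2\<close> norm, and a Cauchy sequence of Schwartz functions that tends to \<open>0\<close> in \<open>L\<^sup>2\<close> tends to
  \<open>0\<close> in the norm. Hence the completion of the Schwartz functions is the set of the \<open>L\<^sup>2\<close> limits
  of Cauchy sequences, and the norm of such a limit is the limit of the norms.\<close>

definition has_Xsb_norm ::
    "real \<Rightarrow> real \<Rightarrow> real \<Rightarrow> real \<Rightarrow> (real \<times> real \<Rightarrow> complex) \<Rightarrow> real \<Rightarrow> bool" where
  "has_Xsb_norm \<alpha> \<beta> s b u r \<longleftrightarrow> sq_integrable u \<and>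
     (\<exists>V :: nat \<Rightarrow> real \<times> real \<Rightarrow> complex. (\<forall>n. schwartz (V n)) \<and>
        (\<forall>e>0. \<exists>N. \<forall>m\<ge>N. \<forall>n\<ge>N. Xsb_norm_schwartz \<alpha> \<beta> s b (\<lambda>p. V m p - V n p) < e) \<and>
        (\<lambda>n. L2_norm (\<lambda>p. V n p - u p)) \<longlonglongrightarrow> 0 \<and>
        (\<lambda>n. Xsb_norm_schwartz \<alpha> \<beta> s b (V n)) \<longlonglongrightarrow> r)"

definition Xsb :: "real \<Rightarrow> real \<Rightarrow> real \<Rightarrow> real \<Rightarrow> (real \<times> real \<Rightarrow> complex) set" where
  "Xsb \<alpha> \<beta> s b = {u. \<exists>r. has_Xsb_norm \<alpha> \<beta> s b u r}"

definition Xsb_norm ::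
    "real \<Rightarrow> real \<Rightarrow> real \<Rightarrow> real \<Rightarrow> (real \<times> real \<Rightarrow> complex) \<Rightarrow> real" where
  "Xsb_norm \<alpha> \<beta> s b u = (THE r. has_Xsb_norm \<alpha> \<beta> s b u r)"


section \<open>The integral equation\<close>

definition time_cutoff :: "(real \<Rightarrow> real) \<Rightarrow> bool" where
  "time_cutoff \<eta> \<longleftrightarrow> (\<forall>n t. (deriv ^^ n) \<eta> differentiable (at t)) \<and>
     (\<forall>t. \<bar>t\<bar> \<le> 1 \<longrightarrow> \<eta> t = 1) \<and> (\<forall>t. \<bar>t\<bar> > 2 \<longrightarrow> \<eta> t = 0)"

text \<open>The operator \<open>U(t)\<close> is the Fourier multiplier with this symbol.\<close>

definition U_symbol :: "real \<Rightarrow> real \<Rightarrow> real \<Rightarrow> real \<Rightarrow> complex" where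
  "U_symbol \<alpha> \<beta> t \<xi> = exp (- (\<i> * complex_of_real (t * phase \<alpha> \<beta> \<xi>)))"

text \<open>\<open>G t\<close> is the Fourier transform in \<open>x\<close> of \<open>z(\<cdot>, t)\<close>. This determines \<open>z\<close> up to a null set
  of the plane.\<close>

definition has_spatial_fourier ::
    "(real \<times> real \<Rightarrow> complex) \<Rightarrow> (real \<Rightarrow> real \<Rightarrow> complex) \<Rightarrow> bool" where
  "has_spatial_fourier z G \<longleftrightarrow> z \<in> borel_measurable borel \<and>
     (AE t in lborel. has_fourier_L2 (\<lambda>x. z (x, t)) (G t))"

text \<open>\<open>z\<close> represents \<open>\<eta>(t) U(t) f\<close>. For \<open>f\<close> in \<open>H\<^sup>s\<close> the integral over \<open>\<xi>\<close> defining
  \<open>U(t) f\<close> is in general not absolutely convergent; it is the inverse Fourier transform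
  in \<open>L\<^sup>2\<close>.\<close>

definition cutoff_flow ::
    "real \<Rightarrow> real \<Rightarrow> (real \<Rightarrow> real) \<Rightarrow> (real \<Rightarrow> complex) \<Rightarrow> (real \<times> real \<Rightarrow> complex) \<Rightarrow> bool" where
  "cutoff_flow \<alpha> \<beta> \<eta> f z \<longleftrightarrow> has_spatial_fourier z
     (\<lambda>t \<xi>. complex_of_real (\<eta> t) * (U_symbol \<alpha> \<beta> t \<xi> * fourier_L2 f \<xi>))"

text \<open>The Fourier transform in \<open>x\<close> of \<open>\<integral>\<^sub>0\<^sup>t U(t - t') \<partial>\<^sub>x(v w)(t') dt'\<close>. The derivative
  \<open>\<partial>\<^sub>x(v w)(t')\<close> is a distribution in general; its Fourier transform is \<open>\<i> \<xi>\<close> times that of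
  \<open>(v w)(t')\<close>. For \<open>v\<close> and \<open>w\<close> in \<open>L\<^sup>2\<close> the product is integrable on the plane, so that the
  inner Fourier integral converges absolutely for almost every \<open>t'\<close> and is integrable in \<open>t'\<close>.
  The outer integral is oriented, so \<open>t < 0\<close> is allowed.\<close>

definition duhamel_fourier ::
    "real \<Rightarrow> real \<Rightarrow> (real \<times> real \<Rightarrow> complex) \<Rightarrow> (real \<times> real \<Rightarrow> complex) \<Rightarrow>
     real \<Rightarrow> real \<Rightarrow> complex" where
  "duhamel_fourier \<alpha> \<beta> v w t \<xi> =
     (LBINT t'=ereal 0..ereal t. U_symbol \<alpha> \<beta> (t - t') \<xi> *
        (\<i> * complex_of_real \<xi> * fourier (\<lambda>x. v (x, t') * w (x, t')) \<xi>))"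

text \<open>\<open>z\<close> represents \<open>\<eta>(t/T) \<integral>\<^sub>0\<^sup>t U(t - t') \<partial>\<^sub>x(v w)(t') dt'\<close>.\<close>

definition cutoff_duhamel ::
    "real \<Rightarrow> real \<Rightarrow> (real \<Rightarrow> real) \<Rightarrow> real \<Rightarrow> (real \<times> real \<Rightarrow> complex) \<Rightarrow>
     (real \<times> real \<Rightarrow> complex) \<Rightarrow> (real \<times> real \<Rightarrow> complex) \<Rightarrow> bool" where
  "cutoff_duhamel \<alpha> \<beta> \<eta> T v w z \<longleftrightarrow> has_spatial_fourier z
     (\<lambda>t \<xi>. complex_of_real (\<eta> (t / T)) * duhamel_fourier \<alpha> \<beta> v w t \<xi>)"

text \<open>\<open>C\<^sub>0\<close> is a constant for the linear and the bilinear estimate with \<open>b = 1/2 + \<epsilon>/2\<close>.\<close>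

definition estimate_constant ::
    "real \<Rightarrow> real \<Rightarrow> real \<Rightarrow> real \<Rightarrow> (real \<Rightarrow> real) \<Rightarrow> real \<Rightarrow> bool" where
  "estimate_constant \<alpha> \<beta> s \<epsilon> \<eta> C\<^sub>0 \<longleftrightarrow> C\<^sub>0 \<ge> 1 \<and>
     (let b = 1/2 + \<epsilon>/2 in
      (\<forall>f \<in> Hs s. \<exists>z \<in> Xsb \<alpha> \<beta> s b. cutoff_flow \<alpha> \<beta> \<eta> f z \<and>
         Xsb_norm \<alpha> \<beta> s b z \<le> C\<^sub>0 * Hs_norm s f) \<and>
      (\<forall>v \<in> Xsb \<alpha> \<beta> s b. \<forall>w \<in> Xsb \<alpha> \<beta> s b. \<forall>T. 0 < T \<and> T < 1 \<longrightarrow>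
         (\<exists>z \<in> Xsb \<alpha> \<beta> s b. cutoff_duhamel \<alpha> \<beta> \<eta> T v w z \<and>
            Xsb_norm \<alpha> \<beta> s b z \<le>
              C\<^sub>0 * T powr (3 * \<epsilon> / 2) * Xsb_norm \<alpha> \<beta> s b v * Xsb_norm \<alpha> \<beta> s b w)))"

text \<open>\<open>u\<close> is the solution on \<open>[-T, T]\<close> with initial value \<open>u\<^sub>0\<close>. If \<open>C\<^sub>0\<close> is a constant for
  the estimates, then the contraction principle gives exactly one such \<open>u\<close>, up to equality
  almost everywhere.\<close>

definition kawahara_solution ::
    "real \<Rightarrow> real \<Rightarrow> real \<Rightarrow> real \<Rightarrow> (real \<Rightarrow> real) \<Rightarrow> real \<Rightarrow> real \<Rightarrow>
     (real \<Rightarrow> complex) \<Rightarrow> (real \<times> real \<Rightarrow> complex) \<Rightarrow> bool" where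
  "kawahara_solution \<alpha> \<beta> s \<epsilon> \<eta> C\<^sub>0 T u\<^sub>0 u \<longleftrightarrow>
     (let b = 1/2 + \<epsilon>/2 in
      0 < T \<and> T < 1 \<and> 8 * C\<^sub>0\<^sup>2 * T powr (3 * \<epsilon> / 2) * Hs_norm s u\<^sub>0 \<le> 1 \<and>
      u \<in> Xsb \<alpha> \<beta> s b \<and> Xsb_norm \<alpha> \<beta> s b u \<le> 2 * C\<^sub>0 * Hs_norm s u\<^sub>0 \<and>
      (\<exists>y z. cutoff_flow \<alpha> \<beta> \<eta> u\<^sub>0 y \<and> cutoff_duhamel \<alpha> \<beta> \<eta> T u u z \<and>
         (AE p in lborel. u p = y p - z p)))"

end

theory Submission
  imports Defs "HOL-Probability.Probability"
begin

text \<open>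
  For \<open>b > 1/2\<close> a function in \<open>X\<^bsub>s,b\<^esub>\<close> is a superposition of modulated free solutions
  \<open>exp (\<i> t \<sigma>) U(t) f\<^sub>\<sigma>\<close>, so it inherits the maximal estimate for \<open>U(t)\<close> on \<open>H\<close> of order \<open>1/4\<close>: the
  supremum over \<open>t\<close> is integrable in \<open>x\<close> against a Gaussian, with a bound by the \<open>X\<^bsub>s,b\<^esub>\<close> norm.
  After duality this is a \<open>T T*\<close> argument, which rests on the bound \<open>C (1 + \<bar>x\<bar> powr (- 1/2))\<close>,
  uniform in \<open>t\<close>, for the integral of \<open>exp (\<i> (x \<xi> - t \<phi> \<xi>)) \<bar>\<xi>\<bar> powr (- 1/2)\<close>; that bound is
  van der Corput's lemma.

  Schwartz functions tending to \<open>u\<close> in \<open>X\<^bsub>s,b\<^esub>\<close> therefore converge, along a subsequence and for almost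
  every \<open>x\<close>, uniformly in \<open>t\<close>. Their limit \<open>v\<close> equals \<open>u\<close> almost everywhere and is continuous in \<open>t\<close>.
  To see that \<open>v (x, 0)\<close> is the initial value, test the integral equation against translated
  Gaussians and let \<open>t\<close> tend to \<open>0\<close>: the Fourier transform of the Duhamel term at time \<open>t\<close> is at most a
  constant times \<open>\<bar>\<xi>\<bar>\<close> times the integral of \<open>\<bar>u\<bar>\<^sup>2\<close> over the strip \<open>\<bar>t'\<bar> \<le> \<bar>t\<bar>\<close>.
\<close>

section \<open>Schwartz functions and their Fourier transforms\<close>

text \<open>The threshold 1/4 comes from squaring: the weight of order -2s is at most |\<xi>| to the
  power -1/2, and this is the amplitude that the substitution \<xi> = n^2 removes. The time at which
  the supremum is nearly attained is an arbitrary measurable function \<theta> of x. The kernel is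
  therefore met at times \<theta> x - \<theta> y of which nothing is known, and only a bound uniform
  in t can help. The constant in that bound comes from low frequencies, where the cubic term
  competes with the quintic one and oscillation is not exploited; as it does not decay in x, the
  estimate carries a Gaussian weight. The obstacle at time 0 is that the integral equation holds at
  almost every time only. It can be used at times tending to 0, and the continuous representative
  carries the conclusion to 0 itself. There the derivative in the nonlinearity costs a factor
  |\<xi>|, which is harmless because the test functions are Gaussians on the frequency side. Their
  transforms are one fixed Gaussian multiplied by every character, so they separate functions that
  are integrable against that Gaussian.\<close>

lemma lborel_has_integral_prod:
  fixes f :: "'a::euclidean_space \<Rightarrow> real \<Rightarrow> 'b::{real_normed_field,banach,second_countable_topology}"
  assumes int: "\<And>b. b \<in> Basis \<Longrightarrow> integrable lborel (f b)"
  shows "integrable lborel (\<lambda>x::'a. \<Prod>b\<in>Basis. f b (x \<bullet> b))" (is ?A)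
    and "(\<integral>x. (\<Prod>b\<in>Basis. f b (x \<bullet> b)) \<partial>(lborel :: 'a measure)) = (\<Prod>b\<in>Basis. \<integral>x. f b x \<partial>lborel)" (is ?B)
proof -
  interpret product_sigma_finite "\<lambda>b::'a. lborel :: real measure" ..
  define S :: "('a \<Rightarrow> real) \<Rightarrow> 'a" where "S = (\<lambda>g. \<Sum>b\<in>Basis. g b *\<^sub>R b)"
  have S[measurable]: "S \<in> (\<Pi>\<^sub>M b\<in>Basis. lborel) \<rightarrow>\<^sub>M borel"
    unfolding S_def by measurable
  have meas: "f b \<in> borel_measurable borel" if "b \<in> Basis" for b
    using borel_measurable_integrable[OF int[OF that]] by simp
  have P[measurable]: "(\<lambda>x::'a. \<Prod>b\<in>Basis. f b (x \<bullet> b)) \<in> borel_measurable borel"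
    by (intro borel_measurable_prod measurable_compose[OF _ meas]) auto
  have eq: "(\<Prod>b\<in>Basis. f b (S g \<bullet> b)) = (\<Prod>b\<in>Basis. f b (g b))" for g
    by (intro prod.cong refl) (simp add: S_def)
  show ?A
    apply (subst lborel_eq)
    apply (subst S_def[symmetric])
    apply (subst integrable_distr_eq)
      apply (simp_all add: eq S)
    apply (rule product_integrable_prod)
     apply (auto intro: int)
    done
  show ?B
    apply (subst lborel_eq)
    apply (subst S_def[symmetric])
    apply (subst integral_distr)
      apply (simp_all add: eq S)
    apply (rule product_integral_prod)
     apply (auto intro: int)
    done
qed

lemma lborel_integrable_inverse_1_plus_square: "integrable lborel (\<lambda>x::real. inverse (1 + x\<^sup>2))"
  using integrable_inverse_1_plus_square by (simp add: set_integrable_def)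

text \<open>Each factor 1 + (x \<bullet> b)^2 is at most 1 + |x|^2. With one power of the bracket
  per dimension, the product of one-dimensional integrable functions dominates. This is the standard
  majorant for Schwartz functions below.\<close>

lemma integrable_inverse_bracket_power:
  "integrable lborel (\<lambda>x::'a::euclidean_space. inverse ((1 + (norm x)\<^sup>2) ^ DIM('a)))"
proof (rule Bochner_Integration.integrable_bound)
  show "integrable lborel (\<lambda>x::'a. \<Prod>b\<in>Basis. inverse (1 + (x \<bullet> b)\<^sup>2))"
    by (rule lborel_has_integral_prod) (rule lborel_integrable_inverse_1_plus_square)
  show "(\<lambda>x::'a. inverse ((1 + (norm x)\<^sup>2) ^ DIM('a))) \<in> borel_measurable lborel"
    by simp
  show "AE x::'a in lborel. norm (inverse ((1 + (norm x)\<^sup>2) ^ DIM('a))) \<le> norm (\<Prod>b\<in>Basis. inverse (1 + (x \<bullet> b)\<^sup>2))"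
  proof (rule AE_I2)
    fix x :: 'a
    have "(\<Prod>b\<in>Basis. (1 + (x \<bullet> b)\<^sup>2)) \<le> (\<Prod>b\<in>(Basis::'a set). (1 + (norm x)\<^sup>2))"
      by (rule prod_mono) (auto intro!: power_mono simp: abs_le_square_iff[symmetric] Basis_le_norm)
    then have "inverse ((1 + (norm x)\<^sup>2) ^ DIM('a)) \<le> inverse (\<Prod>b\<in>Basis. (1 + (x \<bullet> b)\<^sup>2))"
      by (intro le_imp_inverse_le) (auto intro!: prod_pos add_pos_nonneg)
    then show "norm (inverse ((1 + (norm x)\<^sup>2) ^ DIM('a))) \<le> norm (\<Prod>b\<in>Basis. inverse (1 + (x \<bullet> b)\<^sup>2))"
      by (simp add: prod_inversef[symmetric] o_def prod_nonneg)
  qed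
qed

lemma one_plus_power_le: "(1 + r\<^sup>2) ^ k \<le> 2 ^ k * (1 + r ^ (2 * k))" for r :: real
proof -
  have "(1 + r\<^sup>2) ^ k \<le> (2 * max 1 (r\<^sup>2)) ^ k"
    by (intro power_mono) auto
  also have "\<dots> = 2 ^ k * (max 1 (r\<^sup>2)) ^ k" by (simp add: power_mult_distrib)
  also have "(max 1 (r\<^sup>2)) ^ k \<le> 1 + r ^ (2 * k)"
    by (auto simp: max_def power_mult)
  finally show ?thesis by simp
qed

section \<open>Closure and decay properties of Schwartz functions\<close>

lemma iter_dderiv_append: "iter_dderiv (vs @ ws) f = iter_dderiv vs (iter_dderiv ws f)"
  by (induction vs) auto

lemma schwartz_dderiv:
  assumes "schwartz f" "v \<in> Basis"
  shows "schwartz (iter_dderiv [v] f)"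
  unfolding schwartz_def iter_dderiv_append[symmetric]
  using assms unfolding schwartz_def by (metis Un_subset_iff empty_set empty_subsetI insert_subset list.simps(15) set_append)

lemma schwartz_differentiable: "schwartz f \<Longrightarrow> f differentiable (at x)"
  unfolding schwartz_def by (metis empty_set empty_subsetI iter_dderiv.simps(1))

lemma schwartz_continuous: "schwartz f \<Longrightarrow> continuous_on UNIV f"
  by (meson differentiable_at_withinI differentiable_imp_continuous_on differentiable_on_def schwartz_differentiable)

lemma schwartz_measurable: "schwartz f \<Longrightarrow> f \<in> borel_measurable borel"
  by (intro borel_measurable_continuous_onI schwartz_continuous)

text \<open>The seminorms of \<open>schwartz\<close> involve pure powers of the norm, which say
  nothing at the origin. Those of orders 0 and 2k together control the bracket, by which one can
  divide.\<close>

lemma schwartz_decay: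
  assumes "schwartz f"
  obtains C where "C \<ge> 0" "\<And>x. cmod (f x) \<le> C / (1 + (norm x)\<^sup>2) ^ k"
proof -
  have "bounded (range (\<lambda>x. complex_of_real (norm x ^ j) * f x))" for j
    using assms unfolding schwartz_def by (metis empty_set empty_subsetI iter_dderiv.simps(1))
  then obtain B where B: "\<And>j x. cmod (complex_of_real (norm x ^ j) * f x) \<le> B j"
    unfolding bounded_iff by (metis rangeI)
  have B': "norm x ^ j * cmod (f x) \<le> B j" for j x
    using B[of x j] by (simp add: norm_mult norm_power)
  have B0: "0 \<le> B j" for j
    using order.trans[OF norm_ge_zero B] .
  have "(1 + (norm x)\<^sup>2) ^ k * cmod (f x) \<le> 2 ^ k * (B 0 + B (2*k))" for x
  proof -
    have "(1 + (norm x)\<^sup>2) ^ k * cmod (f x) \<le> (2 ^ k * (1 + norm x ^ (2 * k))) * cmod (f x)"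
      by (intro mult_right_mono one_plus_power_le) auto
    also have "\<dots> \<le> 2 ^ k * (B 0 + B (2*k))"
      using mult_left_mono[OF add_mono[OF B'[where x=x and j=0] B'[where x=x and j="2*k"]], of "2 ^ k"] by (simp add: algebra_simps)
    finally show ?thesis .
  qed
  moreover have "(1 + (norm x)\<^sup>2) ^ k > 0" for x :: 'a by (simp add: add_pos_nonneg)
  ultimately show thesis
    using that[of "2 ^ k * (B 0 + B (2*k))"] B0 by (simp add: pos_le_divide_eq mult.commute)
qed

lemma integrable_decay:
  fixes f :: "'a::euclidean_space \<Rightarrow> 'b::{banach,second_countable_topology}"
  assumes "f \<in> borel_measurable borel" "\<And>x. norm (f x) \<le> C / (1 + (norm x)\<^sup>2) ^ DIM('a)"
  shows "integrable lborel f"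
proof (rule Bochner_Integration.integrable_bound)
  show "integrable lborel (\<lambda>x::'a. C * inverse ((1 + (norm x)\<^sup>2) ^ DIM('a)))"
    by (intro integrable_mult_right integrable_inverse_bracket_power)
  show "f \<in> borel_measurable lborel" using assms(1) by simp
  show "AE x in lborel. norm (f x) \<le> norm (C * inverse ((1 + (norm x)\<^sup>2) ^ DIM('a)))"
  proof (rule AE_I2)
    fix x
    show "norm (f x) \<le> norm (C * inverse ((1 + (norm x)\<^sup>2) ^ DIM('a)))"
      using assms(2)[of x] abs_ge_self[of "C * inverse ((1 + (norm x)\<^sup>2) ^ DIM('a))"]
      by (simp add: divide_inverse)
  qed
qed

lemma schwartz_integrable: "schwartz f \<Longrightarrow> integrable lborel f"
  by (rule schwartz_decay[where k="DIM('a)" and f=f]) (auto intro: integrable_decay schwartz_measurable)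

lemma sq_integrable_decay:
  fixes f :: "'a::euclidean_space \<Rightarrow> complex"
  assumes "f \<in> borel_measurable borel" "\<And>x. norm (f x) \<le> C / (1 + (norm x)\<^sup>2) ^ DIM('a)"
  shows "sq_integrable f"
  unfolding sq_integrable_def
proof (intro conjI assms)
  have [measurable]: "f \<in> borel_measurable borel" by fact
  show "integrable lborel (\<lambda>x. (cmod (f x))\<^sup>2)"
  proof (rule integrable_decay)
    fix x :: 'a
    let ?p = "(1 + (norm x)\<^sup>2) ^ DIM('a)"
    have p: "?p \<ge> 1" by simp
    have "(cmod (f x))\<^sup>2 \<le> (C / ?p)\<^sup>2" by (intro power_mono assms) auto
    also have "\<dots> = C\<^sup>2 / ?p / ?p" by (simp add: power2_eq_square)
    also have "\<dots> \<le> C\<^sup>2 / ?p" using divide_left_mono[OF p, of "C\<^sup>2 / ?p"] p by simp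
    finally show "norm ((cmod (f x))\<^sup>2) \<le> C\<^sup>2 / ?p" by simp
  qed simp
qed

lemma schwartz_sq_integrable: "schwartz f \<Longrightarrow> sq_integrable f"
  by (rule schwartz_decay[where k="DIM('a)" and f=f]) (auto intro: sq_integrable_decay schwartz_measurable)

lemma iter_dderiv_diff:
  assumes "schwartz f" "schwartz g" "set vs \<subseteq> Basis"
  shows "iter_dderiv vs (\<lambda>x. f x - g x) = (\<lambda>x. iter_dderiv vs f x - iter_dderiv vs g x)"
  using assms(3)
proof (induction vs)
  case (Cons v vs)
  have d: "iter_dderiv vs f differentiable (at x)" "iter_dderiv vs g differentiable (at x)" for x
    using assms(1,2) Cons.prems unfolding schwartz_def by auto
  have "((\<lambda>x. iter_dderiv vs f x - iter_dderiv vs g x) has_derivative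
      (\<lambda>v. frechet_derivative (iter_dderiv vs f) (at x) v - frechet_derivative (iter_dderiv vs g) (at x) v)) (at x)" for x
    using d[of x] by (intro has_derivative_diff) (auto simp: frechet_derivative_works[symmetric])
  note * = this[THEN frechet_derivative_at, symmetric]
  show ?case using Cons by (simp add: *)
qed simp

lemma schwartz_diff:
  assumes "schwartz f" "schwartz g"
  shows "schwartz (\<lambda>x. f x - g x)"
  unfolding schwartz_def
proof (intro allI impI conjI)
  fix vs :: "'a list" and k x assume vs: "set vs \<subseteq> Basis"
  show "iter_dderiv vs (\<lambda>x. f x - g x) differentiable at x"
    unfolding iter_dderiv_diff[OF assms vs]
    using assms vs unfolding schwartz_def by (auto intro: differentiable_diff)
  have "bounded (range (\<lambda>x. complex_of_real (norm x ^ k) * iter_dderiv vs f x))"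
    "bounded (range (\<lambda>x. complex_of_real (norm x ^ k) * iter_dderiv vs g x))"
    using assms vs unfolding schwartz_def by auto
  from bounded_minus_comp[OF this]
  show "bounded (range (\<lambda>x. complex_of_real (norm x ^ k) * iter_dderiv vs (\<lambda>x. f x - g x) x))"
    unfolding iter_dderiv_diff[OF assms vs] by (simp add: algebra_simps)
qed

lemma norm_exp_i_times_of_real [simp]: "cmod (exp (\<i> * complex_of_real r)) = 1"
  "cmod (exp (- (\<i> * complex_of_real r))) = 1"
  using norm_exp_i_times[of "-r"] by (simp_all del: norm_exp_i_times add: norm_exp_i_times)

section \<open>The Fourier integral: trivial bound, derivatives, decay\<close>

lemma measurable_fourier [measurable]:
  fixes f :: "'a::euclidean_space \<Rightarrow> complex"
  assumes [measurable]: "f \<in> borel_measurable borel"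
  shows "fourier f \<in> borel_measurable borel"
  unfolding fourier_def by measurable

lemma integrable_exp_mult:
  fixes f :: "'a \<Rightarrow> complex"
  assumes "integrable M f" and [measurable]: "r \<in> borel_measurable M"
  shows "integrable M (\<lambda>x. exp (- (\<i> * complex_of_real (r x))) * f x)"
    and "integrable M (\<lambda>x. exp (\<i> * complex_of_real (r x)) * f x)"
proof -
  have [measurable]: "f \<in> borel_measurable M" using assms(1) by auto
  show "integrable M (\<lambda>x. exp (- (\<i> * complex_of_real (r x))) * f x)"
    by (rule Bochner_Integration.integrable_bound[OF assms(1)]) (auto simp: norm_mult)
  show "integrable M (\<lambda>x. exp (\<i> * complex_of_real (r x)) * f x)"
    by (rule Bochner_Integration.integrable_bound[OF assms(1)]) (auto simp: norm_mult)
qed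

text \<open>No integrability is assumed: when f is not integrable, the Fourier integral has the
  default value 0.\<close>

lemma norm_fourier_le:
  fixes f :: "'a::euclidean_space \<Rightarrow> complex"
  shows "cmod (fourier f \<xi>) \<le> (2 * pi) powr (- real DIM('a) / 2) * (\<integral>x. cmod (f x) \<partial>lborel)"
proof -
  have "cmod (\<integral>x. exp (- (\<i> * complex_of_real (x \<bullet> \<xi>))) * f x \<partial>lborel) \<le> (\<integral>x. cmod (f x) \<partial>lborel)"
    using integral_norm_bound[of lborel "\<lambda>x. exp (- (\<i> * complex_of_real (x \<bullet> \<xi>))) * f x"]
    by (simp add: norm_mult)
  then show ?thesis unfolding fourier_def norm_mult
    by (intro mult_mono) auto
qed

text \<open>On the Fourier side a difference quotient of step 1 / (n + 1) is multiplication by the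
  sequence on the left, and the limit is the symbol of the derivative.\<close>

lemma exp_difference_quotient:
  "(\<lambda>n. (exp (\<i> * complex_of_real (c / real (Suc n))) - 1) * of_nat (Suc n)) \<longlonglongrightarrow> \<i> * complex_of_real c"
proof -
  have "((\<lambda>z. exp (\<i> * of_real c * z)) has_field_derivative \<i> * of_real c) (at 0)"
    by (auto intro!: derivative_eq_intros)
  then have *: "((\<lambda>h. (exp (\<i> * of_real c * h) - 1) / h) \<longlongrightarrow> \<i> * of_real c) (at 0)"
    by (simp add: DERIV_def)
  have "filterlim (\<lambda>n. complex_of_real (1 / real (Suc n))) (at 0) sequentially"
    unfolding filterlim_at
    using tendsto_of_real[OF LIMSEQ_inverse_real_of_nat, where 'a=complex]
    by (simp add: inverse_eq_divide del: of_nat_Suc)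
  from filterlim_compose[OF * this] show ?thesis
    by (simp add: divide_inverse mult_ac del: of_nat_Suc)
qed

lemma lborel_integral_translate:
  fixes f :: "'a::euclidean_space \<Rightarrow> 'b::{banach, second_countable_topology}"
  assumes [measurable]: "f \<in> borel_measurable borel"
  shows "(\<integral>x. f (a + x) \<partial>lborel) = (\<integral>x. f x \<partial>lborel)"
    and "integrable lborel (\<lambda>x. f (a + x)) = integrable lborel f"
proof -
  have *: "lborel = distr lborel borel ((+) a)" by (simp add: lborel_distr_plus)
  show "(\<integral>x. f (a + x) \<partial>lborel) = (\<integral>x. f x \<partial>lborel)"
    by (subst (2) *, subst integral_distr) auto
  show "integrable lborel (\<lambda>x. f (a + x)) = integrable lborel f"
    by (subst (2) *, subst integrable_distr_eq) auto
qed

text \<open>In place of an integration by parts, the derivative is taken as the limit of the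
  difference quotients \<open>Q n\<close>. Translation invariance of Lebesgue measure computes their
  transforms exactly, and dominated convergence passes to the limit.\<close>

lemma fourier_dderiv:
  assumes f: "schwartz f" and v: "v \<in> Basis"
  shows "fourier (iter_dderiv [v] f) \<xi> = \<i> * complex_of_real (v \<bullet> \<xi>) * fourier f \<xi>"
proof -
  define D where "D = iter_dderiv [v] f"
  define e where "e = (\<lambda>x. exp (- (\<i> * complex_of_real (x \<bullet> \<xi>))))"
  define h where "h = (\<lambda>n. 1 / real (Suc n))"
  define Q where "Q = (\<lambda>n x. (f (h n *\<^sub>R v + x) - f x) * of_nat (Suc n))"
  have D: "schwartz D" unfolding D_def by (rule schwartz_dderiv[OF f v])
  note [measurable] = schwartz_measurable[OF f] schwartz_measurable[OF D]
  have [measurable]: "e \<in> borel_measurable borel" unfolding e_def by measurable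
  have ne: "cmod (e x) = 1" for x by (simp add: e_def)
  have h: "0 < h n" "h n \<le> 1" for n by (auto simp: h_def)
  obtain C where C: "C \<ge> 0" "\<And>x. cmod (D x) \<le> C / (1 + (norm x)\<^sup>2) ^ DIM('a)"
    using schwartz_decay[OF D] by blast
  have deriv: "((\<lambda>s. f (s *\<^sub>R v + x)) has_vector_derivative D (s *\<^sub>R v + x)) (at s within S)" for s x S
  proof -
    let ?y = "s *\<^sub>R v + x"
    have d: "(f has_derivative frechet_derivative f (at ?y)) (at ?y)"
      using schwartz_differentiable[OF f] frechet_derivative_works by blast
    have "((\<lambda>s. f (s *\<^sub>R v + x)) has_derivative (\<lambda>r. frechet_derivative f (at ?y) (r *\<^sub>R v))) (at s within S)"
      using d by (rule has_derivative_compose[rotated]) (auto intro!: derivative_eq_intros)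
    moreover have "frechet_derivative f (at ?y) (r *\<^sub>R v) = r *\<^sub>R D ?y" for r
      using linear_frechet_derivative[OF schwartz_differentiable[OF f]]
      by (simp add: D_def linear_cmul)
    ultimately show ?thesis unfolding has_vector_derivative_def by simp
  qed
  have lim: "(\<lambda>n. e x * Q n x) \<longlonglongrightarrow> e x * D x" for x
  proof -
    have "((\<lambda>s. (f (s *\<^sub>R v + x) - f x) /\<^sub>R s) \<longlongrightarrow> D x) (at 0)"
    proof (rule LIM_zero_cancel, rule tendsto_norm_zero_cancel)
      have "((\<lambda>s. norm (f (s *\<^sub>R v + x) - f x - s *\<^sub>R D x) / norm s) \<longlongrightarrow> 0) (at 0)"
        using deriv[of x 0 UNIV] unfolding has_vector_derivative_def has_derivative_at by simp
      then show "((\<lambda>s. norm ((f (s *\<^sub>R v + x) - f x) /\<^sub>R s - D x)) \<longlongrightarrow> 0) (at 0)"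
      proof (rule Lim_transform_eventually)
        have "norm (f (s *\<^sub>R v + x) - f x - s *\<^sub>R D x) / norm s = norm ((f (s *\<^sub>R v + x) - f x) /\<^sub>R s - D x)" if "s \<noteq> 0" for s
        proof -
          have "(f (s *\<^sub>R v + x) - f x) /\<^sub>R s - D x = (f (s *\<^sub>R v + x) - f x - s *\<^sub>R D x) /\<^sub>R s"
            using that by (simp add: algebra_simps)
          then show ?thesis by (simp add: divide_inverse)
        qed
        then show "\<forall>\<^sub>F s in at 0. norm (f (s *\<^sub>R v + x) - f x - s *\<^sub>R D x) / norm s = norm ((f (s *\<^sub>R v + x) - f x) /\<^sub>R s - D x)"
          by (simp add: eventually_at_filter)
      qed
    qed
    moreover have "filterlim h (at 0) sequentially"
      unfolding filterlim_at h_def using LIMSEQ_inverse_real_of_nat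
      by (auto simp: inverse_eq_divide simp del: of_nat_Suc)
    ultimately have "((\<lambda>n. (f (h n *\<^sub>R v + x) - f x) /\<^sub>R h n)) \<longlonglongrightarrow> D x"
      by (rule filterlim_compose)
    then show ?thesis
      unfolding Q_def by (intro tendsto_mult tendsto_const) (simp add: h_def scaleR_conv_of_real mult.commute del: of_nat_Suc)
  qed
  \<comment> \<open>By the mean value theorem the quotient is at most the derivative at a point
    within distance 1 of x, since the steps are at most 1. Over that distance the bracket changes by
    at most a factor 3, so one majorant serves for all n.\<close>
  have bound: "cmod (Q n x) \<le> 3 ^ DIM('a) * C / (1 + (norm x)\<^sup>2) ^ DIM('a)" for n x
  proof -
    have "\<exists>s\<in>{0<..<h n}. norm (f (h n *\<^sub>R v + x) - f (0 *\<^sub>R v + x)) \<le> norm ((h n - 0) *\<^sub>R D (s *\<^sub>R v + x))"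
    proof (rule mvt_general[OF h(1)])
      show "continuous_on {0..h n} (\<lambda>s. f (s *\<^sub>R v + x))"
        by (intro continuous_on_compose2[OF schwartz_continuous[OF f]] continuous_intros) auto
    qed (use deriv in \<open>simp add: has_vector_derivative_def\<close>)
    then obtain s where s: "0 < s" "s < h n" "cmod (f (h n *\<^sub>R v + x) - f x) \<le> h n * cmod (D (s *\<^sub>R v + x))"
      using h(1)[of n] by (auto)
    let ?y = "s *\<^sub>R v + x"
    have "norm x \<le> norm ?y + norm (s *\<^sub>R v)" by (metis add.commute add_diff_cancel_left' norm_triangle_ineq4)
    also have "norm (s *\<^sub>R v) \<le> 1" using s h(2)[of n] v by simp
    finally have "(norm x)\<^sup>2 \<le> (norm ?y + 1)\<^sup>2" by (intro power_mono) auto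
    also have "\<dots> \<le> 2 * (norm ?y)\<^sup>2 + 2"
      using zero_le_power2[of "norm ?y - 1"] by (simp add: power2_eq_square algebra_simps)
    finally have "1 + (norm x)\<^sup>2 \<le> 3 * (1 + (norm ?y)\<^sup>2)" using zero_le_power2[of "norm ?y"] unfolding distrib_left by linarith
    define P where "P = (1 + (norm x)\<^sup>2) ^ DIM('a)"
    define Y where "Y = (1 + (norm ?y)\<^sup>2) ^ DIM('a)"
    have "P \<le> 3 ^ DIM('a) * Y"
      unfolding P_def Y_def power_mult_distrib[symmetric]
      by (intro power_mono \<open>1 + (norm x)\<^sup>2 \<le> 3 * (1 + (norm ?y)\<^sup>2)\<close>) auto
    moreover have "P > 0" "Y > 0" by (auto simp: P_def Y_def intro!: zero_less_power add_pos_nonneg)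
    ultimately have "1 / Y \<le> 3 ^ DIM('a) / P" by (simp add: field_simps)
    from mult_left_mono[OF this C(1)]
    have le: "C / (1 + (norm ?y)\<^sup>2) ^ DIM('a) \<le> C * (3 ^ DIM('a) / (1 + (norm x)\<^sup>2) ^ DIM('a))"
      by (simp add: P_def Y_def)
    have "cmod (Q n x) = cmod (f (h n *\<^sub>R v + x) - f x) * real (Suc n)"
      unfolding Q_def norm_mult norm_of_nat ..
    also have "\<dots> \<le> h n * cmod (D ?y) * real (Suc n)"
      using s(3) by (intro mult_right_mono) auto
    also have "\<dots> = cmod (D ?y)" by (simp add: h_def)
    also have "\<dots> \<le> C / (1 + (norm ?y)\<^sup>2) ^ DIM('a)" by (rule C)
    finally show ?thesis using le by (simp add: mult_ac)
  qed
  have 1: "(\<lambda>n. \<integral>x. e x * Q n x \<partial>lborel) \<longlonglongrightarrow> (\<integral>x. e x * D x \<partial>lborel)"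
  proof (rule integral_dominated_convergence)
    show "integrable lborel (\<lambda>x::'a. (3 ^ DIM('a) * C) * inverse ((1 + (norm x)\<^sup>2) ^ DIM('a)))"
      by (intro integrable_mult_right integrable_inverse_bracket_power)
    show "AE x in lborel. norm (e x * Q n x) \<le> (3 ^ DIM('a) * C) * inverse ((1 + (norm x)\<^sup>2) ^ DIM('a))" for n
      using bound[of n] by (simp add: norm_mult ne divide_inverse)
  qed (use lim in \<open>auto simp: Q_def\<close>)
  have int: "integrable lborel (\<lambda>x. e x * f x)"
    unfolding e_def by (intro integrable_exp_mult schwartz_integrable f) auto
  have 2: "(\<integral>x. e x * Q n x \<partial>lborel) = ((exp (\<i> * complex_of_real ((v \<bullet> \<xi>) / real (Suc n))) - 1) * of_nat (Suc n)) * (\<integral>x. e x * f x \<partial>lborel)" for n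
  proof -
    have e: "e x = exp (\<i> * complex_of_real ((v \<bullet> \<xi>) / real (Suc n))) * e (h n *\<^sub>R v + x)" for x
      unfolding e_def h_def exp_add[symmetric]
      by (intro arg_cong[where f=exp]) (simp add: algebra_simps del: of_nat_Suc)
    have int': "integrable lborel (\<lambda>x. e (h n *\<^sub>R v + x) * f (h n *\<^sub>R v + x))"
      by (subst lborel_integral_translate(2)) (use int in auto)
    have "(\<integral>x. e x * Q n x \<partial>lborel) = (\<integral>x. (exp (\<i> * complex_of_real ((v \<bullet> \<xi>) / real (Suc n))) * (e (h n *\<^sub>R v + x) * f (h n *\<^sub>R v + x)) - e x * f x) * of_nat (Suc n) \<partial>lborel)"
      unfolding Q_def by (intro Bochner_Integration.integral_cong refl) (subst (1) e, subst (2) e, simp add: algebra_simps del: of_nat_Suc)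
    also have "\<dots> = (exp (\<i> * complex_of_real ((v \<bullet> \<xi>) / real (Suc n))) * (\<integral>x. e (h n *\<^sub>R v + x) * f (h n *\<^sub>R v + x) \<partial>lborel) - (\<integral>x. e x * f x \<partial>lborel)) * of_nat (Suc n)"
      using int int' by (simp del: of_nat_Suc)
    also have "(\<integral>x. e (h n *\<^sub>R v + x) * f (h n *\<^sub>R v + x) \<partial>lborel) = (\<integral>x. e x * f x \<partial>lborel)"
      by (rule lborel_integral_translate) auto
    finally show ?thesis by (simp add: algebra_simps del: of_nat_Suc)
  qed
  have "(\<integral>x. e x * D x \<partial>lborel) = (\<i> * complex_of_real (v \<bullet> \<xi>)) * (\<integral>x. e x * f x \<partial>lborel)"
    using 1 unfolding 2
    by (rule LIMSEQ_unique) (intro tendsto_mult_right exp_difference_quotient)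
  then show ?thesis
    unfolding fourier_def D_def[symmetric] e_def by simp
qed

text \<open>Each power of the component is traded for a derivative of f, which is again a Schwartz
  function. Hence the induction must leave f arbitrary.\<close>

lemma fourier_component_decay:
  assumes "schwartz f" "v \<in> Basis"
  shows "\<exists>C. \<forall>\<xi>. \<bar>v \<bullet> \<xi>\<bar> ^ k * cmod (fourier f \<xi>) \<le> C"
  using assms
proof (induction k arbitrary: f)
  case 0
  then show ?case using norm_fourier_le[of f] by auto
next
  case (Suc k)
  from Suc.IH[OF schwartz_dderiv[OF Suc.prems] Suc.prems(2)] obtain C where
    "\<And>\<xi>. \<bar>v \<bullet> \<xi>\<bar> ^ k * cmod (fourier (iter_dderiv [v] f) \<xi>) \<le> C" by blast
  then show ?case
    unfolding fourier_dderiv[OF Suc.prems] by (auto simp: norm_mult mult_ac)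
qed

text \<open>Decay in each coordinate suffices: the square of the norm of \<xi> is at most the
  dimension times the square of its largest component.\<close>

lemma fourier_decay:
  fixes f :: "'a::euclidean_space \<Rightarrow> complex"
  assumes f: "schwartz f"
  obtains C where "C \<ge> 0" "\<And>\<xi>. cmod (fourier f \<xi>) \<le> C / (1 + (norm \<xi>)\<^sup>2) ^ k"
proof -
  obtain B where B: "\<And>v \<xi>. v \<in> Basis \<Longrightarrow> \<bar>v \<bullet> \<xi>\<bar> ^ (2 * k) * cmod (fourier f \<xi>) \<le> B v"
    using fourier_component_decay[OF f, where k="2 * k"] by metis
  obtain B0 where B0: "\<And>\<xi>. cmod (fourier f \<xi>) \<le> B0"
    using norm_fourier_le[of f] by blast
  let ?d = "real DIM('a)"
  define C where "C = 2 ^ k * (B0 + ?d ^ k * (\<Sum>v\<in>Basis. B v))"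
  have Bn: "0 \<le> B v" if "v \<in> Basis" for v
    using order.trans[OF _ B[OF that]] by (meson norm_ge_zero mult_nonneg_nonneg zero_le_power abs_ge_zero)
  have "(1 + (norm \<xi>)\<^sup>2) ^ k * cmod (fourier f \<xi>) \<le> C" for \<xi>
  proof -
    define a where "a = (\<lambda>v. (v \<bullet> \<xi>)\<^sup>2)"
    obtain w where w: "w \<in> Basis" "Max (a ` Basis) = a w"
      using Max_in[of "a ` Basis"] by fastforce
    have "(norm \<xi>)\<^sup>2 = (\<Sum>v\<in>Basis. a v)"
      unfolding power2_norm_eq_inner a_def by (subst euclidean_inner) (simp add: power2_eq_square inner_commute)
    also have "\<dots> \<le> (\<Sum>v\<in>(Basis::'a set). a w)"
      unfolding w(2)[symmetric] by (intro sum_mono) auto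
    also have "\<dots> = ?d * a w" by simp
    finally have "((norm \<xi>)\<^sup>2) ^ k \<le> (?d * a w) ^ k" by (intro power_mono) auto
    then have n: "norm \<xi> ^ (2 * k) \<le> ?d ^ k * \<bar>w \<bullet> \<xi>\<bar> ^ (2 * k)"
      by (simp add: power_mult power_mult_distrib a_def)
    have "(1 + (norm \<xi>)\<^sup>2) ^ k * cmod (fourier f \<xi>) \<le> (2 ^ k * (1 + ?d ^ k * \<bar>w \<bullet> \<xi>\<bar> ^ (2 * k))) * cmod (fourier f \<xi>)"
      using one_plus_power_le[of "norm \<xi>" k] n
      by (intro mult_right_mono order.trans[OF one_plus_power_le] mult_left_mono add_left_mono) auto
    also have "\<dots> = 2 ^ k * (cmod (fourier f \<xi>) + ?d ^ k * (\<bar>w \<bullet> \<xi>\<bar> ^ (2 * k) * cmod (fourier f \<xi>)))"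
      by (simp add: algebra_simps)
    also have "\<dots> \<le> C"
      unfolding C_def using member_le_sum[of w Basis B] Bn w(1)
      by (intro mult_left_mono add_mono B0 order.trans[OF B[OF w(1)]]) auto
    finally show ?thesis .
  qed
  moreover have "C \<ge> 0"
    unfolding C_def using order.trans[OF norm_ge_zero B0] Bn by (intro mult_nonneg_nonneg add_nonneg_nonneg sum_nonneg) auto
  moreover have "(1 + (norm x)\<^sup>2) ^ k > 0" for x :: 'a by (simp add: add_pos_nonneg)
  ultimately show thesis
    using that[of C] by (simp add: pos_le_divide_eq mult.commute)
qed

lemma fourier_schwartz_integrable:
  fixes f :: "'a::euclidean_space \<Rightarrow> complex"
  assumes f: "schwartz f"
  shows "integrable lborel (fourier f)" "sq_integrable (fourier f)"
proof -
  obtain C where "\<And>\<xi>. cmod (fourier f \<xi>) \<le> C / (1 + (norm \<xi>)\<^sup>2) ^ DIM('a)"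
    using fourier_decay[OF f] by blast
  note C = measurable_fourier[OF schwartz_measurable[OF f]] this
  show "integrable lborel (fourier f)" "sq_integrable (fourier f)"
    using integrable_decay[OF C] sq_integrable_decay[OF C] by auto
qed

section \<open>Fourier inversion\<close>

lemma lborel_integral_affine:
  fixes f :: "'a::euclidean_space \<Rightarrow> 'b::{banach, second_countable_topology}"
  assumes [measurable]: "f \<in> borel_measurable borel" and c: "c \<noteq> 0"
  shows "(\<integral>x. f x \<partial>lborel) = \<bar>c\<bar> ^ DIM('a) *\<^sub>R (\<integral>x. f (t + c *\<^sub>R x) \<partial>lborel)"
proof -
  have "(\<integral>x. f x \<partial>lborel) = (\<integral>x. \<bar>c\<bar> ^ DIM('a) *\<^sub>R f x \<partial>distr lborel borel (\<lambda>x. t + c *\<^sub>R x))"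
    by (subst lborel_affine[OF c, of t], subst integral_density) auto
  also have "\<dots> = (\<integral>x. \<bar>c\<bar> ^ DIM('a) *\<^sub>R f (t + c *\<^sub>R x) \<partial>lborel)"
    by (subst integral_distr) auto
  finally show ?thesis by simp
qed

lemma lborel_integrable_affine:
  fixes f :: "'a::euclidean_space \<Rightarrow> 'b::{banach, second_countable_topology}"
  assumes f: "integrable lborel f" and c: "c \<noteq> 0"
  shows "integrable lborel (\<lambda>x. f (t + c *\<^sub>R x))"
proof -
  have [measurable]: "f \<in> borel_measurable borel" using f by auto
  have "integrable (density (distr lborel borel (\<lambda>x. t + c *\<^sub>R x)) (\<lambda>_. ennreal (\<bar>c\<bar> ^ DIM('a)))) f"
    using f lborel_affine[OF c, of t] by simp
  then have "integrable (distr lborel borel (\<lambda>x. t + c *\<^sub>R x)) (\<lambda>x. \<bar>c\<bar> ^ DIM('a) *\<^sub>R f x)"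
    by (subst (asm) integrable_density) auto
  then have "integrable lborel (\<lambda>x. \<bar>c\<bar> ^ DIM('a) *\<^sub>R f (t + c *\<^sub>R x))"
    by (subst (asm) integrable_distr_eq) auto
  then have "integrable lborel (\<lambda>x. inverse (\<bar>c\<bar> ^ DIM('a)) *\<^sub>R (\<bar>c\<bar> ^ DIM('a) *\<^sub>R f (t + c *\<^sub>R x)))"
    by (rule integrable_scaleR_right)
  then show ?thesis using c by simp
qed

text \<open>Normalised to be its own Fourier transform. It serves as approximate identity for
  inversion, as weight of the maximal estimate and as test function at time 0.\<close>

definition gaussian :: "'a::euclidean_space \<Rightarrow> real" where
  "gaussian x = exp (- (norm x)\<^sup>2 / 2)"

lemma gaussian_pos: "0 < gaussian x"
  by (simp add: gaussian_def)

lemma gaussian_le_1: "gaussian x \<le> 1"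
  by (simp add: gaussian_def)

lemma gaussian_measurable [measurable]: "gaussian \<in> borel_measurable borel"
  unfolding gaussian_def by measurable

text \<open>Up to the factor sqrt (2 pi), this is the characteristic function of the standard normal
  distribution.\<close>

lemma gaussian_integral_real:
  fixes t :: real
  shows "integrable lborel (\<lambda>x::real. exp (- (\<i> * complex_of_real (x * t))) * complex_of_real (exp (- x\<^sup>2 / 2)))"
    and "(\<integral>x. exp (- (\<i> * complex_of_real (x * t))) * complex_of_real (exp (- x\<^sup>2 / 2)) \<partial>(lborel::real measure)) = complex_of_real (sqrt (2 * pi) * exp (- t\<^sup>2 / 2))"
proof -
  have eq: "exp (- (\<i> * complex_of_real (x * t))) * complex_of_real (exp (- x\<^sup>2 / 2)) =
      complex_of_real (sqrt (2 * pi)) * (std_normal_density x *\<^sub>R iexp (- t * x))" for x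
    by (simp add: std_normal_density_def scaleR_conv_of_real field_simps)
  have int: "integrable lborel (\<lambda>x. std_normal_density x *\<^sub>R iexp (- t * x))"
    by (rule Bochner_Integration.integrable_bound[where f=std_normal_density]) (auto simp: norm_mult)
  then show "integrable lborel (\<lambda>x::real. exp (- (\<i> * complex_of_real (x * t))) * complex_of_real (exp (- x\<^sup>2 / 2)))"
    unfolding eq by (rule integrable_mult_right)
  have "char std_normal_distribution (- t) = (\<integral>x. std_normal_density x *\<^sub>R iexp (- t * x) \<partial>lborel)"
    unfolding char_def by (subst integral_density) auto
  then have "(\<integral>x. std_normal_density x *\<^sub>R iexp (- t * x) \<partial>lborel) = complex_of_real (exp (- t\<^sup>2 / 2))"
    unfolding char_std_normal_distribution by simp
  then show "(\<integral>x. exp (- (\<i> * complex_of_real (x * t))) * complex_of_real (exp (- x\<^sup>2 / 2)) \<partial>(lborel::real measure)) = complex_of_real (sqrt (2 * pi) * exp (- t\<^sup>2 / 2))"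
    by (simp only: eq integral_mult_right_zero) (simp only: of_real_mult)
qed

lemma gaussian_integral:
  fixes \<xi> :: "'a::euclidean_space"
  shows "integrable lborel (\<lambda>x::'a. exp (- (\<i> * complex_of_real (x \<bullet> \<xi>))) * complex_of_real (gaussian x))"
    and "(\<integral>x. exp (- (\<i> * complex_of_real (x \<bullet> \<xi>))) * complex_of_real (gaussian x) \<partial>(lborel::'a measure)) = complex_of_real ((2 * pi) powr (real DIM('a) / 2) * gaussian \<xi>)"
proof -
  define h where "h = (\<lambda>(b::'a) (y::real). exp (- (\<i> * complex_of_real (y * (\<xi> \<bullet> b)))) * complex_of_real (exp (- y\<^sup>2 / 2)))"
  have n2: "(norm x)\<^sup>2 = (\<Sum>b\<in>Basis. (x \<bullet> b)\<^sup>2)" for x :: 'a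
    unfolding power2_norm_eq_inner by (subst euclidean_inner) (simp add: power2_eq_square)
  have g: "gaussian x = (\<Prod>b\<in>Basis. exp (- (x \<bullet> b)\<^sup>2 / 2))" for x :: 'a
    unfolding gaussian_def n2 exp_sum[OF finite_Basis, symmetric]
    by (simp add: sum_negf sum_divide_distrib)
  have eq: "exp (- (\<i> * complex_of_real (x \<bullet> \<xi>))) * complex_of_real (gaussian x) = (\<Prod>b\<in>Basis. h b (x \<bullet> b))" for x
    unfolding h_def prod.distrib g of_real_prod
    by (subst euclidean_inner) (simp add: exp_sum sum_distrib_left sum_negf[symmetric])
  have int: "integrable lborel (h b)" for b unfolding h_def by (rule gaussian_integral_real)
  show "integrable lborel (\<lambda>x::'a. exp (- (\<i> * complex_of_real (x \<bullet> \<xi>))) * complex_of_real (gaussian x))"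
    unfolding eq by (intro lborel_has_integral_prod int)
  have "(\<integral>x. exp (- (\<i> * complex_of_real (x \<bullet> \<xi>))) * complex_of_real (gaussian x) \<partial>(lborel::'a measure)) = (\<Prod>b\<in>Basis. complex_of_real (sqrt (2 * pi) * exp (- (\<xi> \<bullet> b)\<^sup>2 / 2)))"
    unfolding eq by (subst lborel_has_integral_prod(2)[OF int]) (unfold h_def gaussian_integral_real, rule refl)
  also have "\<dots> = complex_of_real (sqrt (2 * pi) ^ DIM('a) * gaussian \<xi>)"
    by (simp add: prod.distrib g)
  also have "sqrt (2 * pi) ^ DIM('a) = (2 * pi) powr (real DIM('a) / 2)"
    by (simp add: powr_half_sqrt[symmetric] powr_powr flip: powr_realpow)
  finally show "(\<integral>x. exp (- (\<i> * complex_of_real (x \<bullet> \<xi>))) * complex_of_real (gaussian x) \<partial>(lborel::'a measure)) = complex_of_real ((2 * pi) powr (real DIM('a) / 2) * gaussian \<xi>)" .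
qed

lemma gaussian_integrable: "integrable lborel (gaussian :: 'a::euclidean_space \<Rightarrow> real)"
  using gaussian_integral(1)[of "0::'a"] integrable_Re[of lborel "\<lambda>x::'a. complex_of_real (gaussian x)"] by simp

lemma gaussian_lebesgue_integral:
  "(\<integral>x. gaussian x \<partial>(lborel::'a::euclidean_space measure)) = (2 * pi) powr (real DIM('a) / 2)"
proof -
  have "complex_of_real (\<integral>x. gaussian x \<partial>(lborel::'a measure)) = complex_of_real ((2 * pi) powr (real DIM('a) / 2))"
    using gaussian_integral(2)[of "0::'a"] by (simp add: gaussian_def[of 0])
  then show ?thesis by (simp only: of_real_eq_iff)
qed

text \<open>The criterion behind the exchanges of complex integrals below. Oscillating factors have
  modulus 1, so a product of two integrable functions dominates whatever the phase couples.\<close>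

lemma integrable_pair_bound:
  fixes F :: "'a \<times> 'b \<Rightarrow> complex" and f :: "'a \<Rightarrow> complex" and g :: "'b \<Rightarrow> complex"
  assumes "sigma_finite_measure M1" "sigma_finite_measure M2"
    and f: "integrable M1 f" and g: "integrable M2 g"
    and [measurable]: "F \<in> borel_measurable (M1 \<Otimes>\<^sub>M M2)"
    and le: "\<And>x y. cmod (F (x, y)) \<le> cmod (f x) * cmod (g y)"
  shows "integrable (M1 \<Otimes>\<^sub>M M2) F"
proof -
  interpret M1: sigma_finite_measure M1 by fact
  interpret M2: sigma_finite_measure M2 by fact
  interpret pair_sigma_finite M1 M2 ..
  have [measurable]: "f \<in> borel_measurable M1" "g \<in> borel_measurable M2" using f g by auto
  have "integrable (M1 \<Otimes>\<^sub>M M2) (\<lambda>(x, y). f x * g y)"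
  proof (rule Fubini_integrable)
    show "integrable M1 (\<lambda>x. \<integral>y. norm (case (x, y) of (x, y) \<Rightarrow> f x * g y) \<partial>M2)"
      using f by (simp add: norm_mult)
    show "AE x in M1. integrable M2 (\<lambda>y. case (x, y) of (x, y) \<Rightarrow> f x * g y)"
      using g by simp
  qed simp
  then show ?thesis
    by (rule Bochner_Integration.integrable_bound) (auto simp: norm_mult le)
qed

text \<open>The kernel of the transform is symmetric in x and \<xi>, so Fubini moves the transform
  from one factor to the other.\<close>

lemma fourier_multiplication_formula:
  fixes f g :: "'a::euclidean_space \<Rightarrow> complex"
  assumes f: "integrable lborel f" and g: "integrable lborel g"
  shows "(\<integral>\<xi>. fourier f \<xi> * g \<xi> \<partial>lborel) = (\<integral>x. f x * fourier g x \<partial>lborel)"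
proof -
  have [measurable]: "f \<in> borel_measurable borel" "g \<in> borel_measurable borel"
    using borel_measurable_integrable[OF f] borel_measurable_integrable[OF g] by auto
  define k where "k = complex_of_real ((2 * pi) powr (- real DIM('a) / 2))"
  have "integrable (lborel \<Otimes>\<^sub>M lborel) (\<lambda>(x, \<xi>). exp (- (\<i> * complex_of_real (x \<bullet> \<xi>))) * f x * g \<xi>)"
    by (rule integrable_pair_bound[OF _ _ f g]) (auto simp: norm_mult lborel.sigma_finite_measure_axioms)
  then have fub: "(\<integral>\<xi>. \<integral>x. exp (- (\<i> * complex_of_real (x \<bullet> \<xi>))) * f x * g \<xi> \<partial>lborel \<partial>lborel) =
      (\<integral>x. \<integral>\<xi>. exp (- (\<i> * complex_of_real (x \<bullet> \<xi>))) * f x * g \<xi> \<partial>lborel \<partial>lborel)"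
    by (rule lborel_pair.Fubini_integral)
  have 1: "fourier f \<xi> * g \<xi> = k * (\<integral>x. exp (- (\<i> * complex_of_real (x \<bullet> \<xi>))) * f x * g \<xi> \<partial>lborel)" for \<xi>
  proof -
    have "fourier f \<xi> * g \<xi> = k * ((\<integral>x. exp (- (\<i> * complex_of_real (x \<bullet> \<xi>))) * f x \<partial>lborel) * g \<xi>)"
      unfolding fourier_def k_def by (rule mult.assoc)
    then show ?thesis by simp
  qed
  have 2: "f x * fourier g x = k * (\<integral>\<xi>. exp (- (\<i> * complex_of_real (x \<bullet> \<xi>))) * f x * g \<xi> \<partial>lborel)" for x
  proof -
    have "(\<integral>\<xi>. exp (- (\<i> * complex_of_real (x \<bullet> \<xi>))) * f x * g \<xi> \<partial>lborel) = (\<integral>\<xi>. f x * (exp (- (\<i> * complex_of_real (\<xi> \<bullet> x))) * g \<xi>) \<partial>lborel)"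
      by (simp add: mult_ac inner_commute)
    then show ?thesis by (simp add: fourier_def k_def)
  qed
  show ?thesis by (simp only: 1 2 integral_mult_right_zero fub)
qed

text \<open>An approximate identity centred at x, exhibited as a Fourier transform: as c tends to 0
  the transform concentrates at x while g tends to the character of inversion.\<close>

lemma fourier_modulated_gaussian:
  fixes x :: "'a::euclidean_space"
  assumes c: "c > 0"
  defines "g \<equiv> \<lambda>\<xi>. exp (\<i> * complex_of_real (x \<bullet> \<xi>)) * complex_of_real (gaussian (c *\<^sub>R \<xi>))"
  shows "integrable lborel g" and "fourier g y = complex_of_real (gaussian ((y - x) /\<^sub>R c) / c ^ DIM('a))"
proof -
  have "integrable lborel (\<lambda>\<xi>::'a. gaussian (0 + c *\<^sub>R \<xi>))"
    using c by (intro lborel_integrable_affine gaussian_integrable) auto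
  then have "integrable lborel (\<lambda>\<xi>::'a. complex_of_real (gaussian (c *\<^sub>R \<xi>)))" by simp
  then show int: "integrable lborel g"
    unfolding g_def by (rule integrable_exp_mult) simp
  have "(\<integral>\<xi>. exp (- (\<i> * complex_of_real (\<xi> \<bullet> ((y - x) /\<^sub>R c)))) * complex_of_real (gaussian \<xi>) \<partial>lborel)
     = c ^ DIM('a) *\<^sub>R (\<integral>\<xi>. exp (- (\<i> * complex_of_real (\<xi> \<bullet> y))) * g \<xi> \<partial>lborel)"
  proof (subst lborel_integral_affine[of _ c 0])
    have "exp (- (\<i> * complex_of_real ((c *\<^sub>R \<xi>) \<bullet> ((y - x) /\<^sub>R c)))) = exp (- (\<i> * complex_of_real (\<xi> \<bullet> y))) * exp (\<i> * complex_of_real (x \<bullet> \<xi>))" for \<xi>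

    proof -
      have "(c *\<^sub>R \<xi>) \<bullet> ((y - x) /\<^sub>R c) = \<xi> \<bullet> y - x \<bullet> \<xi>" using c by (simp add: inner_diff_right inner_commute)
      then show ?thesis unfolding exp_add[symmetric] by (simp only: of_real_diff) (simp add: algebra_simps)
    qed
    then show "\<bar>c\<bar> ^ DIM('a) *\<^sub>R (\<integral>\<xi>. exp (- (\<i> * complex_of_real ((0 + c *\<^sub>R \<xi>) \<bullet> ((y - x) /\<^sub>R c)))) * complex_of_real (gaussian (0 + c *\<^sub>R \<xi>)) \<partial>lborel) =
        c ^ DIM('a) *\<^sub>R (\<integral>\<xi>. exp (- (\<i> * complex_of_real (\<xi> \<bullet> y))) * g \<xi> \<partial>lborel)"
      using c by (simp only: add_0 g_def mult.assoc) simp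
  qed (use c in auto)
  then have "c ^ DIM('a) *\<^sub>R (\<integral>\<xi>. exp (- (\<i> * complex_of_real (\<xi> \<bullet> y))) * g \<xi> \<partial>lborel) = complex_of_real ((2 * pi) powr (real DIM('a) / 2) * gaussian ((y - x) /\<^sub>R c))"
    unfolding gaussian_integral(2) by (rule sym)
  then have "(\<integral>\<xi>. exp (- (\<i> * complex_of_real (\<xi> \<bullet> y))) * g \<xi> \<partial>lborel) = complex_of_real ((2 * pi) powr (real DIM('a) / 2) * gaussian ((y - x) /\<^sub>R c) / c ^ DIM('a))"
    using c by (simp add: field_simps scaleR_conv_of_real)
  then show "fourier g y = complex_of_real (gaussian ((y - x) /\<^sub>R c) / c ^ DIM('a))"
    by (simp add: fourier_def powr_minus field_simps)
qed

text \<open>The multiplication formula is applied to the modulated Gaussians. One side tends to the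
  inversion integral, dominated by the integrable transform. The other is a Gaussian average of f
  around x at scale \<open>c n\<close>, and tends to f x by continuity and boundedness.\<close>

lemma fourier_inversion:
  fixes f :: "'a::euclidean_space \<Rightarrow> complex"
  assumes f: "integrable lborel f" and cont: "continuous_on UNIV f" and B: "\<And>x. cmod (f x) \<le> B"
    and ff: "integrable lborel (fourier f)"
  shows "f x = complex_of_real ((2 * pi) powr (- real DIM('a) / 2)) *
     (\<integral>\<xi>. exp (\<i> * complex_of_real (x \<bullet> \<xi>)) * fourier f \<xi> \<partial>lborel)"
proof -
  define c where "c = (\<lambda>n. 1 / real (Suc n))"
  have c: "c n > 0" for n by (simp add: c_def)
  have c0: "c \<longlonglongrightarrow> 0" unfolding c_def using LIMSEQ_inverse_real_of_nat by (simp add: inverse_eq_divide)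
  have [measurable]: "f \<in> borel_measurable borel" using f by auto
  define g where "g = (\<lambda>n \<xi>. exp (\<i> * complex_of_real (x \<bullet> \<xi>)) * complex_of_real (gaussian (c n *\<^sub>R \<xi>)))"
  have gc: "isCont gaussian (y::'a)" for y unfolding gaussian_def by (intro continuous_intros) auto
  have fc: "isCont f y" for y using cont by (simp add: continuous_on_eq_continuous_at)
  have 1: "(\<lambda>n. \<integral>\<xi>. fourier f \<xi> * g n \<xi> \<partial>lborel) \<longlonglongrightarrow> (\<integral>\<xi>. exp (\<i> * complex_of_real (x \<bullet> \<xi>)) * fourier f \<xi> \<partial>lborel)"
  proof (rule integral_dominated_convergence[where w="\<lambda>\<xi>. cmod (fourier f \<xi>)"])
    show "AE \<xi> in lborel. (\<lambda>n. fourier f \<xi> * g n \<xi>) \<longlonglongrightarrow> exp (\<i> * complex_of_real (x \<bullet> \<xi>)) * fourier f \<xi>"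
    proof (rule AE_I2)
      fix \<xi> :: 'a
      have "(\<lambda>n. gaussian (c n *\<^sub>R \<xi>)) \<longlonglongrightarrow> gaussian (0 *\<^sub>R \<xi>)"
        by (rule isCont_tendsto_compose[OF gc]) (intro tendsto_intros c0)
      then have "(\<lambda>n. fourier f \<xi> * g n \<xi>) \<longlonglongrightarrow> fourier f \<xi> * (exp (\<i> * complex_of_real (x \<bullet> \<xi>)) * complex_of_real (gaussian (0 *\<^sub>R \<xi>)))"
        unfolding g_def by (intro tendsto_intros)
      then show "(\<lambda>n. fourier f \<xi> * g n \<xi>) \<longlonglongrightarrow> exp (\<i> * complex_of_real (x \<bullet> \<xi>)) * fourier f \<xi>"
        by (simp add: gaussian_def mult.commute)
    qed
    show "AE \<xi> in lborel. norm (fourier f \<xi> * g n \<xi>) \<le> cmod (fourier f \<xi>)" for n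
      by (auto simp: g_def norm_mult gaussian_le_1 less_imp_le[OF gaussian_pos] intro!: mult_left_le)
  qed (use ff in \<open>auto simp: g_def\<close>)
  have 2: "(\<lambda>n. \<integral>w. f (x + c n *\<^sub>R w) * complex_of_real (gaussian w) \<partial>lborel) \<longlonglongrightarrow> (\<integral>w. f x * complex_of_real (gaussian w) \<partial>(lborel::'a measure))"
  proof (rule integral_dominated_convergence[where w="\<lambda>w. B * gaussian w"])
    show "AE w in lborel. (\<lambda>n. f (x + c n *\<^sub>R w) * complex_of_real (gaussian w)) \<longlonglongrightarrow> f x * complex_of_real (gaussian w)"
    proof (rule AE_I2)
      fix w :: 'a
      have "(\<lambda>n. f (x + c n *\<^sub>R w)) \<longlonglongrightarrow> f (x + 0 *\<^sub>R w)"
        by (rule isCont_tendsto_compose[OF fc]) (intro tendsto_intros c0)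
      then show "(\<lambda>n. f (x + c n *\<^sub>R w) * complex_of_real (gaussian w)) \<longlonglongrightarrow> f x * complex_of_real (gaussian w)"
        by (auto intro: tendsto_mult)
    qed
    show "AE w::'a in lborel. norm (f (x + c n *\<^sub>R w) * complex_of_real (gaussian w)) \<le> B * gaussian w" for n
      using B by (auto simp: norm_mult less_imp_le[OF gaussian_pos] abs_of_pos[OF gaussian_pos] intro!: mult_right_mono)
  qed (use gaussian_integrable in auto)
  have eq: "(\<integral>\<xi>. fourier f \<xi> * g n \<xi> \<partial>lborel) = (\<integral>w. f (x + c n *\<^sub>R w) * complex_of_real (gaussian w) \<partial>lborel)" for n
  proof -
    have gi: "integrable lborel (g n)" and gf: "fourier (g n) y = complex_of_real (gaussian ((y - x) /\<^sub>R c n) / c n ^ DIM('a))" for y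
      unfolding g_def by (rule fourier_modulated_gaussian[OF c])+
    have "(\<integral>\<xi>. fourier f \<xi> * g n \<xi> \<partial>lborel) = (\<integral>y. f y * complex_of_real (gaussian ((y - x) /\<^sub>R c n) / c n ^ DIM('a)) \<partial>lborel)"
      by (simp only: fourier_multiplication_formula[OF f gi] gf)
    also have "\<dots> = \<bar>c n\<bar> ^ DIM('a) *\<^sub>R (\<integral>w. f (x + c n *\<^sub>R w) * complex_of_real (gaussian w / c n ^ DIM('a)) \<partial>lborel)"
      using c[of n] by (subst lborel_integral_affine[where c="c n" and t=x]) (auto simp: less_imp_neq[symmetric])
    also have "\<dots> = (\<integral>w. f (x + c n *\<^sub>R w) * complex_of_real (gaussian w) \<partial>lborel)"
      using c[of n] by (simp add: scaleR_conv_of_real)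
    finally show ?thesis .
  qed
  have "(\<integral>\<xi>. exp (\<i> * complex_of_real (x \<bullet> \<xi>)) * fourier f \<xi> \<partial>lborel) = f x * complex_of_real ((2 * pi) powr (real DIM('a) / 2))"
    using LIMSEQ_unique[OF 1[unfolded eq] 2] by (simp add: gaussian_lebesgue_integral)
  then show ?thesis by (simp add: powr_minus field_simps)
qed

section \<open>Oscillatory integrals\<close>

text \<open>Integrate by parts against cis q / (i q'). The boundary terms give 2 / l, and what
  remains is the integral of |q''| / q'^2. It is bounded through a majorant g with known integral,
  since q'' may change sign where this is applied.\<close>

lemma integral_cis_by_parts:
  fixes q q' q'' :: "real \<Rightarrow> real"
  assumes ab: "a \<le> b"
    and q: "\<And>x. x \<in> {a..b} \<Longrightarrow> (q has_real_derivative q' x) (at x)"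
    and q': "\<And>x. x \<in> {a..b} \<Longrightarrow> (q' has_real_derivative q'' x) (at x)"
    and cont: "continuous_on {a..b} q''"
    and low: "\<And>x. x \<in> {a..b} \<Longrightarrow> \<bar>q' x\<bar> \<ge> l" "l > 0"
    and g: "\<And>x. x \<in> {a..b} \<Longrightarrow> \<bar>q'' x\<bar> / (q' x)\<^sup>2 \<le> g x"
    and W: "(g has_integral W) {a..b}"
  shows "norm (integral {a..b} (\<lambda>x. cis (q x))) \<le> 2 / l + W"
proof -
  have nz: "q' x \<noteq> 0" if "x \<in> {a..b}" for x using low(1)[OF that] low(2) by auto
  have cq: "continuous_on {a..b} q" "continuous_on {a..b} q'"
    by (rule has_real_derivative_imp_continuous_on, use q q' in blast)+
  define A where "A = (\<lambda>x. cis (q x) / (\<i> * complex_of_real (q' x)))"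
  define r where "r = (\<lambda>x. cis (q x) * (- \<i> * complex_of_real (q'' x / (q' x)\<^sup>2)))"
  have der: "(A has_vector_derivative (cis (q x) - r x)) (at x within {a..b})" if "x \<in> {a..b}" for x
  proof -
    have 1: "((\<lambda>x. cis (q x)) has_vector_derivative (q' x *\<^sub>R (\<i> * cis (q x)))) (at x within {a..b})"
    proof -
      have "(q has_vector_derivative q' x) (at x within {a..b})"
        using q[OF that] by (simp add: has_field_derivative_at_within flip: has_real_derivative_iff_has_vector_derivative)
      moreover have "(cis has_vector_derivative \<i> * cis (q x)) (at (q x) within q ` {a..b})"
        unfolding has_vector_derivative_complex_iff by (auto intro!: derivative_eq_intros)
      ultimately show ?thesis
        using vector_diff_chain_within[of q "q' x" x "{a..b}" cis] by (simp add: o_def)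
    qed
    have 2: "((\<lambda>x. complex_of_real (1 / q' x)) has_vector_derivative complex_of_real (- q'' x / (q' x)\<^sup>2)) (at x within {a..b})"
      using q'[OF that] nz[OF that]
      by (intro has_vector_derivative_of_real)
        (auto intro!: derivative_eq_intros simp: has_field_derivative_at_within power2_eq_square
          simp flip: has_real_derivative_iff_has_vector_derivative)
    have "((\<lambda>x. cis (q x) * (complex_of_real (1 / q' x) * (- \<i>))) has_vector_derivative
       (cis (q x) * (complex_of_real (- q'' x / (q' x)\<^sup>2) * (- \<i>)) + (q' x *\<^sub>R (\<i> * cis (q x))) * (complex_of_real (1 / q' x) * (- \<i>)))) (at x within {a..b})"
      by (intro has_vector_derivative_mult 1 has_vector_derivative_mult_left 2)
    then show ?thesis
      using nz[OF that] by (simp add: A_def r_def scaleR_conv_of_real divide_inverse mult_ac algebra_simps)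
  qed
  have ft: "((\<lambda>x. cis (q x) - r x) has_integral (A b - A a)) {a..b}"
    using ab der by (rule fundamental_theorem_of_calculus)
  have ri: "r integrable_on {a..b}"
    unfolding r_def using nz by (intro integrable_continuous_real continuous_intros cq cont) auto
  have ci: "(\<lambda>x. cis (q x)) integrable_on {a..b}"
    by (intro integrable_continuous_real continuous_intros cq)
  have eq: "integral {a..b} (\<lambda>x. cis (q x)) = (A b - A a) + integral {a..b} r"
    using Henstock_Kurzweil_Integration.integral_diff[OF ci ri] integral_unique[OF ft] by simp
  have "norm (integral {a..b} r) \<le> integral {a..b} g"
    by (rule integral_norm_bound_integral[OF ri]) (use W g in \<open>auto simp: r_def norm_mult norm_divide norm_power abs_divide\<close>)
  also have "\<dots> = W" using W by (rule integral_unique)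
  finally have rW: "norm (integral {a..b} r) \<le> W" .
  have Al: "norm (A x) \<le> 1 / l" if "x \<in> {a..b}" for x
    using low(1)[OF that] low(2) by (auto simp: A_def norm_divide norm_mult intro!: divide_left_mono)
  have "norm (A b - A a) \<le> 1 / l + 1 / l"
    using ab by (intro order.trans[OF norm_triangle_ineq4] add_mono Al) auto
  then show ?thesis unfolding eq using rW by (intro order.trans[OF norm_triangle_ineq]) auto
qed

text \<open>When q'' keeps its sign, q'' / q'^2 is the derivative of -1 / q', so the remainder of
  the integration by parts is again a boundary term.\<close>

lemma van_der_Corput_1:
  fixes q q' q'' :: "real \<Rightarrow> real"
  assumes ab: "a \<le> b"
    and q: "\<And>x. x \<in> {a..b} \<Longrightarrow> (q has_real_derivative q' x) (at x)"
    and q': "\<And>x. x \<in> {a..b} \<Longrightarrow> (q' has_real_derivative q'' x) (at x)"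
    and cont: "continuous_on {a..b} q''"
    and pos: "\<And>x. x \<in> {a..b} \<Longrightarrow> q'' x \<ge> 0"
    and low: "\<And>x. x \<in> {a..b} \<Longrightarrow> \<bar>q' x\<bar> \<ge> l" "l > 0"
  shows "norm (integral {a..b} (\<lambda>x. cis (q x))) \<le> 4 / l"
proof -
  have nz: "q' x \<noteq> 0" if "x \<in> {a..b}" for x using low(1)[OF that] low(2) by auto
  have W: "((\<lambda>x. q'' x / (q' x)\<^sup>2) has_integral (- 1 / q' b - (- 1 / q' a))) {a..b}"
  proof (rule fundamental_theorem_of_calculus[OF ab])
    fix x assume x: "x \<in> {a..b}"
    show "((\<lambda>x. - 1 / q' x) has_vector_derivative q'' x / (q' x)\<^sup>2) (at x within {a..b})"
      using q'[OF x] nz[OF x]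
      by (auto intro!: derivative_eq_intros simp: has_field_derivative_at_within power2_eq_square
          simp flip: has_real_derivative_iff_has_vector_derivative)
  qed
  have "\<bar>q'' x\<bar> / (q' x)\<^sup>2 \<le> q'' x / (q' x)\<^sup>2" if "x \<in> {a..b}" for x using pos[OF that] by simp
  from integral_cis_by_parts[OF ab q q' cont low this W]
  have "norm (integral {a..b} (\<lambda>x. cis (q x))) \<le> 2 / l + (- 1 / q' b - (- 1 / q' a))" .
  also have "- 1 / q' b - (- 1 / q' a) \<le> 1 / l + 1 / l"
  proof -
    have *: "\<bar>1 / q' x\<bar> \<le> 1 / l" if "x \<in> {a..b}" for x
      using low(1)[OF that] low(2) by (auto simp: abs_divide intro!: divide_left_mono)
    show ?thesis using *[of a] *[of b] ab unfolding atLeastAtMost_iff by linarith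
  qed
  finally show ?thesis by simp
qed

lemma norm_integral_cis_le:
  fixes a b :: real
  assumes "a \<le> b" "continuous_on {a..b} q"
  shows "norm (integral {a..b} (\<lambda>x. cis (q x))) \<le> b - a"
  using assms integral_bound[of a b "\<lambda>x. cis (q x)" 1]
  by (auto intro!: continuous_intros)

lemma integral_cis_split:
  fixes a b c :: real
  assumes "a \<le> c" "c \<le> b" "continuous_on {a..b} q"
  shows "integral {a..b} (\<lambda>x. cis (q x)) = integral {a..c} (\<lambda>x. cis (q x)) + integral {c..b} (\<lambda>x. cis (q x))"
proof -
  have "(\<lambda>x. cis (q x)) integrable_on {a..b}"
    using assms(3) by (intro integrable_continuous_real continuous_intros)
  with assms(1,2) show ?thesis by (simp add: Henstock_Kurzweil_Integration.integral_combine)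
qed

text \<open>The alternatives \<open>c = a\<close> and \<open>c = b\<close> record an empty piece, so
  that the level k may lie below, inside or above the range of u.\<close>

lemma mono_threshold:
  fixes u :: "real \<Rightarrow> real"
  assumes "a \<le> b" "continuous_on {a..b} u" "mono_on {a..b} u"
  obtains c where "a \<le> c" "c \<le> b" "c = a \<or> (\<forall>x\<in>{a..c}. u x \<le> k)" "c = b \<or> (\<forall>x\<in>{c..b}. k \<le> u x)"
proof -
  consider "k \<le> u a" | "u b \<le> k" | "u a \<le> k" "k \<le> u b" by linarith
  then show thesis
  proof cases
    case 1
    have "k \<le> u x" if "x \<in> {a..b}" for x
      using 1 mono_onD[OF assms(3), of a x] that assms(1) by auto
    then show thesis using that[of a] assms(1) by blast
  next
    case 2
    have "u x \<le> k" if "x \<in> {a..b}" for x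
      using 2 mono_onD[OF assms(3), of x b] that assms(1) by auto
    then show thesis using that[of b] assms(1) by blast
  next
    case 3
    from IVT'[OF 3 assms(1,2)] obtain c where c: "a \<le> c" "c \<le> b" "u c = k" by blast
    have "u x \<le> k" if "x \<in> {a..c}" for x
      using c mono_onD[OF assms(3), of x c] that assms(1) by auto
    moreover have "k \<le> u x" if "x \<in> {c..b}" for x
      using c mono_onD[OF assms(3), of c x] that assms(1) by auto
    ultimately show thesis using that[of c] c by blast
  qed
qed

text \<open>Since q' grows at rate at least r, it stays within [- sqrt r, sqrt r] on an interval of
  length at most 2 / sqrt r, where the integrand is bounded by 1. Outside, the first derivative test
  applies. The level sqrt r balances the two, and 10 = 4 + 2 + 4.\<close>

lemma van_der_Corput_2:
  fixes q q' q'' :: "real \<Rightarrow> real"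
  assumes ab: "a \<le> b"
    and q: "\<And>x. x \<in> {a..b} \<Longrightarrow> (q has_real_derivative q' x) (at x)"
    and q': "\<And>x. x \<in> {a..b} \<Longrightarrow> (q' has_real_derivative q'' x) (at x)"
    and cont: "continuous_on {a..b} q''"
    and low: "\<And>x. x \<in> {a..b} \<Longrightarrow> q'' x \<ge> r" "r > 0"
  shows "norm (integral {a..b} (\<lambda>x. cis (q x))) \<le> 10 / sqrt r"
proof -
  have cq: "continuous_on {a..b} q" "continuous_on {a..b} q'"
    by (rule has_real_derivative_imp_continuous_on, use q q' in blast)+
  have incr: "r * (y - x) \<le> q' y - q' x" if "a \<le> x" "x \<le> y" "y \<le> b" for x y
  proof (cases "x = y")
    case False
    then have "x < y" using that by simp
    moreover have "(q' has_real_derivative q'' z) (at z)" if "x \<le> z" "z \<le> y" for z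
      using that \<open>a \<le> x\<close> \<open>y \<le> b\<close> by (intro q') auto
    ultimately obtain z where z: "x < z" "z < y" "q' y - q' x = (y - x) * q'' z"
      using MVT2[of x y q' q''] by blast
    have "z \<in> {a..b}" using z that by auto
    then have "(y - x) * r \<le> (y - x) * q'' z"
      using low(1) that by (intro mult_left_mono) auto
    then show ?thesis using z by (simp add: mult.commute)
  qed simp
  have mono: "mono_on {a..b} q'"
  proof (rule mono_onI)
    fix x y assume "x \<in> {a..b}" "y \<in> {a..b}" "x \<le> y"
    moreover from this have "0 \<le> r * (y - x)" using low(2) by simp
    ultimately show "q' x \<le> q' y" using incr[of x y] by simp
  qed
  let ?s = "sqrt r" and ?I = "\<lambda>a b. norm (integral {a..b} (\<lambda>x. cis (q x)))"
  have s: "?s > 0" "?s * ?s = r" using low(2) by auto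
  obtain c where c: "a \<le> c" "c \<le> b" "c = a \<or> (\<forall>x\<in>{a..c}. q' x \<le> - ?s)" "c = b \<or> (\<forall>x\<in>{c..b}. - ?s \<le> q' x)"
    using mono_threshold[OF ab cq(2) mono] by metis
  have sub: "{c..b} \<subseteq> {a..b}" using c by auto
  obtain d where d: "c \<le> d" "d \<le> b" "d = c \<or> (\<forall>x\<in>{c..d}. q' x \<le> ?s)" "d = b \<or> (\<forall>x\<in>{d..b}. ?s \<le> q' x)"
    using mono_threshold[OF c(2) continuous_on_subset[OF cq(2) sub] mono_on_subset[OF mono sub]] by metis
  have end_piece: "?I x y \<le> 4 / ?s" if xy: "a \<le> x" "x \<le> y" "y \<le> b" and "x = y \<or> (\<forall>z\<in>{x..y}. \<bar>q' z\<bar> \<ge> ?s)" for x y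
  proof (cases "x = y")
    case False
    with that(4) have "\<And>z. z \<in> {x..y} \<Longrightarrow> ?s \<le> \<bar>q' z\<bar>" by blast
    moreover have sub: "{x..y} \<subseteq> {a..b}" using xy by auto
    moreover have "\<And>z. z \<in> {x..y} \<Longrightarrow> 0 \<le> q'' z" using low sub by (meson less_imp_le order.trans subsetD)
    ultimately show ?thesis
      using s(1) q q' xy(2) continuous_on_subset[OF cont sub] by (intro van_der_Corput_1[of x y q q' q'' ?s]) blast+
  qed (use s in simp)
  have 1: "?I a c \<le> 4 / ?s"
  proof (rule end_piece)
    show "a = c \<or> (\<forall>z\<in>{a..c}. ?s \<le> \<bar>q' z\<bar>)" using c(3) by force
  qed (use c in auto)
  have 3: "?I d b \<le> 4 / ?s"
  proof (rule end_piece)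
    show "d = b \<or> (\<forall>z\<in>{d..b}. ?s \<le> \<bar>q' z\<bar>)" using d(4) by force
  qed (use c d in auto)
  have 2: "?I c d \<le> 2 / ?s"
  proof (cases "c = d")
    case False
    then have "\<bar>q' c\<bar> \<le> ?s \<or> - ?s \<le> q' c" "q' d \<le> ?s" "- ?s \<le> q' c" using c d by auto
    with incr[of c d] c d have "?s * (?s * (d - c)) \<le> ?s * 2"
      unfolding mult.assoc[symmetric] s(2) by (smt (verit))
    then have "?s * (d - c) \<le> 2" using s(1) by (simp only: mult_le_cancel_left_pos)
    then have "d - c \<le> 2 / ?s" using s(1) by (simp only: pos_le_divide_eq mult.commute)
    moreover have "?I c d \<le> d - c"
      using c d by (intro norm_integral_cis_le continuous_on_subset[OF cq(1)]) auto
    ultimately show ?thesis by linarith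
  qed (use s in simp)
  have "integral {a..b} (\<lambda>x. cis (q x)) = integral {a..c} (\<lambda>x. cis (q x)) + (integral {c..d} (\<lambda>x. cis (q x)) + integral {d..b} (\<lambda>x. cis (q x)))"
    using integral_cis_split[OF c(1,2) cq(1)] integral_cis_split[OF d(1,2) continuous_on_subset[OF cq(1) sub]] by simp
  then have "?I a b \<le> ?I a c + (?I c d + ?I d b)"
    by (simp only:) (intro order.trans[OF norm_triangle_ineq add_left_mono[OF norm_triangle_ineq]])
  also have "\<dots> \<le> 10 / ?s" using 1 2 3 by simp
  finally show ?thesis .
qed

text \<open>Complex conjugation. It turns concave phases into convex ones and, later, negative times
  the sign of \<alpha> into positive ones.\<close>

lemma norm_integral_cis_uminus:
  fixes a b :: real
  shows
  "norm (integral {a..b} (\<lambda>x. cis (- q x))) = norm (integral {a..b} (\<lambda>x. cis (q x)))"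
proof -
  have "integral {a..b} (\<lambda>x. cis (- q x)) = cnj (integral {a..b} (\<lambda>x. cis (q x)))"
    unfolding integral_cnj by (simp add: cis_cnj)
  then show ?thesis by simp
qed

lemma van_der_Corput_2_neg:
  fixes q q' q'' :: "real \<Rightarrow> real"
  assumes "a \<le> b"
    and "\<And>x. x \<in> {a..b} \<Longrightarrow> (q has_real_derivative q' x) (at x)"
    and "\<And>x. x \<in> {a..b} \<Longrightarrow> (q' has_real_derivative q'' x) (at x)"
    and "continuous_on {a..b} q''"
    and "\<And>x. x \<in> {a..b} \<Longrightarrow> q'' x \<le> - r" "r > 0"
  shows "norm (integral {a..b} (\<lambda>x. cis (q x))) \<le> 10 / sqrt r"
proof -
  have "norm (integral {a..b} (\<lambda>x. cis (- q x))) \<le> 10 / sqrt r"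
  proof (rule van_der_Corput_2)
    show "((\<lambda>x. - q x) has_real_derivative - q' x) (at x)"
      "((\<lambda>x. - q' x) has_real_derivative - q'' x) (at x)" if "x \<in> {a..b}" for x
      by (intro DERIV_minus assms that)+
    show "continuous_on {a..b} (\<lambda>x. - q'' x)" by (intro continuous_on_minus assms)
    show "r \<le> - q'' x" if "x \<in> {a..b}" for x using assms(5)[OF that] by simp
  qed (use assms in auto)
  then show ?thesis by (simp only: norm_integral_cis_uminus)
qed

section \<open>Bounds for the kernel of the Kawahara phase\<close>

text \<open>Here \<open>q'' = 2 x - u\<close> with \<open>u\<close> increasing. The second derivative test applies where
  \<open>u \<le> x\<close> and where \<open>u \<ge> 3 x\<close>. In between \<open>q''\<close> may vanish, but there \<open>q' n \<ge> x n\<close>.\<close>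

lemma polynomial_phase_tail_bound:
  fixes a b x :: real
  defines "q \<equiv> \<lambda>n. x * n^2 - a * n^10 + b * n^6"
  assumes a: "a \<ge> 0" and b: "\<bar>b\<bar> \<le> \<kappa> * a" and M: "M \<ge> 1" "M ^ 4 \<ge> \<kappa>"
    and x: "x \<noteq> 0" "1 / sqrt \<bar>x\<bar> \<le> M" and N: "M \<le> N"
  shows "norm (integral {M..N} (\<lambda>n. cis (q n))) \<le> 23 / sqrt \<bar>x\<bar>"
proof -
  define q' where "q' = (\<lambda>n. 2 * x * n - 10 * a * n^9 + 6 * b * n^5)"
  define u where "u = (\<lambda>n. 90 * a * n^8 - 30 * b * n^4)"
  define q'' where "q'' = (\<lambda>n. 2 * x - u n)"
  have dq: "(q has_real_derivative q' n) (at n)" for n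
    unfolding q_def q'_def by (auto intro!: derivative_eq_intros)
  have dq': "(q' has_real_derivative q'' n) (at n)" for n
    unfolding q'_def q''_def u_def by (auto intro!: derivative_eq_intros)
  have cont: "continuous_on S q''" "continuous_on S u" "continuous_on S q" for S
    unfolding q''_def u_def q_def by (auto intro!: continuous_intros)
  \<comment> \<open>This is the purpose of \<open>M ^ 4 \<ge> \<kappa>\<close>: from M on, every
    term with coefficient b is dominated by the corresponding term with coefficient a.\<close>
  have b4: "\<bar>b\<bar> * n ^ k \<le> a * n ^ (k + 4)" if "n \<ge> M" for n k
  proof -
    have n: "n \<ge> 0" using that M by simp
    have "\<kappa> \<le> n ^ 4" using power_mono[OF that, of 4] M by linarith
    then have "\<bar>b\<bar> \<le> a * n ^ 4" using b mult_left_mono[OF _ a, of \<kappa> "n ^ 4"] by (simp add: mult.commute)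
    then have "\<bar>b\<bar> * n ^ k \<le> a * n ^ 4 * n ^ k" using n by (intro mult_right_mono) auto
    then show ?thesis by (simp add: power_add mult_ac)
  qed
  have b4': "b * n ^ k \<le> a * n ^ (k + 4)" "- b * n ^ k \<le> a * n ^ (k + 4)" if "n \<ge> M" for n k
  proof -
    have n: "n \<ge> 0" using that M by simp
    have "b * n ^ k \<le> \<bar>b\<bar> * n ^ k" "- b * n ^ k \<le> \<bar>b\<bar> * n ^ k"
      using n by (intro mult_right_mono; simp)+
    then show "b * n ^ k \<le> a * n ^ (k + 4)" "- b * n ^ k \<le> a * n ^ (k + 4)"
      using b4[OF that, of k] by linarith+
  qed
  have u0: "u n \<ge> 60 * a * n ^ 8" if "n \<ge> M" for n
    using b4'(1)[OF that, of 4] by (simp add: u_def)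
  have u00: "u n \<ge> 0" if "n \<ge> M" for n
    using u0[OF that] a that M by (smt (verit) mult_nonneg_nonneg zero_le_power)
  have mono: "mono_on {M..N} u"
  proof (rule mono_onI)
    fix y z assume "y \<in> {M..N}" "z \<in> {M..N}" "y \<le> z"
    show "u y \<le> u z"
    proof (rule DERIV_nonneg_imp_nondecreasing[OF \<open>y \<le> z\<close>])
      fix n assume "y \<le> n" "n \<le> z"
      then have n: "n \<ge> M" using \<open>y \<in> {M..N}\<close> by auto
      have "(u has_real_derivative (720 * a * n ^ 7 - 120 * b * n ^ 3)) (at n)"
        unfolding u_def by (auto intro!: derivative_eq_intros)
      moreover have "720 * a * n ^ 7 - 120 * b * n ^ 3 \<ge> 0"
      proof -
        have "a * n ^ 7 \<ge> 0" using a n M by auto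
        then show ?thesis using b4'(1)[OF n, of 3] by simp
      qed
      ultimately show "\<exists>d. (u has_real_derivative d) (at n) \<and> 0 \<le> d" by blast
    qed
  qed
  let ?I = "\<lambda>a b. norm (integral {a..b} (\<lambda>n. cis (q n)))"
  define s where "s = sqrt \<bar>x\<bar>"
  have s: "s > 0" "s * s = \<bar>x\<bar>" using x by (auto simp: s_def)
  show ?thesis
  proof (cases "x > 0")
    case False
    with x have x': "x < 0" by simp
    \<comment> \<open>For negative x both parts of q'' have the same sign, so the second derivative
      test covers the whole interval.\<close>
    have "?I M N \<le> 10 / sqrt \<bar>x\<bar>"
      by (rule van_der_Corput_2_neg[of M N q q' q'']) (use N dq dq' cont x' u00 in \<open>auto simp: q''_def intro: order.trans[of _ 0]\<close>)
    then show ?thesis using s unfolding s_def[symmetric] by (smt (verit) divide_right_mono)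
  next
    case True
    have sx: "sqrt x = s" using True by (simp add: s_def)
    \<comment> \<open>The levels x and 3 x for u make |q''| at least x outside [c, d] and at most x
      inside. The three pieces contribute 10 + 3 + 10 = 23.\<close>
    obtain c where c: "M \<le> c" "c \<le> N" "c = M \<or> (\<forall>n\<in>{M..c}. u n \<le> x)" "c = N \<or> (\<forall>n\<in>{c..N}. x \<le> u n)"
      using mono_threshold[OF N cont(2) mono] by metis
    have sub: "{c..N} \<subseteq> {M..N}" using c by auto
    obtain d where d: "c \<le> d" "d \<le> N" "d = c \<or> (\<forall>n\<in>{c..d}. u n \<le> 3 * x)" "d = N \<or> (\<forall>n\<in>{d..N}. 3 * x \<le> u n)"
      using mono_threshold[OF c(2) cont(2) mono_on_subset[OF mono sub]] by metis
    have 1: "?I M c \<le> 10 / s"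
    proof (cases "c = M")
      case False
      with c have "\<forall>n\<in>{M..c}. u n \<le> x" by blast
      then show ?thesis unfolding sx[symmetric]
        by (intro van_der_Corput_2[of M c q q' q'' x]) (use c dq dq' cont True in \<open>auto simp: q''_def\<close>)
    qed (use s in simp)
    have 3: "?I d N \<le> 10 / s"
    proof (cases "d = N")
      case False
      with d have "\<forall>n\<in>{d..N}. 3 * x \<le> u n" by blast
      then show ?thesis unfolding sx[symmetric]
        by (intro van_der_Corput_2_neg[of d N q q' q'' x]) (use d dq dq' cont True in \<open>auto simp: q''_def\<close>)
    qed (use s in simp)
    have 2: "?I c d \<le> 3 / s"
    proof (cases "c = d")
      case False
      with c d have u: "x \<le> u n" "u n \<le> 3 * x" if "n \<in> {c..d}" for n using that by auto
      \<comment> \<open>Here the condition \<open>1 / sqrt \<bar>x\<bar> \<le> M\<close> is used: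
        with it the lower bound x n for q' is at least sqrt x from M on.\<close>
      have "1 \<le> s * M" using x(2) s(1) unfolding s_def[symmetric] by (simp add: field_simps)
      then have "1 \<le> s * c" using c(1) s(1) by (meson mult_left_mono less_imp_le order.trans)
      have low: "x * n \<le> q' n" "s \<le> q' n" "0 < n" if n: "n \<in> {c..d}" for n
      proof -
        have nM: "M \<le> n" using n c by auto
        then show n0: "0 < n" using M by simp
        \<comment> \<open>On [c, d] one has 60 a n^8 \<le> u n \<le> 3 x, so the terms of higher
          degree in q' amount to at most 16/60 times 3 x n. That is below x n, half of the linear
          term 2 x n.\<close>
        have "10 * a * n^9 - 6 * b * n^5 \<le> 16 * a * n^9" using b4'(2)[OF nM, of 5] by simp
        also have "\<dots> = 16 / 60 * (60 * a * n ^ 8) * n" by (simp add: power_eq_if)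
        also have "\<dots> \<le> 16 / 60 * (3 * x) * n"
          using u0[OF nM] u(2)[OF n] n0 by (intro mult_right_mono mult_left_mono) auto
        also have "\<dots> \<le> x * n" using True n0 by simp
        finally show 1: "x * n \<le> q' n" unfolding q'_def by linarith
        have "s \<le> s * (s * c)" using \<open>1 \<le> s * c\<close> s(1) by simp
        also have "\<dots> \<le> x * n" using s n True unfolding mult.assoc[symmetric] by simp
        finally show "s \<le> q' n" using 1 by simp
      qed
      \<comment> \<open>q'' may vanish inside [c, d], so the derivative tests by sign fail. The
        majorant comes from |q''| \<le> x and q' \<ge> x n, and its integral is at most 1 / (x
        c).\<close>
      define g where "g = (\<lambda>n. 1 / (x * n\<^sup>2))"
      have "(g has_integral (- 1 / (x * d) - (- 1 / (x * c)))) {c..d}"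
      proof (rule fundamental_theorem_of_calculus[OF d(1)])
        fix n assume "n \<in> {c..d}"
        then have "n > 0" by (rule low)
        then show "((\<lambda>n. - 1 / (x * n)) has_vector_derivative g n) (at n within {c..d})"
          unfolding g_def using True
          by (auto intro!: derivative_eq_intros simp: power2_eq_square simp flip: has_real_derivative_iff_has_vector_derivative)
      qed
      moreover have "\<bar>q'' n\<bar> / (q' n)\<^sup>2 \<le> g n" if "n \<in> {c..d}" for n
      proof -
        have "\<bar>q'' n\<bar> \<le> x" using u[OF that] by (simp add: q''_def)
        moreover have "0 < x * n" using low(3)[OF that] True by simp
        moreover have "(x * n)\<^sup>2 \<le> (q' n)\<^sup>2" using low[OF that] True by (intro power_mono) auto
        ultimately have "\<bar>q'' n\<bar> / (q' n)\<^sup>2 \<le> x / (x * n)\<^sup>2"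
          by (intro frac_le) auto
        also have "\<dots> = g n" using True by (simp add: g_def power2_eq_square)
        finally show ?thesis .
      qed
      moreover have "s \<le> \<bar>q' n\<bar>" if "n \<in> {c..d}" for n using low(2)[OF that] by simp
      ultimately have "?I c d \<le> 2 / s + (- 1 / (x * d) - (- 1 / (x * c)))"
        using dq dq' cont(1) d(1) s(1) by (intro integral_cis_by_parts[of c d q q' q'' s g]) auto
      also have "\<dots> \<le> 2 / s + 1 / (x * c)"
        using True low(3)[of d] d(1) by simp
      also have "1 / (x * c) \<le> 1 / s"
      proof -
        have "s \<le> s * (s * c)" using \<open>1 \<le> s * c\<close> s(1) by simp
        also have "\<dots> = x * c" using s True unfolding mult.assoc[symmetric] by simp
        finally show ?thesis using s(1) by (intro divide_left_mono) auto
      qed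
      finally show ?thesis by simp
    qed (use s in simp)
    have "integral {M..N} (\<lambda>x. cis (q x)) = integral {M..c} (\<lambda>x. cis (q x)) + (integral {c..d} (\<lambda>x. cis (q x)) + integral {d..N} (\<lambda>x. cis (q x)))"
      using integral_cis_split[OF c(1,2) cont(3)] integral_cis_split[OF d(1,2) cont(3)] by simp
    then have "?I M N \<le> ?I M c + (?I c d + ?I d N)"
      by (simp only:) (intro order.trans[OF norm_triangle_ineq add_left_mono[OF norm_triangle_ineq]])
    also have "\<dots> \<le> 23 / s" using 1 2 3 by simp
    finally show ?thesis by (simp add: s_def)
  qed
qed

text \<open>The substitution \<open>\<xi> = n\<^sup>2\<close> turns the kernel with density \<open>\<bar>\<xi>\<bar> powr (- 1/2) d\<xi>\<close> into one
  without amplitude.\<close>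

lemma phase_kernel_bound:
  assumes "\<alpha> \<noteq> 0"
  obtains C where "C \<ge> 0" "\<And>x t N. x \<noteq> 0 \<Longrightarrow> 0 \<le> N \<Longrightarrow>
    norm (integral {0..N} (\<lambda>n. cis (x * n\<^sup>2 - t * phase \<alpha> \<beta> (n\<^sup>2)))) \<le> C * (1 + 1 / sqrt \<bar>x\<bar>)"
proof -
  define \<kappa> where "\<kappa> = \<bar>\<beta>\<bar> / \<bar>\<alpha>\<bar>"
  define A where "A = max 1 \<kappa>"
  have \<kappa>: "\<bar>t * \<beta>\<bar> \<le> \<kappa> * \<bar>t * \<alpha>\<bar>" for t using assms by (simp add: \<kappa>_def abs_mult)
  have A: "A \<ge> 1" "A ^ 4 \<ge> \<kappa>"
    using self_le_power[of A 4] by (auto simp: A_def)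
  have main: "norm (integral {0..N} (\<lambda>n. cis (x * n^2 - a * n^10 + b * n^6))) \<le> (A + 24) * (1 + 1 / sqrt \<bar>x\<bar>)"
    if x: "x \<noteq> 0" and N: "0 \<le> N" and a: "a \<ge> 0" and b: "\<bar>b\<bar> \<le> \<kappa> * a" for x N a b
  proof -
    let ?q = "\<lambda>n. x * n^2 - a * n^10 + b * n^6"
    define r where "r = 1 / sqrt \<bar>x\<bar>"
    have r: "r > 0" using x by (simp add: r_def)
    \<comment> \<open>Up to M the trivial bound M is already of the claimed size. M exceeds A, so
      that the quintic term dominates, and exceeds r, as the tail estimate demands. The constant A +
      24 absorbs M + 23 r.\<close>
    define M where "M = A + r"
    have M: "M \<ge> 1" "M ^ 4 \<ge> \<kappa>" "r \<le> M"
      using A r power_mono[of A M 4] unfolding M_def by linarith+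
    have cont: "continuous_on S ?q" for S by (auto intro!: continuous_intros)
    have le: "M + 23 * r \<le> (A + 24) * (1 + r)" using A r by (simp add: M_def algebra_simps)
    have "norm (integral {0..N} (\<lambda>n. cis (?q n))) \<le> M + 23 * r"
    proof (cases "N \<le> M")
      case True
      then show ?thesis using norm_integral_cis_le[OF N cont] r by linarith
    next
      case False
      have "norm (integral {0..M} (\<lambda>n. cis (?q n))) \<le> M"
        using norm_integral_cis_le[of 0 M ?q] M cont by simp
      moreover have "norm (integral {M..N} (\<lambda>n. cis (?q n))) \<le> 23 * r"
        using polynomial_phase_tail_bound[OF a b M(1,2) x M(3)[unfolded r_def], of N] False by (simp add: r_def)
      moreover have "integral {0..N} (\<lambda>n. cis (?q n)) = integral {0..M} (\<lambda>n. cis (?q n)) + integral {M..N} (\<lambda>n. cis (?q n))"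
        using False M by (intro integral_cis_split cont) auto
      ultimately show ?thesis by (simp add: norm_triangle_le)
    qed
    with le show ?thesis unfolding r_def by linarith
  qed
  have "norm (integral {0..N} (\<lambda>n. cis (x * n\<^sup>2 - t * phase \<alpha> \<beta> (n\<^sup>2)))) \<le> (A + 24) * (1 + 1 / sqrt \<bar>x\<bar>)"
    if x: "x \<noteq> 0" and N: "0 \<le> N" for x t N
  proof -
    have eq: "x * n\<^sup>2 - t * phase \<alpha> \<beta> (n\<^sup>2) = x * n^2 - (t * \<alpha>) * n^10 + (t * \<beta>) * n^6" for n
      by (simp add: phase_def algebra_simps flip: power_mult)
    show ?thesis
    proof (cases "t * \<alpha> \<ge> 0")
      case True
      then show ?thesis unfolding eq using main[OF x N True, of "t * \<beta>"] \<kappa>[of t] by simp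
    next
      case False
      then have "norm (integral {0..N} (\<lambda>n. cis ((- x) * n^2 - (- (t * \<alpha>)) * n^10 + (- (t * \<beta>)) * n^6))) \<le> (A + 24) * (1 + 1 / sqrt \<bar>x\<bar>)"
        using main[of "- x" N "- (t * \<alpha>)" "- (t * \<beta>)"] x N \<kappa>[of t] by simp
      moreover have "(- x) * n^2 - (- (t * \<alpha>)) * n^10 + (- (t * \<beta>)) * n^6 = - (x * n^2 - (t * \<alpha>) * n^10 + (t * \<beta>) * n^6)" for n
        by simp
      ultimately show ?thesis unfolding eq by (simp only: norm_integral_cis_uminus)
    qed
  qed
  then show thesis using that[of "A + 24"] A by auto
qed

section \<open>The maximal estimate\<close>

lemma jbracket_ge: "1 \<le> jbracket y" "\<bar>y\<bar> \<le> jbracket y"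
  by (auto simp: jbracket_def real_le_rsqrt)

lemma jbracket_pos [simp]: "0 < jbracket y" "jbracket y \<noteq> 0"
  using jbracket_ge(1)[of y] by linarith+

lemma jbracket_measurable [measurable]: "jbracket \<in> borel_measurable borel"
  unfolding jbracket_def by measurable

lemma phase_measurable [measurable]: "phase \<alpha> \<beta> \<in> borel_measurable borel"
  unfolding phase_def by measurable

text \<open>The threshold b > 1/2 enters here: it puts the exponent -2 b below -1. The power is
  compared with 1 near the origin and with a pure power of |y| elsewhere.\<close>

lemma nn_integral_jbracket_powr:
  assumes "b > 1 / 2"
  shows "(\<integral>\<^sup>+y. ennreal (jbracket y powr (- 2 * b)) \<partial>lborel) < \<infinity>"
proof -
  let ?f = "\<lambda>y::real. y powr (- 2 * b)"
  define J where "J = (\<integral>\<^sup>+y. ennreal (?f y * indicator {1..} y) \<partial>lborel)"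
  have "((\<lambda>y. ?f y * indicator {1..} y) has_integral (- (1 powr (- 2 * b + 1)) / (- 2 * b + 1))) UNIV"
  proof -
    have eq: "(\<lambda>y. ?f y * indicator {1..} y) = (\<lambda>y. if y \<in> {1..} then ?f y else 0)"
      by (auto simp: indicator_def)
    show ?thesis
      unfolding eq by (subst has_integral_restrict_UNIV, rule has_integral_powr_to_inf) (use assms in auto)
  qed
  then have J: "J < \<infinity>" unfolding J_def
    by (subst nn_integral_has_integral_lborel) auto
  have J': "(\<integral>\<^sup>+y. ennreal (?f (- y) * indicator {1..} (- y)) \<partial>lborel) = J"
    unfolding J_def
    using nn_integral_real_affine[of "\<lambda>y. ennreal (?f y * indicator {1..} y)" "-1" 0] by simp
  have "(\<integral>\<^sup>+y. ennreal (jbracket y powr (- 2 * b)) \<partial>lborel) \<le>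
      (\<integral>\<^sup>+y. (indicator {-1..1} y + ennreal (?f y * indicator {1..} y)) + ennreal (?f (- y) * indicator {1..} (- y)) \<partial>lborel)"
  proof (rule nn_integral_mono)
    fix y :: real
    have 1: "jbracket y powr (- 2 * b) \<le> 1"
      using powr_mono[of "- 2 * b" 0 "jbracket y"] jbracket_ge(1)[of y] assms by simp
    have 2: "jbracket y powr (- 2 * b) \<le> \<bar>y\<bar> powr (- 2 * b)" if "\<bar>y\<bar> \<ge> 1"
      using powr_mono2'[of "- 2 * b" "\<bar>y\<bar>" "jbracket y"] jbracket_ge(2)[of y] assms that by simp
    consider "\<bar>y\<bar> \<le> 1" | "y > 1" | "y < -1" by linarith
    then show "ennreal (jbracket y powr (- 2 * b)) \<le> (indicator {-1..1} y + ennreal (?f y * indicator {1..} y)) + ennreal (?f (- y) * indicator {1..} (- y))"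
    proof cases
      case 1
      then have "ennreal (jbracket y powr (- 2 * b)) \<le> indicator {-1..1} y"
        using \<open>jbracket y powr (- 2 * b) \<le> 1\<close> by (auto simp: indicator_def)
      then show ?thesis by (meson add_increasing2 zero_le)
    next
      case 2
      then show ?thesis using \<open>\<bar>y\<bar> \<ge> 1 \<Longrightarrow> _\<close> by (auto simp: indicator_def intro!: ennreal_leI)
    next
      case 3
      then show ?thesis using \<open>\<bar>y\<bar> \<ge> 1 \<Longrightarrow> _\<close> by (auto simp: indicator_def intro!: ennreal_leI)
    qed
  qed
  also have "\<dots> = 2 + J + J"
    by (subst nn_integral_add, simp, simp, subst nn_integral_add) (use J' in \<open>auto simp: J_def\<close>)
  also have "\<dots> < \<infinity>" using J by (simp add: less_top)
  finally show ?thesis .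
qed

text \<open>Substituting the square of a new variable turns the integrand on each half into at most
  the constant 2.\<close>

lemma nn_integral_inverse_sqrt:
  "(\<integral>\<^sup>+x. ennreal (1 / sqrt \<bar>x\<bar>) * indicator {-1..1} x \<partial>lborel) \<le> 4"
proof -
  have pos: "(\<integral>\<^sup>+x. ennreal (1 / sqrt \<bar>x\<bar>) * indicator {0..1} x \<partial>lborel) \<le> 2"
  proof -
    have "(\<integral>\<^sup>+x. ennreal (1 / sqrt \<bar>x\<bar>) * indicator {0..1} x \<partial>lborel) =
        (\<integral>\<^sup>+x. ennreal (1 / sqrt \<bar>x\<bar>) * indicator {0\<^sup>2..1\<^sup>2} x \<partial>lborel)" by simp
    also have "\<dots> = (\<integral>\<^sup>+x. ennreal (1 / sqrt \<bar>x\<^sup>2\<bar>) * ennreal (2 * x) * indicator {0..1} x \<partial>lborel)"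
      by (rule nn_integral_substitution_aux[where g="\<lambda>x. x\<^sup>2" and g'="\<lambda>x. 2 * x"])
        (auto intro!: derivative_eq_intros continuous_intros)
    also have "\<dots> \<le> (\<integral>\<^sup>+x. 2 * indicator {0..1::real} x \<partial>lborel)"
      by (intro nn_integral_mono) (auto simp: indicator_def ennreal_mult[symmetric])
    also have "\<dots> = 2" by (simp add: nn_integral_cmult)
    finally show ?thesis .
  qed
  have neg: "(\<integral>\<^sup>+x. ennreal (1 / sqrt \<bar>x\<bar>) * indicator {0..1} (- x) \<partial>lborel) =
     (\<integral>\<^sup>+x. ennreal (1 / sqrt \<bar>x\<bar>) * indicator {0..1} x \<partial>lborel)"
    by (subst (2) nn_integral_real_affine[of _ "-1" 0]) auto
  have "(\<integral>\<^sup>+x. ennreal (1 / sqrt \<bar>x\<bar>) * indicator {-1..1} x \<partial>lborel) \<le>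
     (\<integral>\<^sup>+x. ennreal (1 / sqrt \<bar>x\<bar>) * indicator {0..1} x + ennreal (1 / sqrt \<bar>x\<bar>) * indicator {0..1} (- x) \<partial>lborel)"
    by (intro nn_integral_mono) (auto simp: indicator_def)
  also have "\<dots> \<le> 2 + 2"
    by (subst nn_integral_add) (auto simp: neg simp del: numeral_plus_numeral intro!: add_mono pos)
  finally show ?thesis by simp
qed

lemma nn_integral_gaussian: "(\<integral>\<^sup>+x. ennreal (gaussian (x::real)) \<partial>lborel) = ennreal (sqrt (2 * pi))"
  by (subst nn_integral_eq_integral[OF gaussian_integrable])
    (auto simp: gaussian_lebesgue_integral less_imp_le[OF gaussian_pos] powr_half_sqrt)

text \<open>The integral over y is bounded uniformly in x. Near the diagonal the singularity is
  integrable and the Gaussian is at most 1; at distance over 1 the kernel is at most 2 and the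
  Gaussian is integrable. The second Gaussian then integrates in x.\<close>

lemma gaussian_kernel_integral:
  "(\<integral>\<^sup>+x. \<integral>\<^sup>+y. ennreal (gaussian x * gaussian y * (1 + 1 / sqrt \<bar>x - y\<bar>)) \<partial>lborel \<partial>lborel)
     \<le> ennreal (sqrt (2 * pi)) * (2 * ennreal (sqrt (2 * pi)) + 4)"
proof -
  have inner: "(\<integral>\<^sup>+y. ennreal (gaussian y * (1 + 1 / sqrt \<bar>x - y\<bar>)) \<partial>lborel) \<le> 2 * ennreal (sqrt (2 * pi)) + 4" for x :: real
  proof -
    have "(\<integral>\<^sup>+y. ennreal (gaussian y * (1 + 1 / sqrt \<bar>x - y\<bar>)) \<partial>lborel) \<le>
       (\<integral>\<^sup>+y. 2 * ennreal (gaussian y) + ennreal (1 / sqrt \<bar>x - y\<bar>) * indicator {-1..1} (x - y) \<partial>lborel)"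
    proof (rule nn_integral_mono)
      fix y :: real
      have g: "0 \<le> gaussian y" "gaussian y \<le> 1" using gaussian_pos[of y] gaussian_le_1[of y] by auto
      show "ennreal (gaussian y * (1 + 1 / sqrt \<bar>x - y\<bar>)) \<le> 2 * ennreal (gaussian y) + ennreal (1 / sqrt \<bar>x - y\<bar>) * indicator {-1..1} (x - y)"
      proof (cases "\<bar>x - y\<bar> \<le> 1")
        case True
        have "gaussian y * (1 + 1 / sqrt \<bar>x - y\<bar>) \<le> 2 * gaussian y + 1 / sqrt \<bar>x - y\<bar>"
          using g mult_right_mono[OF g(2), of "1 / sqrt \<bar>x - y\<bar>"] by (simp add: algebra_simps)
        then have "ennreal (gaussian y * (1 + 1 / sqrt \<bar>x - y\<bar>)) \<le> ennreal (2 * gaussian y + 1 / sqrt \<bar>x - y\<bar>)"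
          by (rule ennreal_leI)
        also have "\<dots> = 2 * ennreal (gaussian y) + ennreal (1 / sqrt \<bar>x - y\<bar>) * indicator {-1..1} (x - y)"
          using True g by (simp add: ennreal_mult' abs_le_iff indicator_def)
        finally show ?thesis .
      next
        case False
        then have "1 / sqrt \<bar>x - y\<bar> \<le> 1" by simp
        then have "gaussian y * (1 + 1 / sqrt \<bar>x - y\<bar>) \<le> gaussian y * 2"
          using g by (intro mult_left_mono) auto
        then have "ennreal (gaussian y * (1 + 1 / sqrt \<bar>x - y\<bar>)) \<le> ennreal (2 * gaussian y)"
          by (intro ennreal_leI) simp
        also have "\<dots> = 2 * ennreal (gaussian y)" using g by (simp add: ennreal_mult')
        finally show ?thesis by (meson add_increasing2 zero_le)
      qed
    qed
    also have "\<dots> = 2 * ennreal (sqrt (2 * pi)) + (\<integral>\<^sup>+y. ennreal (1 / sqrt \<bar>x - y\<bar>) * indicator {-1..1} (x - y) \<partial>lborel)"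
      by (subst nn_integral_add) (auto simp: nn_integral_cmult nn_integral_gaussian)
    also have "(\<integral>\<^sup>+y. ennreal (1 / sqrt \<bar>x - y\<bar>) * indicator {-1..1} (x - y) \<partial>lborel) =
      (\<integral>\<^sup>+y. ennreal (1 / sqrt \<bar>y\<bar>) * indicator {-1..1} y \<partial>lborel)"
      by (subst (2) nn_integral_real_affine[of _ "-1" x]) auto
    finally show ?thesis
      using nn_integral_inverse_sqrt by (meson add_left_mono order.trans)
  qed
  have "(\<integral>\<^sup>+x. \<integral>\<^sup>+y. ennreal (gaussian x * gaussian y * (1 + 1 / sqrt \<bar>x - y\<bar>)) \<partial>lborel \<partial>lborel) =
     (\<integral>\<^sup>+x. ennreal (gaussian x) * (\<integral>\<^sup>+y. ennreal (gaussian y * (1 + 1 / sqrt \<bar>x - y\<bar>)) \<partial>lborel) \<partial>lborel)"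
    by (subst nn_integral_cmult[symmetric])
      (auto simp: ennreal_mult[symmetric] mult.assoc less_imp_le[OF gaussian_pos])
  also have "\<dots> \<le> (\<integral>\<^sup>+x. ennreal (gaussian (x::real)) * (2 * ennreal (sqrt (2 * pi)) + 4) \<partial>lborel)"
    by (intro nn_integral_mono mult_left_mono inner) auto
  also have "\<dots> = ennreal (sqrt (2 * pi)) * (2 * ennreal (sqrt (2 * pi)) + 4)"
    by (simp add: nn_integral_multc nn_integral_gaussian)
  finally show ?thesis .
qed

section \<open>Square bounds for the adjoint of evaluation along a curve\<close>

text \<open>The adjoint of \<open>V \<mapsto> (\<lambda>x. V (x, \<theta> x))\<close>, on the Fourier side. A measurable time \<open>\<theta>\<close> at which
  \<open>t \<mapsto> \<bar>V (x, t)\<bar>\<close> is nearly maximal linearises the maximal function.\<close>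

definition curve_transform :: "(real \<Rightarrow> real) \<Rightarrow> (real \<Rightarrow> complex) \<Rightarrow> real \<Rightarrow> real \<Rightarrow> complex" where
  "curve_transform \<theta> h \<xi> \<tau> = (\<integral>x. cis (x * \<xi> + \<theta> x * \<tau>) * h x \<partial>lborel)"

lemma cnj_measurable [measurable]: "cnj \<in> borel_measurable borel"
  by (intro borel_measurable_continuous_onI continuous_intros)

lemma cis_measurable [measurable]: "cis \<in> borel_measurable borel"
  by (intro borel_measurable_continuous_onI continuous_intros)

lemma curve_transform_measurable [measurable]:
  assumes [measurable]: "\<theta> \<in> borel_measurable borel" "h \<in> borel_measurable borel"
  shows "(\<lambda>(\<xi>, \<tau>). curve_transform \<theta> h \<xi> \<tau>) \<in> borel_measurable borel"
proof -
  have "(\<lambda>p. \<integral>x. cis (x * fst p + \<theta> x * snd p) * h x \<partial>lborel) \<in> borel_measurable (borel \<Otimes>\<^sub>M borel)"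
    by measurable
  then show ?thesis by (simp add: curve_transform_def case_prod_beta borel_prod)
qed

lemma curve_transform_measurable' [measurable (raw)]:
  assumes [measurable]: "\<theta> \<in> borel_measurable borel" "h \<in> borel_measurable borel"
    "f \<in> borel_measurable M" "g \<in> borel_measurable M"
  shows "(\<lambda>w. curve_transform \<theta> h (f w) (g w)) \<in> borel_measurable M"
proof -
  have "(\<lambda>w. (\<lambda>(\<xi>, \<tau>). curve_transform \<theta> h \<xi> \<tau>) (f w, g w)) \<in> borel_measurable M"
    by (rule measurable_compose[OF _ curve_transform_measurable]) auto
  then show ?thesis by simp
qed

text \<open>The T T* step. The square expands into a double integral over x and y, and integrating
  over n first leaves the kernel at x - y and \<theta> x - \<theta> y, where the assumed bound is
  uniform in the second argument. The range {0..N} ensures absolute convergence, and the result does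
  not depend on N. The pair p, r leaves room for either sign of the frequency.\<close>

lemma curve_transform_square_integral:
  fixes p r :: "real \<Rightarrow> real" and N :: real
  assumes [measurable]: "\<theta> \<in> borel_measurable borel" "h \<in> borel_measurable borel"
    and h: "\<And>x. cmod (h x) \<le> gaussian x"
    and C: "\<And>x t. x \<noteq> 0 \<Longrightarrow> norm (integral {0..N} (\<lambda>n. cis (x * p n + t * r n))) \<le> C * (1 + 1 / sqrt \<bar>x\<bar>)"
    and C0: "C \<ge> 0"
    and cont: "continuous_on UNIV p" "continuous_on UNIV r"
  shows "(\<integral>\<^sup>+n. ennreal ((cmod (curve_transform \<theta> h (p n) (r n)))\<^sup>2) * indicator {0..N} n \<partial>lborel)
     \<le> ennreal C * (ennreal (sqrt (2 * pi)) * (2 * ennreal (sqrt (2 * pi)) + 4))"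
proof -
  note [measurable] = borel_measurable_continuous_onI[OF cont(1)] borel_measurable_continuous_onI[OF cont(2)]
  define H where "H = (\<lambda>n. curve_transform \<theta> h (p n) (r n))"
  have [measurable]: "H \<in> borel_measurable borel" unfolding H_def by measurable
  \<comment> \<open>The integrand of |H n|^2 with both integrals written out. The indicator makes it
    integrable in all three variables, as Fubini requires.\<close>
  define F where "F = (\<lambda>n (x, y). indicator {0..N} n *\<^sub>R (cis ((x - y) * p n + (\<theta> x - \<theta> y) * r n) * (h x * cnj (h y))))"
  have hint: "integrable lborel h"
    by (rule Bochner_Integration.integrable_bound[OF gaussian_integrable]) (auto intro: order.trans[OF h] simp: abs_of_pos[OF gaussian_pos])
  have gint: "integrable lborel (\<lambda>x::real. complex_of_real (gaussian x))" by (intro integrable_of_real gaussian_integrable)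
  have hcint: "integrable lborel (\<lambda>x. cnj (h x))" using hint by simp
  have hh: "integrable (lborel \<Otimes>\<^sub>M lborel) (\<lambda>(x, y). h x * cnj (h y))"
    by (rule integrable_pair_bound[OF _ _ hint hcint]) (auto simp: norm_mult lborel.sigma_finite_measure_axioms)
  have iN: "integrable lborel (\<lambda>n::real. complex_of_real (indicator {0..N} n))"
    by (intro integrable_of_real integrable_real_indicator) (auto simp: emeasure_lborel_Icc_eq)
  have Fint: "integrable (lborel \<Otimes>\<^sub>M (lborel \<Otimes>\<^sub>M lborel)) (case_prod F)"
  proof (rule integrable_pair_bound[OF _ _ iN hh])
    show "sigma_finite_measure (lborel \<Otimes>\<^sub>M lborel :: (real \<times> real) measure)"
      by (simp add: lborel_prod lborel.sigma_finite_measure_axioms)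
  qed (auto simp: F_def norm_mult lborel.sigma_finite_measure_axioms indicator_def case_prod_beta)
  interpret P: pair_sigma_finite "lborel :: real measure" "lborel \<Otimes>\<^sub>M lborel :: (real \<times> real) measure"
    unfolding pair_sigma_finite_def by (simp add: lborel_prod lborel.sigma_finite_measure_axioms)
  have HF: "(\<integral>z. F n z \<partial>(lborel \<Otimes>\<^sub>M lborel)) = complex_of_real ((cmod (H n))\<^sup>2 * indicator {0..N} n)" for n
  proof -
    have i: "integrable (lborel \<Otimes>\<^sub>M lborel) (\<lambda>(x, y). cis ((x - y) * p n + (\<theta> x - \<theta> y) * r n) * (h x * cnj (h y)))"
      by (rule integrable_pair_bound[OF _ _ hint hcint]) (auto simp: norm_mult lborel.sigma_finite_measure_axioms)
    have "(\<integral>z. F n z \<partial>(lborel \<Otimes>\<^sub>M lborel)) = indicator {0..N} n *\<^sub>R (\<integral>z. (\<lambda>(x, y). cis ((x - y) * p n + (\<theta> x - \<theta> y) * r n) * (h x * cnj (h y))) z \<partial>(lborel \<Otimes>\<^sub>M lborel))"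
      by (simp add: F_def case_prod_beta)
    also have "(\<integral>z. (\<lambda>(x, y). cis ((x - y) * p n + (\<theta> x - \<theta> y) * r n) * (h x * cnj (h y))) z \<partial>(lborel \<Otimes>\<^sub>M lborel)) =
       (\<integral>x. \<integral>y. cis ((x - y) * p n + (\<theta> x - \<theta> y) * r n) * (h x * cnj (h y)) \<partial>lborel \<partial>lborel)"
      using lborel_pair.integral_fst'[OF i] by simp
    also have "\<dots> = (\<integral>x. \<integral>y. (cis (x * p n + \<theta> x * r n) * h x) * cnj (cis (y * p n + \<theta> y * r n) * h y) \<partial>lborel \<partial>lborel)"
    proof (intro Bochner_Integration.integral_cong refl)
      fix x y
      have "cis ((x - y) * p n + (\<theta> x - \<theta> y) * r n) = cis (x * p n + \<theta> x * r n) * cnj (cis (y * p n + \<theta> y * r n))"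
        unfolding cis_cnj cis_mult by (intro arg_cong[where f=cis]) (simp add: algebra_simps)
      then show "cis ((x - y) * p n + (\<theta> x - \<theta> y) * r n) * (h x * cnj (h y)) = (cis (x * p n + \<theta> x * r n) * h x) * cnj (cis (y * p n + \<theta> y * r n) * h y)"
        by (simp add: mult_ac)
    qed
    also have "\<dots> = H n * cnj (H n)"
      unfolding H_def curve_transform_def by (simp only: integral_mult_right_zero integral_mult_left_zero Bochner_Integration.integral_cnj)
    also have "\<dots> = complex_of_real ((cmod (H n))\<^sup>2)" by (rule complex_norm_square[symmetric])
    finally show ?thesis by (simp add: scaleR_conv_of_real mult.commute)
  qed
  have Hint: "integrable lborel (\<lambda>n. complex_of_real ((cmod (H n))\<^sup>2 * indicator {0..N} n))"
    using P.integrable_fst[OF Fint] unfolding HF .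
  then have Hint': "integrable lborel (\<lambda>n. (cmod (H n))\<^sup>2 * indicator {0..N} n)"
    using integrable_Re by fastforce
  let ?K = "\<lambda>z. \<integral>n. F n z \<partial>lborel"
  have "ennreal (\<integral>n. (cmod (H n))\<^sup>2 * indicator {0..N} n \<partial>lborel) = ennreal (cmod (\<integral>n. complex_of_real ((cmod (H n))\<^sup>2 * indicator {0..N} n) \<partial>lborel))"
    by (subst integral_complex_of_real) (simp add: integral_nonneg_AE)
  also have "\<dots> = ennreal (cmod (\<integral>z. ?K z \<partial>(lborel \<Otimes>\<^sub>M lborel)))"
    unfolding HF[symmetric] using P.Fubini_integral[OF Fint] by simp
  also have "\<dots> \<le> (\<integral>\<^sup>+z. ennreal (cmod (?K z)) \<partial>(lborel \<Otimes>\<^sub>M lborel))"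
    using P.integrable_snd[OF Fint] by (rule integral_norm_bound_ennreal)
  also have "\<dots> = (\<integral>\<^sup>+x. \<integral>\<^sup>+y. ennreal (cmod (?K (x, y))) \<partial>lborel \<partial>lborel)"
    using P.integrable_snd[OF Fint] by (subst lborel.nn_integral_fst[symmetric]) auto
  also have "\<dots> \<le> (\<integral>\<^sup>+x. \<integral>\<^sup>+y. ennreal C * ennreal (gaussian x * gaussian y * (1 + 1 / sqrt \<bar>x - y\<bar>)) \<partial>lborel \<partial>lborel)"
  \<comment> \<open>The kernel bound excludes the diagonal, which for each x is a single point
    y.\<close>
  proof (rule nn_integral_mono, rule nn_integral_mono_AE)
    fix x :: real
    have "ennreal (cmod (?K (x, y))) \<le> ennreal C * ennreal (gaussian x * gaussian y * (1 + 1 / sqrt \<bar>x - y\<bar>))" if "y \<noteq> x" for y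
    proof -
      let ?c = "\<lambda>n. cis ((x - y) * p n + (\<theta> x - \<theta> y) * r n)"
      have si: "set_integrable lborel {0..N} ?c"
        by (rule borel_integrable_atLeastAtMost') (intro continuous_intros continuous_on_subset[OF cont(1)] continuous_on_subset[OF cont(2)]; simp)
      have "?K (x, y) = (\<integral>n. (indicator {0..N} n *\<^sub>R ?c n) * (h x * cnj (h y)) \<partial>lborel)"
        by (simp add: F_def)
      also have "\<dots> = (LINT n:{0..N}|lborel. ?c n) * (h x * cnj (h y))"
        unfolding set_lebesgue_integral_def by (rule integral_mult_left_zero)
      also have "(LINT n:{0..N}|lborel. ?c n) = integral {0..N} ?c"
        by (rule set_borel_integral_eq_integral(2)[OF si])
      finally have "cmod (?K (x, y)) = cmod (integral {0..N} ?c) * (cmod (h x) * cmod (h y))"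
        by (simp add: norm_mult)
      also have "\<dots> \<le> (C * (1 + 1 / sqrt \<bar>x - y\<bar>)) * (gaussian x * gaussian y)"
        using that C0 by (intro mult_mono C h mult_nonneg_nonneg less_imp_le[OF gaussian_pos]) auto
      finally have "ennreal (cmod (?K (x, y))) \<le> ennreal (C * (gaussian x * gaussian y * (1 + 1 / sqrt \<bar>x - y\<bar>)))"
        by (intro ennreal_leI) (simp add: mult_ac)
      then show ?thesis using C0 by (simp add: ennreal_mult')
    qed
    moreover have "AE y in lborel. y \<noteq> x" by (rule AE_lborel_singleton)
    ultimately show "AE y in lborel. ennreal (cmod (?K (x, y))) \<le> ennreal C * ennreal (gaussian x * gaussian y * (1 + 1 / sqrt \<bar>x - y\<bar>))"
      by auto
  qed
  also have "\<dots> = ennreal C * (\<integral>\<^sup>+x. \<integral>\<^sup>+y. ennreal (gaussian x * gaussian y * (1 + 1 / sqrt \<bar>x - y\<bar>)) \<partial>lborel \<partial>lborel)"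
    by (simp add: nn_integral_cmult)
  also have "\<dots> \<le> ennreal C * (ennreal (sqrt (2 * pi)) * (2 * ennreal (sqrt (2 * pi)) + 4))"
    by (intro mult_left_mono gaussian_kernel_integral) auto
  finally have "ennreal (\<integral>n. (cmod (H n))\<^sup>2 * indicator {0..N} n \<partial>lborel) \<le> ennreal C * (ennreal (sqrt (2 * pi)) * (2 * ennreal (sqrt (2 * pi)) + 4))" .
  moreover have "(\<integral>\<^sup>+n. ennreal ((cmod (H n))\<^sup>2) * indicator {0..N} n \<partial>lborel) = ennreal (\<integral>n. (cmod (H n))\<^sup>2 * indicator {0..N} n \<partial>lborel)"
    by (subst nn_integral_eq_integral[OF Hint', symmetric]) (auto simp: ennreal_mult' ennreal_indicator)
  ultimately show ?thesis by (simp add: H_def)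
qed

text \<open>Domination by the Gaussian makes integrals along the curve absolutely convergent, and it
  is stable under multiplication by unimodular functions of x.\<close>

definition curve_datum :: "(real \<Rightarrow> real) \<Rightarrow> (real \<Rightarrow> complex) \<Rightarrow> bool" where
  "curve_datum \<theta> h \<longleftrightarrow> \<theta> \<in> borel_measurable borel \<and> h \<in> borel_measurable borel \<and> (\<forall>x. cmod (h x) \<le> gaussian x)"

text \<open>This is the maximal estimate for the free flow in dual form: the second argument -
  \<phi> \<xi> restricts the transform to the characteristic curve of U(t).\<close>

lemma curve_transform_weighted:
  assumes \<alpha>: "\<alpha> \<noteq> 0" and s: "s \<ge> 1 / 4"
  obtains B where "B < \<infinity>" "\<And>\<theta> h. curve_datum \<theta> h \<Longrightarrow>
    (\<integral>\<^sup>+\<xi>. ennreal (jbracket \<xi> powr (- 2 * s) * (cmod (curve_transform \<theta> h \<xi> (- phase \<alpha> \<beta> \<xi>)))\<^sup>2) \<partial>lborel) \<le> B"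
proof -
  obtain C where C: "C \<ge> 0" "\<And>x t N. x \<noteq> 0 \<Longrightarrow> 0 \<le> N \<Longrightarrow>
    norm (integral {0..N} (\<lambda>n. cis (x * n\<^sup>2 - t * phase \<alpha> \<beta> (n\<^sup>2)))) \<le> C * (1 + 1 / sqrt \<bar>x\<bar>)"
    by (rule phase_kernel_bound[OF \<alpha>, of \<beta>]) (rule that, auto)
  define B where "B = ennreal C * (ennreal (sqrt (2 * pi)) * (2 * ennreal (sqrt (2 * pi)) + 4))"
  have B: "B < \<infinity>" by (simp add: B_def ennreal_mult_less_top)
  have odd: "phase \<alpha> \<beta> (- y) = - phase \<alpha> \<beta> y" for y by (simp add: phase_def)
  have phase_cont: "continuous_on S (phase \<alpha> \<beta>)" for S unfolding phase_def by (intro continuous_intros)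
  have main: "(\<integral>\<^sup>+\<xi>. ennreal (jbracket \<xi> powr (- 2 * s) * (cmod (curve_transform \<theta> h \<xi> (- phase \<alpha> \<beta> \<xi>)))\<^sup>2) \<partial>lborel) \<le> 4 * B"
    if "curve_datum \<theta> h" for \<theta> h
  proof -
    have [measurable]: "\<theta> \<in> borel_measurable borel" "h \<in> borel_measurable borel" and h: "\<And>x. cmod (h x) \<le> gaussian x"
      using that by (auto simp: curve_datum_def)
    define f where "f = (\<lambda>\<xi>. ennreal (jbracket \<xi> powr (- 2 * s) * (cmod (curve_transform \<theta> h \<xi> (- phase \<alpha> \<beta> \<xi>)))\<^sup>2))"
    have [measurable]: "f \<in> borel_measurable borel" unfolding f_def by measurable
    \<comment> \<open>The substitution \<xi> = \<sigma> y^2 reaches one half-line for each sign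
      \<sigma>. As the phase is odd, the sign can be moved onto x and t, for which the kernel bound
      is symmetric.\<close>
    have half: "(\<integral>\<^sup>+\<xi>. f (\<sigma> * \<xi>) * indicator {0..(real n)\<^sup>2} \<xi> \<partial>lborel) \<le> 2 * B"
      if \<sigma>: "\<sigma> = 1 \<or> \<sigma> = -1" for \<sigma> n
    proof (cases "n = 0")
      case True
      have "(\<integral>\<^sup>+\<xi>. f (\<sigma> * \<xi>) * indicator {0} \<xi> \<partial>lborel) = 0"
        by (subst nn_integral_indicator_singleton) auto
      then show ?thesis using True by simp
    next
      case False
      have "(\<integral>\<^sup>+\<xi>. f (\<sigma> * \<xi>) * indicator {0..(real n)\<^sup>2} \<xi> \<partial>lborel) = (\<integral>\<^sup>+\<xi>. f (\<sigma> * \<xi>) * indicator {0\<^sup>2..(real n)\<^sup>2} \<xi> \<partial>lborel)"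
        by simp
      also have "\<dots> = (\<integral>\<^sup>+n'. f (\<sigma> * n'\<^sup>2) * ennreal (2 * n') * indicator {0..real n} n' \<partial>lborel)"
        using False by (intro nn_integral_substitution_aux[where g="\<lambda>x. x\<^sup>2" and g'="\<lambda>x. 2 * x"])
          (auto intro!: derivative_eq_intros continuous_intros)
      also have "\<dots> \<le> (\<integral>\<^sup>+y. 2 * (ennreal ((cmod (curve_transform \<theta> h (\<sigma> * y\<^sup>2) (- (\<sigma> * phase \<alpha> \<beta> (y\<^sup>2)))))\<^sup>2) * indicator {0..real n} y) \<partial>lborel)"
      proof (rule nn_integral_mono)
        fix y :: real
        have ph: "phase \<alpha> \<beta> (\<sigma> * y\<^sup>2) = \<sigma> * phase \<alpha> \<beta> (y\<^sup>2)" using \<sigma> odd by auto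
        let ?c = "(cmod (curve_transform \<theta> h (\<sigma> * y\<^sup>2) (- (\<sigma> * phase \<alpha> \<beta> (y\<^sup>2)))))\<^sup>2"
        show "f (\<sigma> * y\<^sup>2) * ennreal (2 * y) * indicator {0..real n} y \<le> 2 * (ennreal ?c * indicator {0..real n} y)"
        proof (cases "0 \<le> y")
          case True
          let ?j = "jbracket (\<sigma> * y\<^sup>2)"
          \<comment> \<open>The threshold 1/4 enters here: the weight must compensate the Jacobian 2
            y, and y is at most the bracket to the power 1/2.\<close>
          have "?j powr (- 2 * s) \<le> ?j powr (- 1 / 2)"
            using s jbracket_ge(1) by (intro powr_mono) auto
          moreover have "y \<le> ?j powr (1 / 2)"
          proof -
            have "(y\<^sup>2) powr (1 / 2) \<le> ?j powr (1 / 2)"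
              using jbracket_ge(2)[of "\<sigma> * y\<^sup>2"] \<sigma> by (intro powr_mono2) auto
            then show ?thesis using True by (simp add: powr_half_sqrt)
          qed
          ultimately have "?j powr (- 2 * s) * y \<le> ?j powr (- 1 / 2) * ?j powr (1 / 2)"
            using True by (intro mult_mono) auto
          also have "\<dots> = 1" by (simp flip: powr_add)
          finally have "?j powr (- 2 * s) * y \<le> 1" .
          then have "(?j powr (- 2 * s) * y) * (2 * ?c) \<le> 1 * (2 * ?c)" by (intro mult_right_mono) auto
          then have "ennreal ((?j powr (- 2 * s) * ?c) * (2 * y)) \<le> ennreal (2 * ?c)"
            by (intro ennreal_leI) (simp add: mult_ac)
          then have "f (\<sigma> * y\<^sup>2) * ennreal (2 * y) \<le> 2 * ennreal ?c"
            unfolding f_def ph using True by (simp add: ennreal_mult')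
          then show ?thesis by (auto simp: indicator_def)
        qed auto
      qed
      also have "\<dots> = 2 * (\<integral>\<^sup>+y. ennreal ((cmod (curve_transform \<theta> h (\<sigma> * y\<^sup>2) (- (\<sigma> * phase \<alpha> \<beta> (y\<^sup>2)))))\<^sup>2) * indicator {0..real n} y \<partial>lborel)"
        by (rule nn_integral_cmult) measurable
      also have "\<dots> \<le> 2 * B"
      proof (intro mult_left_mono)
        show "(\<integral>\<^sup>+y. ennreal ((cmod (curve_transform \<theta> h (\<sigma> * y\<^sup>2) (- (\<sigma> * phase \<alpha> \<beta> (y\<^sup>2)))))\<^sup>2) * indicator {0..real n} y \<partial>lborel) \<le> B"
          unfolding B_def
        proof (rule curve_transform_square_integral)
          fix x t :: real assume x: "x \<noteq> 0"
          have "norm (integral {0..real n} (\<lambda>n. cis ((\<sigma> * x) * n\<^sup>2 - (\<sigma> * t) * phase \<alpha> \<beta> (n\<^sup>2)))) \<le> C * (1 + 1 / sqrt \<bar>\<sigma> * x\<bar>)"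
            using x \<sigma> by (intro C) auto
          also have "\<bar>\<sigma> * x\<bar> = \<bar>x\<bar>" using \<sigma> by auto
          finally show "norm (integral {0..real n} (\<lambda>n. cis (x * (\<sigma> * n\<^sup>2) + t * - (\<sigma> * phase \<alpha> \<beta> (n\<^sup>2))))) \<le> C * (1 + 1 / sqrt \<bar>x\<bar>)"
            by (simp add: mult_ac)
        qed (use h C in \<open>auto intro!: continuous_intros continuous_on_compose2[OF phase_cont]\<close>)
      qed auto
      finally show ?thesis .
    qed
    have sq: "(\<integral>\<^sup>+\<xi>. f \<xi> * indicator {-((real n)\<^sup>2)..(real n)\<^sup>2} \<xi> \<partial>lborel) \<le> 4 * B" for n
    proof -
      have "(\<integral>\<^sup>+\<xi>. f \<xi> * indicator {-((real n)\<^sup>2)..(real n)\<^sup>2} \<xi> \<partial>lborel) \<le>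
         (\<integral>\<^sup>+\<xi>. f \<xi> * indicator {0..(real n)\<^sup>2} \<xi> + f \<xi> * indicator {0..(real n)\<^sup>2} (- \<xi>) \<partial>lborel)"
        by (intro nn_integral_mono) (auto simp: indicator_def)
      also have "\<dots> = (\<integral>\<^sup>+\<xi>. f (1 * \<xi>) * indicator {0..(real n)\<^sup>2} \<xi> \<partial>lborel) + (\<integral>\<^sup>+\<xi>. f \<xi> * indicator {0..(real n)\<^sup>2} (- \<xi>) \<partial>lborel)"
        by (subst nn_integral_add) auto
      also have "(\<integral>\<^sup>+\<xi>. f \<xi> * indicator {0..(real n)\<^sup>2} (- \<xi>) \<partial>lborel) = (\<integral>\<^sup>+\<xi>. f (-1 * \<xi>) * indicator {0..(real n)\<^sup>2} \<xi> \<partial>lborel)"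
        by (subst nn_integral_real_affine[of _ "-1" 0]) auto
      also have "(\<integral>\<^sup>+\<xi>. f (1 * \<xi>) * indicator {0..(real n)\<^sup>2} \<xi> \<partial>lborel) + (\<integral>\<^sup>+\<xi>. f (-1 * \<xi>) * indicator {0..(real n)\<^sup>2} \<xi> \<partial>lborel) \<le> 2 * B + 2 * B"
        by (intro add_mono half) auto
      also have "\<dots> = 4 * B" by (simp flip: distrib_right)
      finally show ?thesis .
    qed
    \<comment> \<open>The bounds on [-n^2, n^2] do not depend on n, so monotone convergence removes
      the frequency cutoff.\<close>
    have "(\<integral>\<^sup>+\<xi>. f \<xi> \<partial>lborel) = (\<integral>\<^sup>+\<xi>. (SUP n. f \<xi> * indicator {-((real n)\<^sup>2)..(real n)\<^sup>2} \<xi>) \<partial>lborel)"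
    proof (intro nn_integral_cong antisym)
      fix \<xi> :: real
      obtain n :: nat where n: "\<bar>\<xi>\<bar> \<le> real n" using real_arch_simple by blast
      also have "real n \<le> (real n)\<^sup>2" by (simp add: power2_eq_square flip: of_nat_mult)
      finally have "f \<xi> \<le> f \<xi> * indicator {-((real n)\<^sup>2)..(real n)\<^sup>2} \<xi>" by (auto simp: indicator_def)
      then show "f \<xi> \<le> (SUP n. f \<xi> * indicator {-((real n)\<^sup>2)..(real n)\<^sup>2} \<xi>)"
        by (intro SUP_upper2[of n]) auto
      show "(SUP n. f \<xi> * indicator {-((real n)\<^sup>2)..(real n)\<^sup>2} \<xi>) \<le> f \<xi>"
        by (intro SUP_least) (auto simp: indicator_def)
    qed
    also have "\<dots> = (SUP n. \<integral>\<^sup>+\<xi>. f \<xi> * indicator {-((real n)\<^sup>2)..(real n)\<^sup>2} \<xi> \<partial>lborel)"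
    proof (rule nn_integral_monotone_convergence_SUP)
      show "incseq (\<lambda>n \<xi>. f \<xi> * indicator {-((real n)\<^sup>2)..(real n)\<^sup>2} \<xi>)"
      proof (intro incseq_SucI le_funI mult_left_mono)
        fix n \<xi>
        have "(real n)\<^sup>2 \<le> (real (Suc n))\<^sup>2" by (intro power_mono) auto
        then show "indicator {-((real n)\<^sup>2)..(real n)\<^sup>2} \<xi> \<le> (indicator {-((real (Suc n))\<^sup>2)..(real (Suc n))\<^sup>2} \<xi> :: ennreal)"
          unfolding indicator_def by (simp del: of_nat_Suc; linarith)
      qed auto
    qed auto
    also have "\<dots> \<le> 4 * B" by (intro SUP_least sq)
    finally show ?thesis unfolding f_def .
  qed
  have "4 * B < \<infinity>" using B by (simp add: ennreal_mult_less_top)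
  with main show thesis using that by blast
qed

text \<open>With \<open>\<tau> = \<sigma> - phase \<alpha> \<beta> \<xi>\<close> the factor \<open>exp (\<i> \<theta> \<sigma>)\<close> is absorbed into \<open>h\<close>, and \<open>b > 1/2\<close> makes
  the remaining weight in \<open>\<sigma>\<close> integrable.\<close>

lemma curve_transform_Xsb_dual:
  assumes \<alpha>: "\<alpha> \<noteq> 0" and s: "s \<ge> 1 / 4" and b: "b > 1 / 2"
  obtains B where "B < \<infinity>" "\<And>\<theta> h. curve_datum \<theta> h \<Longrightarrow>
    (\<integral>\<^sup>+p. ennreal ((cmod (curve_transform \<theta> h (fst p) (snd p)) / (jbracket (fst p) powr s * jbracket (snd p + phase \<alpha> \<beta> (fst p)) powr b))\<^sup>2) \<partial>lborel) \<le> B"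
proof -
  obtain B where B: "B < \<infinity>" "\<And>\<theta> h. curve_datum \<theta> h \<Longrightarrow>
    (\<integral>\<^sup>+\<xi>. ennreal (jbracket \<xi> powr (- 2 * s) * (cmod (curve_transform \<theta> h \<xi> (- phase \<alpha> \<beta> \<xi>)))\<^sup>2) \<partial>lborel) \<le> B"
    by (rule curve_transform_weighted[OF \<alpha> s, of \<beta>]) (rule that, auto)
  define J where "J = (\<integral>\<^sup>+y. ennreal (jbracket y powr (- 2 * b)) \<partial>lborel)"
  have J: "J < \<infinity>" unfolding J_def by (rule nn_integral_jbracket_powr[OF b])
  have main: "(\<integral>\<^sup>+p. ennreal ((cmod (curve_transform \<theta> h (fst p) (snd p)) / (jbracket (fst p) powr s * jbracket (snd p + phase \<alpha> \<beta> (fst p)) powr b))\<^sup>2) \<partial>lborel) \<le> J * B"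
    if "curve_datum \<theta> h" for \<theta> h
  proof -
    have [measurable]: "\<theta> \<in> borel_measurable borel" "h \<in> borel_measurable borel" and h: "\<And>x. cmod (h x) \<le> gaussian x"
      using that by (auto simp: curve_datum_def)
    define g where "g = (\<lambda>\<xi> \<tau>. ennreal ((cmod (curve_transform \<theta> h \<xi> \<tau>) / (jbracket \<xi> powr s * jbracket (\<tau> + phase \<alpha> \<beta> \<xi>) powr b))\<^sup>2))"
    define G where "G = (\<lambda>\<sigma> \<xi>. ennreal (jbracket \<sigma> powr (- 2 * b)) * ennreal (jbracket \<xi> powr (- 2 * s) * (cmod (curve_transform \<theta> h \<xi> (\<sigma> - phase \<alpha> \<beta> \<xi>)))\<^sup>2))"
    have sqp: "(inverse (x powr r))\<^sup>2 = x powr (- 2 * r)" for x r :: real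
    proof -
      have "(x powr r)\<^sup>2 = x powr (2 * r)" by (simp only: power2_eq_square mult_2 powr_add)
      then show ?thesis by (simp add: powr_minus power_inverse)
    qed
    have gG: "g \<xi> (- phase \<alpha> \<beta> \<xi> + 1 * \<sigma>) = G \<sigma> \<xi>" for \<sigma> \<xi>
      unfolding g_def G_def
      by (subst ennreal_mult'[symmetric]) (auto simp: divide_inverse power_mult_distrib sqp mult_ac)
    have "(\<integral>\<^sup>+p. g (fst p) (snd p) \<partial>lborel) = (\<integral>\<^sup>+\<xi>. \<integral>\<^sup>+\<tau>. g \<xi> \<tau> \<partial>lborel \<partial>lborel)"
      unfolding lborel_prod[symmetric] by (subst lborel.nn_integral_fst[symmetric]) (auto simp: g_def)
    also have "\<dots> = (\<integral>\<^sup>+\<xi>. \<integral>\<^sup>+\<sigma>. G \<sigma> \<xi> \<partial>lborel \<partial>lborel)"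
    proof (rule nn_integral_cong)
      fix \<xi> :: real
      have "(\<integral>\<^sup>+\<tau>. g \<xi> \<tau> \<partial>lborel) = (\<integral>\<^sup>+\<sigma>. g \<xi> (- phase \<alpha> \<beta> \<xi> + 1 * \<sigma>) \<partial>lborel)"
        by (subst nn_integral_real_affine[of _ 1 "- phase \<alpha> \<beta> \<xi>"]) (auto simp: g_def)
      then show "(\<integral>\<^sup>+\<tau>. g \<xi> \<tau> \<partial>lborel) = (\<integral>\<^sup>+\<sigma>. G \<sigma> \<xi> \<partial>lborel)" by (simp only: gG)
    qed
    also have "\<dots> = (\<integral>\<^sup>+\<sigma>. \<integral>\<^sup>+\<xi>. G \<sigma> \<xi> \<partial>lborel \<partial>lborel)"
      by (rule lborel_pair.Fubini'[symmetric]) (simp add: G_def)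
    also have "\<dots> \<le> (\<integral>\<^sup>+\<sigma>. ennreal (jbracket \<sigma> powr (- 2 * b)) * B \<partial>lborel)"
    proof (rule nn_integral_mono)
      fix \<sigma> :: real
      define k where "k = (\<lambda>x. cis (\<theta> x * \<sigma>) * h x)"
      have [measurable]: "k \<in> borel_measurable borel" unfolding k_def by measurable
      have "curve_transform \<theta> h \<xi> (\<sigma> - phase \<alpha> \<beta> \<xi>) = curve_transform \<theta> k \<xi> (- phase \<alpha> \<beta> \<xi>)" for \<xi>
        unfolding curve_transform_def k_def mult.assoc[symmetric] cis_mult by (simp add: algebra_simps)
      then have "(\<integral>\<^sup>+\<xi>. G \<sigma> \<xi> \<partial>lborel) = ennreal (jbracket \<sigma> powr (- 2 * b)) *
          (\<integral>\<^sup>+\<xi>. ennreal (jbracket \<xi> powr (- 2 * s) * (cmod (curve_transform \<theta> k \<xi> (- phase \<alpha> \<beta> \<xi>)))\<^sup>2) \<partial>lborel)"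
        unfolding G_def by (subst nn_integral_cmult) auto
      also have "\<dots> \<le> ennreal (jbracket \<sigma> powr (- 2 * b)) * B"
        by (intro mult_left_mono B) (auto simp: curve_datum_def k_def norm_mult h)
      finally show "(\<integral>\<^sup>+\<xi>. G \<sigma> \<xi> \<partial>lborel) \<le> ennreal (jbracket \<sigma> powr (- 2 * b)) * B" .
    qed
    also have "\<dots> = J * B" by (simp add: J_def nn_integral_multc)
    finally show ?thesis by (simp add: g_def)
  qed
  have "J * B < \<infinity>" using J B(1) by (simp add: ennreal_mult_less_top)
  with main show thesis using that by blast
qed

text \<open>This guarantees that \<open>Xsb_norm_schwartz\<close> is a genuine norm integral: for a
  function that is not square integrable, \<open>L2_norm\<close> would be 0 by default. Both weights
  grow polynomially, which the decay of the transform absorbs.\<close>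

lemma Xsb_weighted_fourier_sq_integrable:
  assumes V: "schwartz V" and s: "s \<ge> 0" and b: "b \<ge> 0"
  shows "sq_integrable (\<lambda>(\<xi>, \<tau>). complex_of_real (jbracket \<xi> powr s * jbracket (\<tau> + phase \<alpha> \<beta> \<xi>) powr b) * fourier V (\<xi>, \<tau>))"
proof -
  define m n where "m = nat \<lceil>s\<rceil>" and "n = nat \<lceil>b\<rceil>"
  define K where "K = 2 + \<bar>\<alpha>\<bar> + \<bar>\<beta>\<bar>"
  have powr_le: "jbracket y powr r \<le> jbracket y ^ nat \<lceil>r\<rceil>" if "r \<ge> 0" for y r
  proof -
    have "jbracket y powr r \<le> jbracket y powr real (nat \<lceil>r\<rceil>)"
      using jbracket_ge(1) that by (intro powr_mono) linarith+
    then show ?thesis by (simp add: powr_realpow)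
  qed
  \<comment> \<open>In powers of 1 + |p|^2 the spatial weight costs m and the modulation weight 5 n,
    because the phase has degree 5. The dimension is what remains for square integrability.\<close>
  obtain C where C: "C \<ge> 0" "\<And>p. cmod (fourier V p) \<le> C / (1 + (norm p)\<^sup>2) ^ (m + 5 * n + DIM(real \<times> real))"
    by (rule fourier_decay[OF V, where k="m + 5 * n + DIM(real \<times> real)"]) (rule that, auto)
  note [measurable] = schwartz_measurable[OF V]
  show ?thesis
  proof (rule sq_integrable_decay)
    show "(\<lambda>(\<xi>, \<tau>). complex_of_real (jbracket \<xi> powr s * jbracket (\<tau> + phase \<alpha> \<beta> \<xi>) powr b) * fourier V (\<xi>, \<tau>)) \<in> borel_measurable borel"
      unfolding borel_prod[symmetric] by measurable
    fix p :: "real \<times> real"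
    obtain \<xi> \<tau> where p: "p = (\<xi>, \<tau>)" by (cases p)
    define P where "P = 1 + (norm p)\<^sup>2"
    have P1: "P \<ge> 1" by (simp add: P_def)
    have sq: "y \<le> 1 + y\<^sup>2" for y :: real
      using zero_le_power2[of "y - 1 / 2"] by (simp add: power2_eq_square algebra_simps)
    have "\<bar>\<xi>\<bar> \<le> norm p" "\<bar>\<tau>\<bar> \<le> norm p" unfolding p norm_Pair by (auto simp: real_le_rsqrt)
    then have le: "\<bar>\<xi>\<bar> \<le> P" "\<bar>\<tau>\<bar> \<le> P" using sq[of "norm p"] by (auto simp: P_def)
    have jb: "jbracket y \<le> 1 + \<bar>y\<bar>" for y
      unfolding jbracket_def by (rule real_le_lsqrt) (auto simp: power2_eq_square algebra_simps)
    have "jbracket \<xi> \<le> P"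
    proof -
      have "1 + \<xi>\<^sup>2 \<le> P" unfolding P_def p norm_Pair by simp
      also have "P \<le> P\<^sup>2" using P1 by (simp add: power2_eq_square)
      finally show ?thesis unfolding jbracket_def using P1 by (intro real_le_lsqrt) auto
    qed
    then have 1: "jbracket \<xi> powr s \<le> P ^ m"
      using powr_le[OF s, of \<xi>] jbracket_ge(1)[of \<xi>] unfolding m_def by (meson order.trans power_mono zero_le_one)
    have "jbracket (\<tau> + phase \<alpha> \<beta> \<xi>) \<le> K * P ^ 5"
    proof -
      have "\<bar>phase \<alpha> \<beta> \<xi>\<bar> \<le> \<bar>\<alpha>\<bar> * \<bar>\<xi>\<bar> ^ 5 + \<bar>\<beta>\<bar> * \<bar>\<xi>\<bar> ^ 3"
        unfolding phase_def by (rule order.trans[OF abs_triangle_ineq4]) (simp add: abs_mult power_abs)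
      also have "\<dots> \<le> \<bar>\<alpha>\<bar> * P ^ 5 + \<bar>\<beta>\<bar> * P ^ 5"
        using le P1 by (intro add_mono mult_left_mono order.trans[OF power_mono[OF le(1)] power_increasing] power_mono) auto
      finally have "\<bar>\<tau> + phase \<alpha> \<beta> \<xi>\<bar> \<le> P ^ 5 + (\<bar>\<alpha>\<bar> * P ^ 5 + \<bar>\<beta>\<bar> * P ^ 5)"
        using le(2) self_le_power[OF P1, of 5] by linarith
      with jb[of "\<tau> + phase \<alpha> \<beta> \<xi>"] one_le_power[OF P1, of 5] show ?thesis
        by (simp add: K_def algebra_simps)
    qed
    then have 2: "jbracket (\<tau> + phase \<alpha> \<beta> \<xi>) powr b \<le> (K * P ^ 5) ^ n"
      using powr_le[OF b, of "\<tau> + phase \<alpha> \<beta> \<xi>"] jbracket_ge(1)[of "\<tau> + phase \<alpha> \<beta> \<xi>"] unfolding n_def by (meson order.trans power_mono zero_le_one)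
    have "norm (case p of (\<xi>, \<tau>) \<Rightarrow> complex_of_real (jbracket \<xi> powr s * jbracket (\<tau> + phase \<alpha> \<beta> \<xi>) powr b) * fourier V (\<xi>, \<tau>))
       = (jbracket \<xi> powr s * jbracket (\<tau> + phase \<alpha> \<beta> \<xi>) powr b) * cmod (fourier V p)"
      unfolding p by (simp add: norm_mult)
    also have "\<dots> \<le> (P ^ m * (K * P ^ 5) ^ n) * (C / P ^ (m + 5 * n + DIM(real \<times> real)))"
      using P1 C(2)[of p] by (intro mult_mono 1 2) (auto simp: P_def K_def)
    also have "\<dots> = (K ^ n * C) / P ^ DIM(real \<times> real)"
    proof -
      have nz: "P ^ m \<noteq> 0" "(P ^ 5) ^ n \<noteq> 0" using P1 by auto
      show ?thesis unfolding power_add power_mult power_mult_distrib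
        using nz by (simp only: times_divide_eq_right divide_divide_eq_left[symmetric] nonzero_mult_div_cancel_left mult.assoc) (simp add: mult_ac)
    qed
    finally show "norm (case p of (\<xi>, \<tau>) \<Rightarrow> complex_of_real (jbracket \<xi> powr s * jbracket (\<tau> + phase \<alpha> \<beta> \<xi>) powr b) * fourier V (\<xi>, \<tau>))
       \<le> (K ^ n * C) / (1 + (norm p)\<^sup>2) ^ DIM(real \<times> real)"
      unfolding P_def .
  qed
qed

section \<open>The maximal estimate for Schwartz functions\<close>

lemma Xsb_norm_schwartz_nonneg: "0 \<le> Xsb_norm_schwartz \<alpha> \<beta> s b V"
  unfolding Xsb_norm_schwartz_def L2_norm_def by (intro real_sqrt_ge_zero integral_nonneg_AE) auto

text \<open>Duality. Pairing V along the curve with a suitable \<open>curve_datum\<close> gives the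
  left-hand side, inversion and Fubini move the pairing to the frequency side, and Cauchy-Schwarz
  with the weight W and its inverse separates the norm of V from the dual bound. The constant is
  uniform in \<theta>.\<close>

lemma maximal_estimate_curve:
  assumes \<alpha>: "\<alpha> \<noteq> 0" and s: "s \<ge> 1 / 4" and b: "b > 1 / 2"
  obtains C where "C \<ge> 0" "\<And>V \<theta>. schwartz V \<Longrightarrow> \<theta> \<in> borel_measurable borel \<Longrightarrow>
    (\<integral>\<^sup>+x. ennreal (gaussian x * cmod (V (x, \<theta> x))) \<partial>lborel) \<le> ennreal (C * Xsb_norm_schwartz \<alpha> \<beta> s b V)"
proof -
  obtain B where B: "B < \<infinity>" "\<And>\<theta> h. curve_datum \<theta> h \<Longrightarrow>
    (\<integral>\<^sup>+p. ennreal ((cmod (curve_transform \<theta> h (fst p) (snd p)) / (jbracket (fst p) powr s * jbracket (snd p + phase \<alpha> \<beta> (fst p)) powr b))\<^sup>2) \<partial>lborel) \<le> B"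
    by (rule curve_transform_Xsb_dual[OF \<alpha> s b, of \<beta>]) (rule that, auto)
  obtain r where r: "r \<ge> 0" "B = ennreal r" using B(1) by (cases B) auto
  define c where "c = (2 * pi) powr (-1)"
  have c: "c \<ge> 0" by (simp add: c_def)
  have main: "(\<integral>\<^sup>+x. ennreal (gaussian x * cmod (V (x, \<theta> x))) \<partial>lborel) \<le> ennreal (c * sqrt r * Xsb_norm_schwartz \<alpha> \<beta> s b V)"
    if V: "schwartz V" and \<theta>[measurable]: "\<theta> \<in> borel_measurable borel" for V \<theta>
  proof -
    note [measurable] = schwartz_measurable[OF V]
    have Vm[measurable]: "(\<lambda>x. V (x, \<theta> x)) \<in> borel_measurable borel"
      by (rule measurable_compose[OF _ schwartz_measurable[OF V]]) auto
    \<comment> \<open>The conjugate sign turns V into |V| on the curve; where V vanishes,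
      \<open>sgn\<close> is 0 and nothing is lost.\<close>
    define h where "h = (\<lambda>x. complex_of_real (gaussian x) * cnj (sgn (V (x, \<theta> x))))"
    have hm[measurable]: "h \<in> borel_measurable borel"
      unfolding h_def sgn_div_norm by measurable
    have hg: "cmod (h x) \<le> gaussian x" for x
      by (simp add: h_def norm_mult norm_sgn abs_of_pos[OF gaussian_pos] less_imp_le[OF gaussian_pos])
    have datum: "curve_datum \<theta> h" by (auto simp: curve_datum_def hg)
    have hV: "V (x, \<theta> x) * h x = complex_of_real (gaussian x * cmod (V (x, \<theta> x)))" for x
    proof (cases "V (x, \<theta> x) = 0")
      case False
      have "V (x, \<theta> x) * cnj (V (x, \<theta> x)) = (complex_of_real (cmod (V (x, \<theta> x))))\<^sup>2"
        by (simp add: complex_norm_square[symmetric])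
      then show ?thesis using False
        by (simp add: h_def sgn_div_norm scaleR_conv_of_real power2_eq_square field_simps)
    qed (simp add: h_def)
    have hint: "integrable lborel h"
      by (rule Bochner_Integration.integrable_bound[OF gaussian_integrable]) (auto intro: order.trans[OF hg] simp: abs_of_pos[OF gaussian_pos])
    obtain M where M: "\<And>p. cmod (V p) \<le> M" by (rule schwartz_decay[OF V, where k=0]) (rule that, auto)
    define H where "H = (\<lambda>p. curve_transform \<theta> h (fst p) (snd p))"
    have Hm[measurable]: "H \<in> borel_measurable borel"
      using curve_transform_measurable[OF \<theta> hm] unfolding H_def case_prod_beta' .
    define W where "W = (\<lambda>p. jbracket (fst p) powr s * jbracket (snd p + phase \<alpha> \<beta> (fst p)) powr b)"
    have Wm[measurable]: "W \<in> borel_measurable borel"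
      unfolding W_def borel_prod[symmetric] by measurable
    have W: "W p > 0" for p by (simp add: W_def)
    define X where "X = Xsb_norm_schwartz \<alpha> \<beta> s b V"
    have X: "X \<ge> 0" unfolding X_def by (rule Xsb_norm_schwartz_nonneg)
    have X2: "(\<integral>\<^sup>+p. ennreal (W p * cmod (fourier V p)) ^ 2 \<partial>lborel) = ennreal (X\<^sup>2)"
    proof -
      have eq: "(cmod (case p of (\<xi>, \<tau>) \<Rightarrow> complex_of_real (jbracket \<xi> powr s * jbracket (\<tau> + phase \<alpha> \<beta> \<xi>) powr b) * fourier V (\<xi>, \<tau>)))\<^sup>2 = (W p * cmod (fourier V p))\<^sup>2" for p
        by (simp add: W_def case_prod_beta norm_mult)
      have "integrable lborel (\<lambda>p. (W p * cmod (fourier V p))\<^sup>2)"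
        using Xsb_weighted_fourier_sq_integrable[OF V, of s b \<alpha> \<beta>] s b unfolding sq_integrable_def eq by simp
      moreover have "X\<^sup>2 = (\<integral>p. (W p * cmod (fourier V p))\<^sup>2 \<partial>lborel)"
        unfolding X_def Xsb_norm_schwartz_def L2_norm_def eq by (simp add: integral_nonneg_AE)
      ultimately show ?thesis using W
        by (simp add: ennreal_power less_imp_le nn_integral_eq_integral)
    qed
    have "complex_of_real (\<integral>x. gaussian x * cmod (V (x, \<theta> x)) \<partial>lborel) = (\<integral>x. V (x, \<theta> x) * h x \<partial>lborel)"
      unfolding hV by (rule integral_complex_of_real[symmetric])
    also have "\<dots> = (\<integral>x. complex_of_real c * (\<integral>p. cis ((x, \<theta> x) \<bullet> p) * fourier V p * h x \<partial>lborel) \<partial>lborel)"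
    proof (rule Bochner_Integration.integral_cong)
      fix x
      show "V (x, \<theta> x) * h x = complex_of_real c * (\<integral>p. cis ((x, \<theta> x) \<bullet> p) * fourier V p * h x \<partial>lborel)"
        using fourier_inversion[OF schwartz_integrable[OF V] schwartz_continuous[OF V] M fourier_schwartz_integrable(1)[OF V], of "(x, \<theta> x)"]
        by (simp only: integral_mult_left_zero) (simp add: c_def cis_conv_exp powr_minus)
    qed simp
    also have "\<dots> = complex_of_real c * (\<integral>x. \<integral>p. cis ((x, \<theta> x) \<bullet> p) * fourier V p * h x \<partial>lborel \<partial>lborel)"
      by (rule integral_mult_right_zero)
    also have "(\<integral>x. \<integral>p. cis ((x, \<theta> x) \<bullet> p) * fourier V p * h x \<partial>lborel \<partial>lborel) = (\<integral>p. \<integral>x. cis ((x, \<theta> x) \<bullet> p) * fourier V p * h x \<partial>lborel \<partial>lborel)"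
    proof (rule lborel_pair.Fubini_integral[symmetric])
      have [measurable]: "(\<lambda>z. (fst z, \<theta> (fst z)) \<bullet> snd z) \<in> borel_measurable (lborel \<Otimes>\<^sub>M (lborel :: (real \<times> real) measure))"
        by (intro borel_measurable_inner borel_measurable_Pair) auto
      show "integrable (lborel \<Otimes>\<^sub>M lborel) (\<lambda>(x, p). cis ((x, \<theta> x) \<bullet> p) * fourier V p * h x)"
        by (rule integrable_pair_bound[OF _ _ hint fourier_schwartz_integrable(1)[OF V]])
          (auto simp: norm_mult lborel.sigma_finite_measure_axioms case_prod_beta)
    qed
    also have "\<dots> = (\<integral>p. fourier V p * H p \<partial>lborel)"
    proof (rule Bochner_Integration.integral_cong)
      fix p :: "real \<times> real"
      have "(\<integral>x. cis ((x, \<theta> x) \<bullet> p) * fourier V p * h x \<partial>lborel) = (\<integral>x. fourier V p * (cis (x * fst p + \<theta> x * snd p) * h x) \<partial>lborel)"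
        by (simp add: inner_prod_def mult_ac)
      then show "(\<integral>x. cis ((x, \<theta> x) \<bullet> p) * fourier V p * h x \<partial>lborel) = fourier V p * H p"
        by (simp add: H_def curve_transform_def)
    qed simp
    finally have eq: "complex_of_real (\<integral>x. gaussian x * cmod (V (x, \<theta> x)) \<partial>lborel) = complex_of_real c * (\<integral>p. fourier V p * H p \<partial>lborel)" .
    have gV: "integrable lborel (\<lambda>x. gaussian x * cmod (V (x, \<theta> x)))"
      by (rule Bochner_Integration.integrable_bound[where f="\<lambda>x. gaussian x * M"])
        (use gaussian_integrable M order.trans[OF norm_ge_zero M] in \<open>auto simp: abs_mult abs_of_pos[OF gaussian_pos] intro!: mult_left_mono less_imp_le[OF gaussian_pos]\<close>)
    define I where "I = (\<integral>\<^sup>+p. ennreal (W p * cmod (fourier V p)) * ennreal (cmod (H p) / W p) \<partial>lborel)"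
    have Hb: "cmod (H p) \<le> (\<integral>x. gaussian (x::real) \<partial>lborel)" for p
    proof -
      have "cmod (H p) \<le> (\<integral>x. cmod (cis (x * fst p + \<theta> x * snd p) * h x) \<partial>lborel)"
        unfolding H_def curve_transform_def by (rule integral_norm_bound)
      also have "\<dots> \<le> (\<integral>x. gaussian (x::real) \<partial>lborel)"
        using hg hint gaussian_integrable by (intro Bochner_Integration.integral_mono) (auto simp: norm_mult)
      finally show ?thesis .
    qed
    have fHint: "integrable lborel (\<lambda>p. fourier V p * H p)"
    proof (rule Bochner_Integration.integrable_bound)
      show "integrable lborel (\<lambda>p. cmod (fourier V p) * (\<integral>x. gaussian (x::real) \<partial>lborel))"
        using fourier_schwartz_integrable(1)[OF V] by simp
      show "AE p in lborel. norm (fourier V p * H p) \<le> norm (cmod (fourier V p) * (\<integral>x. gaussian (x::real) \<partial>lborel))"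
        using order.trans[OF Hb abs_ge_self] by (auto simp: norm_mult abs_mult intro!: mult_left_mono)
    qed simp
    have "(\<integral>\<^sup>+x. ennreal (gaussian x * cmod (V (x, \<theta> x))) \<partial>lborel) = ennreal (\<integral>x. gaussian x * cmod (V (x, \<theta> x)) \<partial>lborel)"
      using gV by (rule nn_integral_eq_integral) (auto intro!: mult_nonneg_nonneg less_imp_le[OF gaussian_pos])
    also have "(\<integral>x. gaussian x * cmod (V (x, \<theta> x)) \<partial>lborel) = cmod (complex_of_real (\<integral>x. gaussian x * cmod (V (x, \<theta> x)) \<partial>lborel))"
      by (simp add: integral_nonneg_AE less_imp_le[OF gaussian_pos])
    also have "ennreal \<dots> = ennreal c * ennreal (cmod (\<integral>p. fourier V p * H p \<partial>lborel))"
      unfolding eq norm_mult using c by (simp add: ennreal_mult')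
    also have "\<dots> \<le> ennreal c * (\<integral>\<^sup>+p. ennreal (cmod (fourier V p * H p)) \<partial>lborel)"
      using fHint by (intro mult_left_mono integral_norm_bound_ennreal) auto
    also have "(\<integral>\<^sup>+p. ennreal (cmod (fourier V p * H p)) \<partial>lborel) = I"
      unfolding I_def using W by (intro nn_integral_cong) (simp add: norm_mult less_imp_neq[symmetric] less_imp_le flip: ennreal_mult)
    also have "I \<le> ennreal (X * sqrt r)"
    proof -
      have "I\<^sup>2 \<le> (\<integral>\<^sup>+p. ennreal (W p * cmod (fourier V p)) ^ 2 \<partial>lborel) * (\<integral>\<^sup>+p. ennreal (cmod (H p) / W p) ^ 2 \<partial>lborel)"
        unfolding I_def by (rule Cauchy_Schwarz_nn_integral) measurable
      also have "\<dots> \<le> ennreal (X\<^sup>2) * ennreal r"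
        unfolding X2 using B(2)[OF datum] W r
        by (intro mult_left_mono) (auto simp: H_def W_def ennreal_power less_imp_le)
      finally have *: "I\<^sup>2 \<le> ennreal (X\<^sup>2 * r)" using r by (simp add: ennreal_mult')
      \<comment> \<open>Finiteness must be known before I can be replaced by a real number and the
        square root taken.\<close>
      then have "I \<noteq> \<infinity>" by (auto simp: top_unique power2_eq_square ennreal_mult_top)
      then obtain i where i: "i \<ge> 0" "I = ennreal i" by (cases I) auto
      with * have "i\<^sup>2 \<le> X\<^sup>2 * r" using r by (simp add: ennreal_power)
      then have "i \<le> sqrt (X\<^sup>2 * r)" by (rule real_le_rsqrt)
      also have "\<dots> = X * sqrt r" using X by (simp add: real_sqrt_mult)
      finally show ?thesis unfolding i(2) by (rule ennreal_leI)
    qed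
    also have "ennreal c * ennreal (X * sqrt r) = ennreal (c * sqrt r * X)"
      using c X by (simp add: ennreal_mult'[symmetric] mult_ac)
    finally show ?thesis unfolding X_def by (simp add: mult_left_mono)
  qed
  show thesis by (rule that[of "c * sqrt r"]) (use c r main in auto)
qed

text \<open>Among finitely many times the best one can be chosen measurably in x, so the curve
  estimate bounds finite maxima, and monotone convergence gives the countable supremum. Continuity
  in t later extends it from a dense sequence to all times.\<close>

lemma maximal_estimate:
  assumes \<alpha>: "\<alpha> \<noteq> 0" and s: "s \<ge> 1 / 4" and b: "b > 1 / 2"
  obtains C where "C \<ge> 0" "\<And>V q. schwartz V \<Longrightarrow>
    (\<integral>\<^sup>+x. (SUP n. ennreal (gaussian x * cmod (V (x, q (n::nat))))) \<partial>lborel) \<le> ennreal (C * Xsb_norm_schwartz \<alpha> \<beta> s b V)"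
proof -
  obtain C where C: "C \<ge> 0" "\<And>V \<theta>. schwartz V \<Longrightarrow> \<theta> \<in> borel_measurable borel \<Longrightarrow>
    (\<integral>\<^sup>+x. ennreal (gaussian x * cmod (V (x, \<theta> x))) \<partial>lborel) \<le> ennreal (C * Xsb_norm_schwartz \<alpha> \<beta> s b V)"
    by (rule maximal_estimate_curve[OF \<alpha> s b, of \<beta>]) (rule that, auto)
  have main: "(\<integral>\<^sup>+x. (SUP n. ennreal (gaussian x * cmod (V (x, q (n::nat))))) \<partial>lborel) \<le> ennreal (C * Xsb_norm_schwartz \<alpha> \<beta> s b V)"
    if V: "schwartz V" for V q
  proof -
    have Vm[measurable]: "(\<lambda>x. V (x, \<theta> x)) \<in> borel_measurable borel" if [measurable]: "\<theta> \<in> borel_measurable borel" for \<theta> :: "real \<Rightarrow> real"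
      by (rule measurable_compose[OF _ schwartz_measurable[OF V]]) auto
    define a where "a = (\<lambda>n x. ennreal (gaussian x * cmod (V (x, q n))))"
    have [measurable]: "a n \<in> borel_measurable borel" for n unfolding a_def by measurable
    have ex: "\<exists>\<theta>. \<theta> \<in> borel_measurable borel \<and> (\<forall>x. \<forall>j\<le>n. cmod (V (x, q j)) \<le> cmod (V (x, \<theta> x)))" for n
    proof (induction n)
      case 0
      show ?case by (intro exI[of _ "\<lambda>_. q 0"]) auto
    next
      case (Suc n)
      then obtain \<theta> where \<theta>[measurable]: "\<theta> \<in> borel_measurable borel" and le: "\<And>x j. j \<le> n \<Longrightarrow> cmod (V (x, q j)) \<le> cmod (V (x, \<theta> x))"
        by blast
      \<comment> \<open>The previous choice is replaced exactly where the new time gives a value at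
        least as large. Comparing two measurable functions keeps the choice measurable.\<close>
      define \<theta>' where "\<theta>' = (\<lambda>x. if cmod (V (x, \<theta> x)) \<le> cmod (V (x, q (Suc n))) then q (Suc n) else \<theta> x)"
      have [measurable]: "\<theta>' \<in> borel_measurable borel" unfolding \<theta>'_def by measurable
      have "cmod (V (x, q j)) \<le> cmod (V (x, \<theta>' x))" if "j \<le> Suc n" for x j
        using le[of j x] that by (cases "j = Suc n") (auto simp: \<theta>'_def)
      then show ?case by (intro exI[of _ \<theta>']) auto
    qed
    have "(\<integral>\<^sup>+x. (SUP n. a n x) \<partial>lborel) = (\<integral>\<^sup>+x. (SUP n. SUP j\<in>{..n}. a j x) \<partial>lborel)"
    proof (intro nn_integral_cong antisym SUP_least)
      fix x :: real and n
      show "a n x \<le> (SUP n. SUP j\<in>{..n}. a j x)"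
        by (rule SUP_upper2[of n], simp, rule SUP_upper) simp
    next
      fix x :: real and n j :: nat
      show "a j x \<le> (SUP n. a n x)" by (rule SUP_upper) simp
    qed
    also have "\<dots> = (SUP n. \<integral>\<^sup>+x. (SUP j\<in>{..n}. a j x) \<partial>lborel)"
      by (rule nn_integral_monotone_convergence_SUP)
        (auto intro!: incseq_SucI le_funI SUP_subset_mono)
    also have "\<dots> \<le> ennreal (C * Xsb_norm_schwartz \<alpha> \<beta> s b V)"
    proof (rule SUP_least)
      fix n
      from ex[of n] obtain \<theta> where \<theta>: "\<theta> \<in> borel_measurable borel" and le: "\<And>x j. j \<le> n \<Longrightarrow> cmod (V (x, q j)) \<le> cmod (V (x, \<theta> x))"
        by blast
      have "(\<integral>\<^sup>+x. (SUP j\<in>{..n}. a j x) \<partial>lborel) \<le> (\<integral>\<^sup>+x. ennreal (gaussian x * cmod (V (x, \<theta> x))) \<partial>lborel)"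
        unfolding a_def by (intro nn_integral_mono SUP_least ennreal_leI mult_left_mono le less_imp_le[OF gaussian_pos]) auto
      also have "\<dots> \<le> ennreal (C * Xsb_norm_schwartz \<alpha> \<beta> s b V)" by (rule C(2)[OF V \<theta>])
      finally show "(\<integral>\<^sup>+x. (SUP j\<in>{..n}. a j x) \<partial>lborel) \<le> ennreal (C * Xsb_norm_schwartz \<alpha> \<beta> s b V)" .
    qed
    finally show ?thesis by (simp add: a_def)
  qed
  show thesis by (rule that[of C]) (use C(1) main in auto)
qed

section \<open>Uniqueness and duality for the Fourier transform\<close>

text \<open>The positive and negative parts have the same mass, by the case t = 0, and the same
  transform. Divided by that mass they are probability densities with equal characteristic
  functions, and Levy's theorem identifies them.\<close>

lemma real_integrable_fourier_unique:
  fixes k :: "real \<Rightarrow> real"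
  assumes k: "integrable lborel k"
    and 0: "\<And>t. (\<integral>x. iexp (t * x) * complex_of_real (k x) \<partial>lborel) = 0"
  shows "AE x in lborel. k x = 0"
proof -
  have [measurable]: "k \<in> borel_measurable borel" using k by auto
  define p n where "p = (\<lambda>x. max (k x) 0)" and "n = (\<lambda>x. max (- k x) 0)"
  have pn: "integrable lborel p" "integrable lborel n" "k x = p x - n x" "p x \<ge> 0" "n x \<ge> 0" for x
    unfolding p_def n_def using k by auto
  have [measurable]: "p \<in> borel_measurable borel" "n \<in> borel_measurable borel" unfolding p_def n_def by measurable
  have ci: "integrable lborel (\<lambda>x. iexp (t * x) * complex_of_real (f x))" if "integrable lborel f" for f t
  proof -
    have [measurable]: "f \<in> borel_measurable borel" using that by auto
    show ?thesis by (rule Bochner_Integration.integrable_bound[OF that]) (auto simp: norm_mult)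
  qed
  have chareq: "(\<integral>x. iexp (t * x) * complex_of_real (p x) \<partial>lborel) = (\<integral>x. iexp (t * x) * complex_of_real (n x) \<partial>lborel)" for t
  proof -
    have "(\<integral>x. iexp (t * x) * complex_of_real (k x) \<partial>lborel) = (\<integral>x. iexp (t * x) * complex_of_real (p x) - iexp (t * x) * complex_of_real (n x) \<partial>lborel)"
      by (intro Bochner_Integration.integral_cong refl) (simp add: pn(3) right_diff_distrib)
    also have "\<dots> = (\<integral>x. iexp (t * x) * complex_of_real (p x) \<partial>lborel) - (\<integral>x. iexp (t * x) * complex_of_real (n x) \<partial>lborel)"
      by (rule Bochner_Integration.integral_diff[OF ci[OF pn(1)] ci[OF pn(2)]])
    finally show ?thesis unfolding 0 by simp
  qed
  define m where "m = (\<integral>x. p x \<partial>lborel)"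
  have mn: "m = (\<integral>x. n x \<partial>lborel)"
  proof -
    have "complex_of_real m = complex_of_real (\<integral>x. n x \<partial>lborel)"
      using chareq[of 0] unfolding m_def by simp
    then show ?thesis by (simp only: of_real_eq_iff)
  qed
  \<comment> \<open>Mass 0 cannot be normalised, but then both parts vanish almost
    everywhere.\<close>
  show ?thesis
  proof (cases "m = 0")
    case True
    have "AE x in lborel. p x = 0" "AE x in lborel. n x = 0"
      using integral_nonneg_eq_0_iff_AE[OF pn(1)] integral_nonneg_eq_0_iff_AE[OF pn(2)] pn True mn m_def by auto
    then show ?thesis by eventually_elim (simp add: pn(3))
  next
    case False
    moreover have "m \<ge> 0" unfolding m_def using pn by (intro integral_nonneg_AE) auto
    ultimately have m: "m > 0" by simp
    define P where "P = (\<lambda>f. density lborel (\<lambda>x::real. ennreal (f x / m)))"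
    have dist: "real_distribution (P f)" and charP: "char (P f) t = (\<integral>x. iexp (t * x) * complex_of_real (f x) \<partial>lborel) / m"
      if f: "integrable lborel f" "\<And>x. f x \<ge> 0" "m = (\<integral>x. f x \<partial>lborel)" for f t
    proof -
      have [measurable]: "f \<in> borel_measurable borel" using f(1) by auto
      have "(\<integral>\<^sup>+x. ennreal (f x / m) \<partial>lborel) = ennreal (\<integral>x. f x / m \<partial>lborel)"
        using f m by (intro nn_integral_eq_integral) auto
      also have "\<dots> = 1" using m by (simp add: f(3)[symmetric])
      finally have "emeasure (P f) (space (P f)) = 1"
        unfolding P_def by (simp add: emeasure_density)
      then have "prob_space (P f)" by (rule prob_spaceI)
      then show "real_distribution (P f)"
        unfolding real_distribution_def real_distribution_axioms_def by (simp add: P_def)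
      have "char (P f) t = (\<integral>x. (f x / m) *\<^sub>R iexp (t * x) \<partial>lborel)"
        unfolding char_def P_def using f m by (subst integral_density) auto
      also have "\<dots> = (\<integral>x. (iexp (t * x) * complex_of_real (f x)) / m \<partial>lborel)"
        by (intro Bochner_Integration.integral_cong refl) (simp add: scaleR_conv_of_real)
      also have "\<dots> = (\<integral>x. iexp (t * x) * complex_of_real (f x) \<partial>lborel) / m"
        by (rule integral_divide_zero)
      finally show "char (P f) t = (\<integral>x. iexp (t * x) * complex_of_real (f x) \<partial>lborel) / m" .
    qed
    have "P p = P n"
    proof (rule Levy_uniqueness)
      show "char (P p) = char (P n)"
        using charP[OF pn(1) pn(4) m_def] charP[OF pn(2) pn(5) mn] chareq by (simp add: fun_eq_iff)
    qed (use dist[OF pn(1) pn(4) m_def] dist[OF pn(2) pn(5) mn] in auto)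
    then have "AE x in lborel. ennreal (p x / m) = ennreal (n x / m)"
      unfolding P_def by (intro sigma_finite_measure.density_unique[OF lborel.sigma_finite_measure_axioms]) auto
    then show ?thesis
    proof eventually_elim
      fix x assume "ennreal (p x / m) = ennreal (n x / m)"
      then have "p x / m = n x / m" using pn m by (subst (asm) ennreal_inj) auto
      then show "k x = 0" using m by (simp add: pn(3))
    qed
  qed
qed

text \<open>Conjugating the hypothesis at -t shows that \<open>cnj \<circ> h\<close> satisfies it
  too, hence so do the real and imaginary parts.\<close>

lemma integrable_fourier_unique:
  fixes h :: "real \<Rightarrow> complex"
  assumes h: "integrable lborel h" and 0: "\<And>t. (\<integral>x. iexp (t * x) * h x \<partial>lborel) = 0"
  shows "AE x in lborel. h x = 0"
proof -
  have [measurable]: "h \<in> borel_measurable borel" using h by auto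
  have hi: "integrable lborel (\<lambda>x. iexp (t * x) * h x)" for t
    by (rule Bochner_Integration.integrable_bound[OF h]) (auto simp: norm_mult)
  have ci: "integrable lborel (\<lambda>x. iexp (t * x) * cnj (h x))" for t
    by (rule Bochner_Integration.integrable_bound[OF h]) (auto simp: norm_mult)
  have c0: "(\<integral>x. iexp (t * x) * cnj (h x) \<partial>lborel) = 0" for t
  proof -
    have "(\<integral>x. iexp (t * x) * cnj (h x) \<partial>lborel) = (\<integral>x. cnj (iexp (- t * x) * h x) \<partial>lborel)"
      by (simp add: exp_cnj)
    also have "\<dots> = cnj (\<integral>x. iexp (- t * x) * h x \<partial>lborel)" by (rule Bochner_Integration.integral_cnj)
    finally show ?thesis unfolding 0 by simp
  qed
  have "AE x in lborel. Re (h x) = 0"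
  proof (rule real_integrable_fourier_unique)
    fix t
    have eq: "iexp (t * x) * complex_of_real (Re (h x)) = (iexp (t * x) * h x + iexp (t * x) * cnj (h x)) / 2" for x
      by (simp add: complex_add_cnj flip: distrib_left)
    show "(\<integral>x. iexp (t * x) * complex_of_real (Re (h x)) \<partial>lborel) = 0"
      unfolding eq integral_divide_zero Bochner_Integration.integral_add[OF hi ci] 0 c0 by simp
  qed (use h in simp)
  moreover have "AE x in lborel. Im (h x) = 0"
  proof (rule real_integrable_fourier_unique)
    fix t
    have eq: "iexp (t * x) * complex_of_real (Im (h x)) = (iexp (t * x) * h x - iexp (t * x) * cnj (h x)) / (2 * \<i>)" for x
    proof -
      have 1: "h x - cnj (h x) = 2 * \<i> * complex_of_real (Im (h x))" by (simp add: complex_eq_iff)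
      have 2: "E * I = (E * (2 * \<i> * I)) / (2 * \<i>)" for E I :: complex
        by (subst nonzero_eq_divide_eq) (auto simp: mult_ac)
      show ?thesis unfolding right_diff_distrib[symmetric] 1 by (rule 2)
    qed
    show "(\<integral>x. iexp (t * x) * complex_of_real (Im (h x)) \<partial>lborel) = 0"
      unfolding eq integral_divide_zero Bochner_Integration.integral_diff[OF hi ci] 0 c0 by simp
  qed (use h in simp)
  ultimately show ?thesis by eventually_elim (simp add: complex_eq_iff)
qed

section \<open>Pairings and the Fourier transform of square-integrable functions\<close>

lemma sq_integrable_diff:
  assumes "sq_integrable f" "sq_integrable g"
  shows "sq_integrable (\<lambda>x. f x - g x)"
proof -
  have [measurable]: "f \<in> borel_measurable borel" "g \<in> borel_measurable borel" using assms by (auto simp: sq_integrable_def)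
  have "integrable lborel (\<lambda>x. 2 * (cmod (f x))\<^sup>2 + 2 * (cmod (g x))\<^sup>2)"
    using assms by (auto simp: sq_integrable_def)
  then have "integrable lborel (\<lambda>x. (cmod (f x - g x))\<^sup>2)"
  proof (rule Bochner_Integration.integrable_bound)
    have "(cmod (f x - g x))\<^sup>2 \<le> 2 * (cmod (f x))\<^sup>2 + 2 * (cmod (g x))\<^sup>2" for x
    proof -
      have "(cmod (f x - g x))\<^sup>2 \<le> (cmod (f x) + cmod (g x))\<^sup>2" by (intro power_mono norm_triangle_ineq4) auto
      also have "\<dots> \<le> 2 * (cmod (f x))\<^sup>2 + 2 * (cmod (g x))\<^sup>2"
        using zero_le_power2[of "cmod (f x) - cmod (g x)"] by (simp add: power2_eq_square algebra_simps)
      finally show ?thesis .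
    qed
    then show "AE x in lborel. norm ((cmod (f x - g x))\<^sup>2) \<le> norm (2 * (cmod (f x))\<^sup>2 + 2 * (cmod (g x))\<^sup>2)"
      by (auto intro: order.trans[OF _ abs_ge_self])
  qed simp
  then show ?thesis by (simp add: sq_integrable_def)
qed

lemma L2_Cauchy_Schwarz:
  assumes f: "sq_integrable f" and g: "sq_integrable g"
  shows "integrable lborel (\<lambda>x. f x * g x)" and "cmod (\<integral>x. f x * g x \<partial>lborel) \<le> L2_norm f * L2_norm g"
proof -
  have [measurable]: "f \<in> borel_measurable borel" "g \<in> borel_measurable borel" using assms by (auto simp: sq_integrable_def)
  have i: "integrable lborel (\<lambda>x. (cmod (f x))\<^sup>2)" "integrable lborel (\<lambda>x. (cmod (g x))\<^sup>2)"
    using assms by (auto simp: sq_integrable_def)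
  have "integrable lborel (\<lambda>x. (cmod (f x))\<^sup>2 + (cmod (g x))\<^sup>2)" using i by simp
  then show fg: "integrable lborel (\<lambda>x. f x * g x)"
  proof (rule Bochner_Integration.integrable_bound)
    have "cmod (f x) * cmod (g x) \<le> (cmod (f x))\<^sup>2 + (cmod (g x))\<^sup>2" for x
    proof -
      have "2 * (cmod (f x) * cmod (g x)) \<le> (cmod (f x))\<^sup>2 + (cmod (g x))\<^sup>2"
        using zero_le_power2[of "cmod (f x) - cmod (g x)"] by (simp add: power2_diff)
      moreover have "0 \<le> cmod (f x) * cmod (g x)" by simp
      ultimately show ?thesis by linarith
    qed
    then show "AE x in lborel. norm (f x * g x) \<le> norm ((cmod (f x))\<^sup>2 + (cmod (g x))\<^sup>2)"
      by (auto simp: norm_mult intro: order.trans[OF _ abs_ge_self])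
  qed simp
  define I where "I = (\<integral>x. cmod (f x) * cmod (g x) \<partial>lborel)"
  have I0: "I \<ge> 0" unfolding I_def by (intro integral_nonneg_AE) auto
  have fgn: "integrable lborel (\<lambda>x. cmod (f x) * cmod (g x))" using integrable_norm[OF fg] by (simp add: norm_mult)
  have L: "(\<integral>\<^sup>+x. ennreal (cmod (h x)) ^ 2 \<partial>lborel) = ennreal ((L2_norm h)\<^sup>2)"
    if "integrable lborel (\<lambda>x. (cmod (h x))\<^sup>2)" for h :: "'a \<Rightarrow> complex"
    using that unfolding L2_norm_def by (simp add: ennreal_power nn_integral_eq_integral integral_nonneg_AE)
  have "(\<integral>\<^sup>+x. ennreal (cmod (f x)) * ennreal (cmod (g x)) \<partial>lborel) = ennreal I"
    unfolding I_def using fgn by (simp add: nn_integral_eq_integral flip: ennreal_mult)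
  then have "(ennreal I)\<^sup>2 \<le> ennreal ((L2_norm f)\<^sup>2) * ennreal ((L2_norm g)\<^sup>2)"
    using Cauchy_Schwarz_nn_integral[of "\<lambda>x. ennreal (cmod (f x))" lborel "\<lambda>x. ennreal (cmod (g x))"] L[OF i(1)] L[OF i(2)] by simp
  then have "I\<^sup>2 \<le> (L2_norm f * L2_norm g)\<^sup>2"
    using I0 by (simp add: ennreal_power power_mult_distrib flip: ennreal_mult)
  moreover have "0 \<le> L2_norm f * L2_norm g" unfolding L2_norm_def by (intro mult_nonneg_nonneg real_sqrt_ge_zero integral_nonneg_AE) auto
  ultimately have "I \<le> L2_norm f * L2_norm g" by (rule power2_le_imp_le)
  then show "cmod (\<integral>x. f x * g x \<partial>lborel) \<le> L2_norm f * L2_norm g"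
    using integral_norm_bound[of lborel "\<lambda>x. f x * g x"] by (simp add: I_def norm_mult)
qed

lemma L2_norm_limit_integral:
  assumes F: "\<And>n. sq_integrable (F n)" and f: "sq_integrable f" and g: "sq_integrable g"
    and lim: "(\<lambda>n. L2_norm (\<lambda>x. F n x - f x)) \<longlonglongrightarrow> 0"
  shows "(\<lambda>n. \<integral>x. F n x * g x \<partial>lborel) \<longlonglongrightarrow> (\<integral>x. f x * g x \<partial>lborel)"
proof -
  have "cmod ((\<integral>x. F n x * g x \<partial>lborel) - (\<integral>x. f x * g x \<partial>lborel)) \<le> L2_norm (\<lambda>x. F n x - f x) * L2_norm g" for n
  proof -
    have "(\<integral>x. F n x * g x \<partial>lborel) - (\<integral>x. f x * g x \<partial>lborel) = (\<integral>x. (F n x - f x) * g x \<partial>lborel)"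
      using L2_Cauchy_Schwarz(1)[OF F g] L2_Cauchy_Schwarz(1)[OF f g] by (simp add: left_diff_distrib)
    then show ?thesis using L2_Cauchy_Schwarz(2)[OF sq_integrable_diff[OF F f] g] by simp
  qed
  then have "(\<lambda>n. (\<integral>x. F n x * g x \<partial>lborel) - (\<integral>x. f x * g x \<partial>lborel)) \<longlonglongrightarrow> 0"
    by (intro Lim_null_comparison[OF always_eventually tendsto_mult_left_zero[OF lim]] allI)
  then show ?thesis by (rule LIM_zero_cancel)
qed

text \<open>Both sides are continuous in the square norm, so the formula passes from the
  approximating Schwartz functions to the limit. The integral equation is tested in this
  form.\<close>

lemma has_fourier_L2_multiplication:
  assumes fg: "has_fourier_L2 f g" and \<psi>: "integrable lborel \<psi>" "sq_integrable \<psi>" "sq_integrable (fourier \<psi>)"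
  shows "(\<integral>x. f x * fourier \<psi> x \<partial>lborel) = (\<integral>\<xi>. g \<xi> * \<psi> \<xi> \<partial>lborel)"
proof -
  obtain F where F: "\<And>n. schwartz (F n)" "(\<lambda>n. L2_norm (\<lambda>x. F n x - f x)) \<longlonglongrightarrow> 0"
    "(\<lambda>n. L2_norm (\<lambda>\<xi>. fourier (F n) \<xi> - g \<xi>)) \<longlonglongrightarrow> 0" and sq: "sq_integrable f" "sq_integrable g"
    using fg unfolding has_fourier_L2_def by blast
  have "(\<lambda>n. \<integral>x. F n x * fourier \<psi> x \<partial>lborel) \<longlonglongrightarrow> (\<integral>x. f x * fourier \<psi> x \<partial>lborel)"
    by (intro L2_norm_limit_integral schwartz_sq_integrable F sq \<psi>)
  moreover have "(\<lambda>n. \<integral>\<xi>. fourier (F n) \<xi> * \<psi> \<xi> \<partial>lborel) \<longlonglongrightarrow> (\<integral>\<xi>. g \<xi> * \<psi> \<xi> \<partial>lborel)"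
    by (intro L2_norm_limit_integral fourier_schwartz_integrable(2) F sq \<psi>)
  moreover have "(\<integral>\<xi>. fourier (F n) \<xi> * \<psi> \<xi> \<partial>lborel) = (\<integral>x. F n x * fourier \<psi> x \<partial>lborel)" for n
    by (intro fourier_multiplication_formula schwartz_integrable F \<psi>)
  ultimately show ?thesis by (simp only:) (rule LIMSEQ_unique)
qed

text \<open>The test functions for time 0. Translating in frequency multiplies the transform by a
  character without changing its modulus. The last integrability absorbs the derivative in the
  Duhamel term.\<close>

lemma translated_gaussian:
  fixes a :: real
  defines "\<psi> \<equiv> \<lambda>\<xi>. complex_of_real (gaussian (- a + \<xi>))"
  shows "integrable lborel \<psi>" "sq_integrable \<psi>"
    "fourier \<psi> x = exp (- (\<i> * complex_of_real (a * x))) * complex_of_real (gaussian x)"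
    "sq_integrable (fourier \<psi>)"
    "integrable lborel (\<lambda>\<xi>. \<bar>\<xi>\<bar> * gaussian (- a + \<xi>))"
proof -
  have [measurable]: "\<psi> \<in> borel_measurable borel" unfolding \<psi>_def by measurable
  have gg: "(gaussian x)\<^sup>2 \<le> gaussian x" for x :: real
    using gaussian_pos[of x] gaussian_le_1[of x] by (simp add: power2_eq_square)
  have gi: "integrable lborel (\<lambda>\<xi>. gaussian (- a + \<xi>))"
    using gaussian_integrable by (subst lborel_integral_translate(2)) auto
  then show "integrable lborel \<psi>" unfolding \<psi>_def by (rule integrable_of_real)
  show "sq_integrable \<psi>" unfolding sq_integrable_def
  proof
    show "integrable lborel (\<lambda>x. (cmod (\<psi> x))\<^sup>2)"
      by (rule Bochner_Integration.integrable_bound[OF gi])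
        (auto simp: \<psi>_def abs_of_pos[OF gaussian_pos] intro: gg)
  qed measurable
  have four: "fourier \<psi> x = exp (- (\<i> * complex_of_real (a * x))) * complex_of_real (gaussian x)" for x
  proof -
    have "(\<integral>\<xi>. exp (- (\<i> * complex_of_real (\<xi> \<bullet> x))) * \<psi> \<xi> \<partial>lborel) = (\<integral>\<xi>. exp (- (\<i> * complex_of_real ((a + \<xi>) \<bullet> x))) * \<psi> (a + \<xi>) \<partial>lborel)"
      by (rule lborel_integral_translate(1)[symmetric]) measurable
    also have "\<dots> = (\<integral>\<xi>. exp (- (\<i> * complex_of_real (a * x))) * (exp (- (\<i> * complex_of_real (\<xi> \<bullet> x))) * complex_of_real (gaussian \<xi>)) \<partial>lborel)"
      unfolding \<psi>_def mult.assoc[symmetric] exp_add[symmetric] by (simp add: algebra_simps)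
    also have "\<dots> = exp (- (\<i> * complex_of_real (a * x))) * complex_of_real ((2 * pi) powr (real DIM(real) / 2) * gaussian x)"
      unfolding integral_mult_right_zero gaussian_integral(2) by simp
    finally show ?thesis by (simp add: fourier_def powr_minus)
  qed
  then show "fourier \<psi> x = exp (- (\<i> * complex_of_real (a * x))) * complex_of_real (gaussian x)" .
  show "sq_integrable (fourier \<psi>)" unfolding sq_integrable_def
  proof
    show "integrable lborel (\<lambda>x. (cmod (fourier \<psi> x))\<^sup>2)"
      by (rule Bochner_Integration.integrable_bound[OF gaussian_integrable])
        (auto simp: four norm_mult abs_of_pos[OF gaussian_pos] intro: gg)
  qed measurable
  show "integrable lborel (\<lambda>\<xi>. \<bar>\<xi>\<bar> * gaussian (- a + \<xi>))"
  proof -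
    have "integrable lborel (\<lambda>x. sqrt (2 * pi) * (std_normal_density x * \<bar>x\<bar> ^ 1))"
      by (intro integrable_mult_right integrable_std_normal_moment_abs)
    also have "(\<lambda>x. sqrt (2 * pi) * (std_normal_density x * \<bar>x\<bar> ^ 1)) = (\<lambda>x. \<bar>x\<bar> * gaussian x)"
      by (auto simp: std_normal_density_def gaussian_def)
    finally have "integrable lborel (\<lambda>\<xi>. \<bar>- a + \<xi>\<bar> * gaussian (- a + \<xi>))"
      by (subst lborel_integral_translate(2)[where f="\<lambda>x. \<bar>x\<bar> * gaussian x"]) auto
    then have "integrable lborel (\<lambda>\<xi>. \<bar>- a + \<xi>\<bar> * gaussian (- a + \<xi>) + \<bar>a\<bar> * gaussian (- a + \<xi>))"
      using gi by simp
    then show ?thesis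
    proof (rule Bochner_Integration.integrable_bound)
      have "\<bar>\<xi>\<bar> * gaussian (- a + \<xi>) \<le> \<bar>- a + \<xi>\<bar> * gaussian (- a + \<xi>) + \<bar>a\<bar> * gaussian (- a + \<xi>)" for \<xi>
        unfolding distrib_right[symmetric] by (intro mult_right_mono less_imp_le[OF gaussian_pos]) auto
      then show "AE \<xi> in lborel. norm (\<bar>\<xi>\<bar> * gaussian (- a + \<xi>)) \<le> norm (\<bar>- a + \<xi>\<bar> * gaussian (- a + \<xi>) + \<bar>a\<bar> * gaussian (- a + \<xi>))"
        by (auto simp: abs_mult abs_of_pos[OF gaussian_pos] intro!: order.trans[OF _ abs_ge_self])
    qed measurable
  qed
qed

text \<open>\<open>m t'\<close> is a multiple of the squared norm of the slice u(., t'), which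
  bounds the transform of the squared slice at every frequency. The flow is unimodular and the
  derivative contributes |\<xi>|.\<close>

lemma duhamel_fourier_bound:
  assumes u: "sq_integrable u"
  obtains m :: "real \<Rightarrow> real" where "integrable lborel m" "\<And>t'. m t' \<ge> 0"
    "\<And>t \<xi>. cmod (duhamel_fourier \<alpha> \<beta> u u t \<xi>) \<le> \<bar>\<xi>\<bar> * (\<integral>t'. indicator {-\<bar>t\<bar>..\<bar>t\<bar>} t' * m t' \<partial>lborel)"
proof -
  have [measurable]: "u \<in> borel_measurable borel" using u by (simp add: sq_integrable_def)
  define c where "c = (2 * pi) powr (- real DIM(real) / 2)"
  have c: "c \<ge> 0" by (simp add: c_def)
  define m where "m = (\<lambda>t'. c * (\<integral>x. (cmod (u (x, t')))\<^sup>2 \<partial>lborel))"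
  have "integrable (lborel \<Otimes>\<^sub>M lborel) (\<lambda>(x, t'). (cmod (u (x, t')))\<^sup>2)"
    using u by (simp add: sq_integrable_def lborel_prod case_prod_beta')
  from lborel_pair.integrable_snd[OF this] have mi: "integrable lborel m"
    unfolding m_def by (intro integrable_mult_right)
  have m0: "m t' \<ge> 0" for t' unfolding m_def using c by (intro mult_nonneg_nonneg integral_nonneg_AE) auto
  have bound: "cmod (duhamel_fourier \<alpha> \<beta> u u t \<xi>) \<le> \<bar>\<xi>\<bar> * (\<integral>t'. indicator {-\<bar>t\<bar>..\<bar>t\<bar>} t' * m t' \<partial>lborel)" for t \<xi>
  proof -
    define f where "f = (\<lambda>t'. U_symbol \<alpha> \<beta> (t - t') \<xi> * (\<i> * complex_of_real \<xi> * fourier (\<lambda>x. u (x, t') * u (x, t')) \<xi>))"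
    \<comment> \<open>This holds for every t': on a slice that is not square integrable, both
      integrals have the default value 0.\<close>
    have f: "cmod (f t') \<le> \<bar>\<xi>\<bar> * m t'" for t'
    proof -
      have "cmod (f t') = \<bar>\<xi>\<bar> * cmod (fourier (\<lambda>x. u (x, t') * u (x, t')) \<xi>)"
        by (simp add: f_def norm_mult U_symbol_def)
      also have "cmod (fourier (\<lambda>x. u (x, t') * u (x, t')) \<xi>) \<le> m t'"
        using norm_fourier_le[of "\<lambda>x. u (x, t') * u (x, t')" \<xi>] by (simp add: m_def c_def norm_mult power2_eq_square)
      finally show ?thesis by (simp add: mult_left_mono)
    qed
    have int: "integrable lborel (\<lambda>t'. \<bar>\<xi>\<bar> * (indicator {-\<bar>t\<bar>..\<bar>t\<bar>} t' * m t'))"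
      by (intro integrable_mult_right integrable_real_mult_indicator[where f=m, simplified mult.commute[of "m _"]] mi) auto
    have S: "cmod (LINT t':S|lborel. f t') \<le> \<bar>\<xi>\<bar> * (\<integral>t'. indicator {-\<bar>t\<bar>..\<bar>t\<bar>} t' * m t' \<partial>lborel)"
      if "S \<subseteq> {-\<bar>t\<bar>..\<bar>t\<bar>}" for S
    proof -
      have "cmod (LINT t':S|lborel. f t') \<le> (\<integral>t'. cmod (indicator S t' *\<^sub>R f t') \<partial>lborel)"
        unfolding set_lebesgue_integral_def by (rule integral_norm_bound)
      also have "\<dots> \<le> (\<integral>t'. \<bar>\<xi>\<bar> * (indicator {-\<bar>t\<bar>..\<bar>t\<bar>} t' * m t') \<partial>lborel)"
        using that f m0 by (intro Bochner_Integration.integral_mono'[OF int]) (auto simp: indicator_def)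
      finally show ?thesis by simp
    qed
    \<comment> \<open>For negative t the oriented integral is minus the one over (t, 0). Both open
      intervals lie in the symmetric one, so \<open>S\<close> covers either sign.\<close>
    show ?thesis
      unfolding duhamel_fourier_def f_def[symmetric] interval_lebesgue_integral_def
      using S[of "einterval 0 t"] S[of "einterval t 0"]
      by (auto simp: einterval_def subset_eq zero_ereal_def)
  qed
  show thesis by (rule that[OF mi m0 bound])
qed

section \<open>Convergence to the initial value\<close>

lemma AE_lborel_fst:
  assumes "AE x in (lborel :: 'a::euclidean_space measure). P x"
  shows "AE p in (lborel :: ('a \<times> 'b::euclidean_space) measure). P (fst p)"
proof -
  obtain N where N: "N \<in> null_sets (lborel :: 'a measure)" "{x. \<not> P x} \<subseteq> N"
    using assms by (auto elim!: AE_E simp: null_sets_def)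
  have [measurable]: "N \<in> sets borel" using N by (auto simp: null_sets_def)
  have "AE p in (lborel :: 'a measure) \<Otimes>\<^sub>M (lborel :: 'b measure). fst p \<notin> N"
  proof (rule lborel_pair.AE_pair_measure)
    show "{x \<in> space (lborel \<Otimes>\<^sub>M lborel). fst x \<notin> N} \<in> sets ((lborel :: 'a measure) \<Otimes>\<^sub>M (lborel :: 'b measure))"
      by measurable
    show "AE x in lborel. AE y in (lborel :: 'b measure). fst (x, y) \<notin> N"
      using AE_not_in[OF N(1)] by eventually_elim simp
  qed
  then show ?thesis unfolding lborel_prod by eventually_elim (use N in auto)
qed

lemma AE_lborel_dense:
  assumes P: "AE t in lborel. P t" and ab: "a < (b::real)"
  shows "\<exists>t. a < t \<and> t < b \<and> P t"
proof (rule ccontr)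
  assume "\<not> ?thesis"
  then have "AE t in lborel. t \<notin> {a<..<b}" using P by (auto elim!: eventually_mono)
  then have "emeasure lborel {a<..<b} = 0"
    by (subst (asm) AE_iff_measurable[of "{a<..<b}"]) auto
  with ab show False by simp
qed

lemma dense_bound:
  fixes f :: "real \<Rightarrow> complex"
  assumes cont: "continuous_on UNIV f" and q: "closure (range q) = UNIV" and le: "\<And>n. cmod (f (q n)) \<le> B"
  shows "cmod (f t) \<le> B"
proof (rule continuous_le_on_closure[where S="range q" and f="\<lambda>t. cmod (f t)"])
  show "continuous_on (closure (range q)) (\<lambda>t. cmod (f t))"
    unfolding q using cont by (intro continuous_intros)
qed (use q le in auto)

text \<open>Summing the thresholds makes k monotone and beyond each of them. The geometric rate will
  make the maximal functions of the increments summable, and \<open>n \<le> k n\<close> keeps limits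
  along the full sequence.\<close>

lemma cauchy_fast_subsequence:
  fixes d :: "nat \<Rightarrow> nat \<Rightarrow> real"
  assumes "\<forall>e>0. \<exists>N. \<forall>m\<ge>N. \<forall>n\<ge>N. d m n < e"
  obtains k :: "nat \<Rightarrow> nat" where "\<And>n. n \<le> k n" "\<And>n. d (k (Suc n)) (k n) < (1 / 2) ^ n"
proof -
  have "\<forall>j. \<exists>N. \<forall>m\<ge>N. \<forall>n\<ge>N. d m n < (1 / 2) ^ j" using assms by simp
  then obtain N where N: "\<And>j m n. m \<ge> N j \<Longrightarrow> n \<ge> N j \<Longrightarrow> d m n < (1 / 2) ^ j" by metis
  define k where "k = (\<lambda>n. n + (\<Sum>j\<le>n. N j))"
  have le: "N n \<le> k n" for n
    unfolding k_def using member_le_sum[of n "{..n}" N] by simp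
  have "k n \<le> k (Suc n)" for n unfolding k_def by simp
  then have "d (k (Suc n)) (k n) < (1 / 2) ^ n" for n
    using le[of n] by (intro N) (auto intro: order.trans)
  then show thesis using that[of k] by (simp add: k_def)
qed

text \<open>The maximal functions of the increments along a fast subsequence have summable
  integrals, so at almost every x their sum is finite and the subsequence converges uniformly in t.
  That sum, \<open>E\<close>, is also the majorant with which the limit in t is later taken under
  the integral.\<close>

lemma Xsb_representative:
  assumes \<alpha>: "\<alpha> \<noteq> 0" and s: "s \<ge> 1 / 4" and b: "b > 1 / 2" and u: "has_Xsb_norm \<alpha> \<beta> s b u r"
  obtains v :: "real \<times> real \<Rightarrow> complex" and E :: "real \<Rightarrow> real" where
    "v \<in> borel_measurable borel" "AE p in lborel. v p = u p" "integrable lborel E"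
    "AE x in lborel. continuous_on UNIV (\<lambda>t. v (x, t)) \<and> (\<forall>t. gaussian x * cmod (v (x, t)) \<le> E x)"
proof -
  obtain V where V: "\<And>n. schwartz (V n)"
    and cauchy: "\<forall>e>0. \<exists>N. \<forall>m\<ge>N. \<forall>n\<ge>N. Xsb_norm_schwartz \<alpha> \<beta> s b (\<lambda>p. V m p - V n p) < e"
    and conv: "(\<lambda>n. L2_norm (\<lambda>p. V n p - u p)) \<longlonglongrightarrow> 0" and su: "sq_integrable u"
    using u unfolding has_Xsb_norm_def by blast
  obtain C where C: "C \<ge> 0" "\<And>V q. schwartz V \<Longrightarrow>
    (\<integral>\<^sup>+x. (SUP n. ennreal (gaussian x * cmod (V (x, q (n::nat))))) \<partial>lborel) \<le> ennreal (C * Xsb_norm_schwartz \<alpha> \<beta> s b V)"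
    by (rule maximal_estimate[OF \<alpha> s b, of \<beta>]) (rule that, auto)
  obtain k :: "nat \<Rightarrow> nat" where k: "\<And>n. n \<le> k n"
    "\<And>n. Xsb_norm_schwartz \<alpha> \<beta> s b (\<lambda>p. V (k (Suc n)) p - V (k n) p) < (1 / 2) ^ n"
    using cauchy_fast_subsequence[OF cauchy] by blast
  define U where "U = (\<lambda>n. V (k n))"
  have U: "schwartz (U n)" for n by (simp add: U_def V)
  define W where "W = (\<lambda>n p. U (Suc n) p - U n p)"
  have W: "schwartz (W n)" for n unfolding W_def by (intro schwartz_diff U)
  note [measurable] = schwartz_measurable[OF U] schwartz_measurable[OF W]
  have um[measurable]: "u \<in> borel_measurable borel" using su by (simp add: sq_integrable_def)
  \<comment> \<open>Suprema over rational times are measurable in x. Slices of Schwartz functions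
    are continuous in t, so \<open>dense_bound\<close> recovers every time.\<close>
  define q :: "nat \<Rightarrow> real" where "q = from_nat_into \<rat>"
  have q: "closure (range q) = UNIV"
    unfolding q_def using countable_rat by (subst range_from_nat_into) (auto simp: Rats_closure_real)
  have section_cont: "continuous_on UNIV (\<lambda>t. F (x, t))" if "schwartz F" for F :: "real \<times> real \<Rightarrow> complex" and x
    by (rule continuous_on_compose2[OF schwartz_continuous[OF that]]) (auto intro!: continuous_intros)
  have section_meas[measurable]: "(\<lambda>x. F (x, t)) \<in> borel_measurable borel" if "schwartz F" for F :: "real \<times> real \<Rightarrow> complex" and t
    by (rule measurable_compose[OF _ schwartz_measurable[OF that]]) auto
  define S where "S = (\<lambda>(F :: real \<times> real \<Rightarrow> complex) x. SUP n. ennreal (gaussian x * cmod (F (x, q n))))"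
  have Sm[measurable]: "S F \<in> borel_measurable borel" if "schwartz F" for F
  proof -
    have [measurable]: "(\<lambda>x. F (x, t)) \<in> borel_measurable borel" for t by (rule section_meas[OF that])
    show ?thesis unfolding S_def by measurable
  qed
  note [measurable] = Sm[OF U] Sm[OF W]
  define G where "G = (\<lambda>x. S (U 0) x + (\<Sum>n. S (W n) x))"
  have [measurable]: "G \<in> borel_measurable borel" unfolding G_def by measurable
  have Gfin: "(\<integral>\<^sup>+x. G x \<partial>lborel) < \<infinity>"
  proof -
    have "(\<integral>\<^sup>+x. G x \<partial>lborel) = (\<integral>\<^sup>+x. S (U 0) x \<partial>lborel) + (\<Sum>n. \<integral>\<^sup>+x. S (W n) x \<partial>lborel)"
      unfolding G_def by (subst nn_integral_add) (auto simp: nn_integral_suminf)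
    also have "(\<Sum>n. \<integral>\<^sup>+x. S (W n) x \<partial>lborel) \<le> (\<Sum>n. ennreal (C * (1 / 2) ^ n))"
    proof (intro suminf_le summableI)
      fix n
      have "(\<integral>\<^sup>+x. S (W n) x \<partial>lborel) \<le> ennreal (C * Xsb_norm_schwartz \<alpha> \<beta> s b (W n))"
        unfolding S_def by (rule C(2)[OF W])
      also have "\<dots> \<le> ennreal (C * (1 / 2) ^ n)"
        using C(1) k(2)[of n] by (intro ennreal_leI mult_left_mono) (auto simp: W_def U_def)
      finally show "(\<integral>\<^sup>+x. S (W n) x \<partial>lborel) \<le> ennreal (C * (1 / 2) ^ n)" .
    qed
    also have "(\<Sum>n. ennreal (C * (1 / 2) ^ n)) = ennreal (\<Sum>n. C * (1 / 2) ^ n)"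
      using C(1) by (intro suminf_ennreal_eq) (auto intro!: summable_sums summable_mult summable_geometric)
    also have "(\<integral>\<^sup>+x. S (U 0) x \<partial>lborel) \<le> ennreal (C * Xsb_norm_schwartz \<alpha> \<beta> s b (U 0))"
      unfolding S_def by (rule C(2)[OF U])
    finally show ?thesis by (auto simp: less_top[symmetric] top_unique)
  qed
  define E where "E = (\<lambda>x. enn2real (G x))"
  have AEG: "AE x in lborel. G x \<noteq> \<infinity>"
    using Gfin by (intro nn_integral_PInf_AE) auto
  have Eint: "integrable lborel E"
  proof (rule integrableI_nonneg)
    have "(\<integral>\<^sup>+x. ennreal (E x) \<partial>lborel) = (\<integral>\<^sup>+x. G x \<partial>lborel)"
      using AEG by (intro nn_integral_cong_AE) (auto simp: E_def less_top elim!: eventually_mono)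
    then show "(\<integral>\<^sup>+x. ennreal (E x) \<partial>lborel) < \<infinity>" using Gfin by simp
  qed (auto simp: E_def)
  \<comment> \<open>\<open>lim\<close> is total, so v is defined and measurable everywhere; where
    the sequence diverges its value is arbitrary.\<close>
  define v where "v = (\<lambda>p. lim (\<lambda>n. U n p))"
  have vm[measurable]: "v \<in> borel_measurable borel"
    unfolding v_def by (rule borel_measurable_lim_metric) measurable
  have good: "continuous_on UNIV (\<lambda>t. v (x, t)) \<and> (\<forall>t. gaussian x * cmod (v (x, t)) \<le> E x) \<and> (\<forall>t. (\<lambda>n. U n (x, t)) \<longlonglongrightarrow> v (x, t))"
    if "G x \<noteq> \<infinity>" for x
  proof -
    have g: "gaussian x > 0" by (rule gaussian_pos)
    have sumSW: "(\<Sum>n. S (W n) x) \<noteq> \<infinity>" and SU: "S (U 0) x \<noteq> \<infinity>" using that by (auto simp: G_def)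
    have SW: "S (W n) x \<noteq> \<infinity>" for n
    proof -
      have "S (W n) x \<le> (\<Sum>n. S (W n) x)"
        using sum_le_suminf[of "\<lambda>n. S (W n) x" "{n}"] by simp
      then show "S (W n) x \<noteq> \<infinity>" using sumSW by (auto simp: top_unique)
    qed
    have bnd: "gaussian x * cmod (F (x, t)) \<le> enn2real (S F x)" if F: "schwartz F" and fin: "S F x \<noteq> \<infinity>" for F t
    proof -
      have "cmod (F (x, t)) \<le> enn2real (S F x) / gaussian x"
      proof (rule dense_bound[OF section_cont[OF F] q])
        fix n
        have "ennreal (gaussian x * cmod (F (x, q n))) \<le> S F x" unfolding S_def by (rule SUP_upper) simp
        also have "\<dots> = ennreal (enn2real (S F x))" using fin by (simp add: less_top)
        finally have "gaussian x * cmod (F (x, q n)) \<le> enn2real (S F x)" by (simp add: ennreal_le_iff)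
        then show "cmod (F (x, q n)) \<le> enn2real (S F x) / gaussian x" using g by (simp add: field_simps)
      qed
      then show ?thesis using g by (simp add: field_simps)
    qed
    define M where "M = (\<lambda>n. enn2real (S (W n) x))"
    have M: "ennreal (M n) = S (W n) x" "M n \<ge> 0" for n using SW[of n] by (auto simp: M_def less_top)
    have sM: "summable M"
      using sumSW M by (intro summable_suminf_not_top) auto
    have sumM: "ennreal (\<Sum>n. M n) = (\<Sum>n. S (W n) x)"
      using suminf_ennreal_eq[OF M(2) summable_sums[OF sM]] M(1) by simp
    have E: "E x = enn2real (S (U 0) x) + (\<Sum>n. M n)"
    proof -
      have "G x = ennreal (enn2real (S (U 0) x)) + ennreal (\<Sum>n. M n)"
        unfolding G_def sumM using SU by (simp add: less_top)
      also have "\<dots> = ennreal (enn2real (S (U 0) x) + (\<Sum>n. M n))"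
        using sM M(2) by (intro ennreal_plus[symmetric]) (auto intro: suminf_nonneg)
      finally have G: "G x = ennreal (enn2real (S (U 0) x) + (\<Sum>n. M n))" .
      show ?thesis unfolding E_def G
        by (rule enn2real_ennreal) (intro add_nonneg_nonneg suminf_nonneg sM enn2real_nonneg M(2))
    qed
    have Wb: "norm (W n (x, t)) \<le> M n / gaussian x" for n t
      using bnd[OF W SW, of n t] g by (simp add: M_def field_simps)
    \<comment> \<open>With x fixed, the bounds \<open>M n / gaussian x\<close> hold for all t at
      once and are summable because G x is finite.\<close>
    have "uniform_limit UNIV (\<lambda>n t. \<Sum>i<n. W i (x, t)) (\<lambda>t. \<Sum>i. W i (x, t)) sequentially"
      by (rule Weierstrass_m_test[where M="\<lambda>n. M n / gaussian x", OF Wb summable_divide[OF sM]])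
    moreover have tel: "(\<Sum>i<n. W i (x, t)) = U n (x, t) - U 0 (x, t)" for n t
      unfolding W_def by (rule sum_lessThan_telescope)
    ultimately have ul: "uniform_limit UNIV (\<lambda>n t. U n (x, t) - U 0 (x, t)) (\<lambda>t. \<Sum>i. W i (x, t)) sequentially"
      by simp
    have "continuous_on UNIV (\<lambda>t. \<Sum>i. W i (x, t))"
    proof (rule uniform_limit_theorem[OF always_eventually ul])
      show "\<forall>n. continuous_on UNIV (\<lambda>t. U n (x, t) - U 0 (x, t))"
        by (intro allI continuous_on_diff[OF section_cont[OF U] section_cont[OF U]])
    qed simp
    then have cL: "continuous_on UNIV (\<lambda>t. U 0 (x, t) + (\<Sum>i. W i (x, t)))"
      by (rule continuous_on_add[OF section_cont[OF U]])
    have lim: "(\<lambda>n. U n (x, t)) \<longlonglongrightarrow> U 0 (x, t) + (\<Sum>i. W i (x, t))" for t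
    proof -
      have "(\<lambda>n. U n (x, t) - U 0 (x, t)) \<longlonglongrightarrow> (\<Sum>i. W i (x, t))"
        by (rule tendsto_uniform_limitI[OF ul]) simp
      from tendsto_add[OF tendsto_const[of "U 0 (x, t)"] this] show ?thesis by simp
    qed
    then have veq: "v (x, t) = U 0 (x, t) + (\<Sum>i. W i (x, t))" for t
      unfolding v_def by (rule limI)
    have "gaussian x * cmod (v (x, t)) \<le> E x" for t
    proof (rule tendsto_upperbound)
      show "(\<lambda>n. gaussian x * cmod (U n (x, t))) \<longlonglongrightarrow> gaussian x * cmod (v (x, t))"
        using lim[of t] unfolding veq by (intro tendsto_intros)
      have "gaussian x * cmod (U n (x, t)) \<le> E x" for n
      proof -
        have "U n (x, t) = U 0 (x, t) + (\<Sum>i<n. W i (x, t))" by (simp add: tel)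
        then have "cmod (U n (x, t)) \<le> cmod (U 0 (x, t)) + (\<Sum>i<n. cmod (W i (x, t)))"
          by (metis add_left_mono norm_triangle_le norm_sum)
        then have "gaussian x * cmod (U n (x, t)) \<le> gaussian x * (cmod (U 0 (x, t)) + (\<Sum>i<n. cmod (W i (x, t))))"
          using g by (intro mult_left_mono) auto
        also have "\<dots> = gaussian x * cmod (U 0 (x, t)) + (\<Sum>i<n. gaussian x * cmod (W i (x, t)))"
          by (simp add: distrib_left sum_distrib_left)
        also have "\<dots> \<le> enn2real (S (U 0) x) + (\<Sum>i<n. M i)"
          unfolding M_def by (intro add_mono sum_mono bnd U W SW SU)
        also have "(\<Sum>i<n. M i) \<le> (\<Sum>i. M i)"
          using M(2) by (intro sum_le_suminf sM) auto
        finally show ?thesis by (simp add: E)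
      qed
      then show "\<forall>\<^sub>F n in sequentially. gaussian x * cmod (U n (x, t)) \<le> E x" by simp
    qed simp
    with cL lim show ?thesis by (simp add: veq)
  qed
  \<comment> \<open>Pointwise convergence to v meets square convergence to u through Fatou's lemma:
    the lower limit of |U n - u|^2 has integral 0, and almost everywhere it equals |v -
    u|^2.\<close>
  have "AE p in lborel. v p = u p"
  proof -
    have AEp: "AE p in lborel. (\<lambda>n. U n p) \<longlonglongrightarrow> v p"
      using AE_lborel_fst[OF AEG, where 'b=real] by eventually_elim (use good in auto)
    have L: "(\<integral>\<^sup>+p. ennreal ((cmod (U n p - u p))\<^sup>2) \<partial>lborel) = ennreal ((L2_norm (\<lambda>p. U n p - u p))\<^sup>2)" for n
      using sq_integrable_diff[OF schwartz_sq_integrable[OF U] su, of n]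
      unfolding sq_integrable_def L2_norm_def by (simp add: nn_integral_eq_integral integral_nonneg_AE)
    have "filterlim k at_top sequentially"
      using k(1) by (intro filterlim_at_top_mono[OF filterlim_ident always_eventually]) auto
    from filterlim_compose[OF conv this] have "(\<lambda>n. L2_norm (\<lambda>p. U n p - u p)) \<longlonglongrightarrow> 0"
      by (simp add: U_def)
    from tendsto_power[OF this, of 2] have "(\<lambda>n. ennreal ((L2_norm (\<lambda>p. U n p - u p))\<^sup>2)) \<longlonglongrightarrow> ennreal 0"
      by (intro tendsto_ennrealI) simp
    then have "liminf (\<lambda>n. \<integral>\<^sup>+p. ennreal ((cmod (U n p - u p))\<^sup>2) \<partial>lborel) = 0"
      unfolding L by (simp add: lim_imp_Liminf)
    then have "(\<integral>\<^sup>+p. liminf (\<lambda>n. ennreal ((cmod (U n p - u p))\<^sup>2)) \<partial>lborel) = 0"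
      using nn_integral_liminf[of "\<lambda>n p. ennreal ((cmod (U n p - u p))\<^sup>2)" lborel] by simp
    then have "AE p in lborel. liminf (\<lambda>n. ennreal ((cmod (U n p - u p))\<^sup>2)) = 0"
      by (subst (asm) nn_integral_0_iff_AE) auto
    with AEp show ?thesis
    proof eventually_elim
      fix p assume "(\<lambda>n. U n p) \<longlonglongrightarrow> v p" and 0: "liminf (\<lambda>n. ennreal ((cmod (U n p - u p))\<^sup>2)) = 0"
      then have "(\<lambda>n. ennreal ((cmod (U n p - u p))\<^sup>2)) \<longlonglongrightarrow> ennreal ((cmod (v p - u p))\<^sup>2)"
        by (intro tendsto_ennrealI tendsto_intros)
      then have "liminf (\<lambda>n. ennreal ((cmod (U n p - u p))\<^sup>2)) = ennreal ((cmod (v p - u p))\<^sup>2)"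
        by (intro lim_imp_Liminf) auto
      with 0 show "v p = u p" by simp
    qed
  qed
  moreover have "AE x in lborel. continuous_on UNIV (\<lambda>t. v (x, t)) \<and> (\<forall>t. gaussian x * cmod (v (x, t)) \<le> E x)"
    using AEG by eventually_elim (use good in auto)
  ultimately show thesis using that[OF vm _ Eint] by blast
qed

section \<open>The limit at time 0\<close>

lemma lborel_AE_section:
  fixes P :: "real \<times> real \<Rightarrow> bool"
  assumes "AE p in lborel. P p" and [measurable]: "Measurable.pred borel P"
  shows "AE t in lborel. AE x in lborel. P (x, t)"
proof -
  have "AE p in lborel \<Otimes>\<^sub>M lborel. P p" using assms(1) unfolding lborel_prod .
  then have "AE x in lborel. AE t in lborel. P (x, t)" by (rule lborel_pair.AE_pair)
  moreover have "{p \<in> space (lborel \<Otimes>\<^sub>M lborel). P (fst p, snd p)} \<in> sets (lborel \<Otimes>\<^sub>M lborel)"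
    using assms(2) unfolding lborel_prod by (simp add: pred_def)
  ultimately show ?thesis using lborel_pair.AE_commute[of "\<lambda>x t. P (x, t)"] by simp
qed

text \<open>Every t' other than 0 eventually leaves the intervals, and |m| dominates.\<close>

lemma shrinking_integral_tendsto_0:
  fixes m :: "real \<Rightarrow> real"
  assumes m: "integrable lborel m" and \<tau>: "\<tau> \<longlonglongrightarrow> 0"
  shows "(\<lambda>n. \<integral>t'. indicator {-\<bar>\<tau> n\<bar>..\<bar>\<tau> n\<bar>} t' * m t' \<partial>lborel) \<longlonglongrightarrow> 0"
proof -
  have [measurable]: "m \<in> borel_measurable borel" using m by auto
  have "(\<lambda>n. \<integral>t'. indicator {-\<bar>\<tau> n\<bar>..\<bar>\<tau> n\<bar>} t' * m t' \<partial>lborel) \<longlonglongrightarrow> (\<integral>t'. 0 \<partial>(lborel :: real measure))"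
  proof (rule integral_dominated_convergence[where w="\<lambda>t'. \<bar>m t'\<bar>"])
    show "AE t' in lborel. (\<lambda>n. indicator {-\<bar>\<tau> n\<bar>..\<bar>\<tau> n\<bar>} t' * m t') \<longlonglongrightarrow> 0"
      using AE_lborel_singleton[of 0]
    proof eventually_elim
      fix t' :: real assume "t' \<noteq> 0"
      then have "\<forall>\<^sub>F n in sequentially. \<bar>\<tau> n\<bar> < \<bar>t'\<bar>"
        using order_tendstoD(2)[OF tendsto_rabs_zero[OF \<tau>], of "\<bar>t'\<bar>"] by simp
      then have "\<forall>\<^sub>F n in sequentially. 0 = indicator {-\<bar>\<tau> n\<bar>..\<bar>\<tau> n\<bar>} t' * m t'"
        by eventually_elim (auto simp: indicator_def)
      then show "(\<lambda>n. indicator {-\<bar>\<tau> n\<bar>..\<bar>\<tau> n\<bar>} t' * m t') \<longlonglongrightarrow> 0"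
        by (rule Lim_transform_eventually[OF tendsto_const])
    qed
  qed (use m in \<open>auto simp: indicator_def\<close>)
  then show ?thesis by simp
qed

theorem theorem1p4:
  fixes \<alpha> \<beta> s \<epsilon> C\<^sub>0 T :: real
    and \<eta> :: "real \<Rightarrow> real"
    and u\<^sub>0 :: "real \<Rightarrow> complex"
    and u :: "real \<times> real \<Rightarrow> complex"
  assumes "\<alpha> \<noteq> 0"
    and "s \<ge> 1 / 4"
    and "u\<^sub>0 \<in> Hs s"
    and "time_cutoff \<eta>"
    and "\<epsilon> > 0"
    and "estimate_constant \<alpha> \<beta> s \<epsilon> \<eta> C\<^sub>0"
    and "kawahara_solution \<alpha> \<beta> s \<epsilon> \<eta> C\<^sub>0 T u\<^sub>0 u"
  shows "\<exists>v. v \<in> borel_measurable borel \<and>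
    (AE p in lborel. snd p \<in> {-T<..<T} \<longrightarrow> v p = u p) \<and>
    (AE x in lborel. ((\<lambda>t. v (x, t)) \<longlongrightarrow> u\<^sub>0 x) (at 0))"
proof -
  define b where "b = 1 / 2 + \<epsilon> / 2"
  have b: "b > 1 / 2" using \<open>\<epsilon> > 0\<close> by (simp add: b_def)
  have T: "0 < T" "T < 1" and "u \<in> Xsb \<alpha> \<beta> s b"
    and "\<exists>y z. cutoff_flow \<alpha> \<beta> \<eta> u\<^sub>0 y \<and> cutoff_duhamel \<alpha> \<beta> \<eta> T u u z \<and> (AE p in lborel. u p = y p - z p)"
    using assms(7) unfolding kawahara_solution_def Let_def b_def by auto
  then obtain r y z where r: "has_Xsb_norm \<alpha> \<beta> s b u r"
    and y: "cutoff_flow \<alpha> \<beta> \<eta> u\<^sub>0 y" and z: "cutoff_duhamel \<alpha> \<beta> \<eta> T u u z"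
    and uyz: "AE p in lborel. u p = y p - z p"
    unfolding Xsb_def by blast
  have su: "sq_integrable u" using r by (simp add: has_Xsb_norm_def)
  have \<eta>: "\<eta> t = 1" if "\<bar>t\<bar> \<le> 1" for t using assms(4) that by (simp add: time_cutoff_def)
  define f where "f = fourier_L2 u\<^sub>0"
  \<comment> \<open>Membership in \<open>Hs\<close> supplies some transform, so the choice made by
    \<open>fourier_L2\<close> is indeed one.\<close>
  have f: "has_fourier_L2 u\<^sub>0 f"
  proof -
    have "\<exists>g. has_fourier_L2 u\<^sub>0 g" using assms(3) by (simp add: Hs_def)
    then show ?thesis unfolding f_def fourier_L2_def by (rule someI_ex)
  qed
  then have sf: "sq_integrable f" and su0: "sq_integrable u\<^sub>0" by (auto simp: has_fourier_L2_def)
  have [measurable]: "f \<in> borel_measurable borel" "u\<^sub>0 \<in> borel_measurable borel" "y \<in> borel_measurable borel"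
    "z \<in> borel_measurable borel" "phase \<alpha> \<beta> \<in> borel_measurable borel"
    using sf su0 y z by (auto simp: sq_integrable_def cutoff_flow_def cutoff_duhamel_def has_spatial_fourier_def phase_measurable)
  obtain v :: "real \<times> real \<Rightarrow> complex" and E :: "real \<Rightarrow> real" where v[measurable]: "v \<in> borel_measurable borel"
    and vu: "AE p in lborel. v p = u p" and E: "integrable lborel E"
    and vE: "AE x in lborel. continuous_on UNIV (\<lambda>t. v (x, t)) \<and> (\<forall>t. gaussian x * cmod (v (x, t)) \<le> E x)"
    by (rule Xsb_representative[OF assms(1,2) b r]) (rule that, auto)
  have v_section[measurable]: "(\<lambda>x. v (x, t)) \<in> borel_measurable borel" for t
    by (rule measurable_compose[OF _ v]) auto
  define good where "good = (\<lambda>t. (AE x in lborel. v (x, t) = y (x, t) - z (x, t)) \<and>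
    has_fourier_L2 (\<lambda>x. y (x, t)) (\<lambda>\<xi>. complex_of_real (\<eta> t) * (U_symbol \<alpha> \<beta> t \<xi> * f \<xi>)) \<and>
    has_fourier_L2 (\<lambda>x. z (x, t)) (\<lambda>\<xi>. complex_of_real (\<eta> (t / T)) * duhamel_fourier \<alpha> \<beta> u u t \<xi>))"
  have "AE t in lborel. AE x in lborel. v (x, t) = y (x, t) - z (x, t)"
  proof (rule lborel_AE_section[where P="\<lambda>p. v p = y p - z p"])
    show "AE p in lborel. v p = y p - z p" using vu uyz by eventually_elim simp
  qed measurable
  moreover have "AE t in lborel. has_fourier_L2 (\<lambda>x. y (x, t)) (\<lambda>\<xi>. complex_of_real (\<eta> t) * (U_symbol \<alpha> \<beta> t \<xi> * f \<xi>))"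
    "AE t in lborel. has_fourier_L2 (\<lambda>x. z (x, t)) (\<lambda>\<xi>. complex_of_real (\<eta> (t / T)) * duhamel_fourier \<alpha> \<beta> u u t \<xi>)"
    using y z by (auto simp: cutoff_flow_def cutoff_duhamel_def has_spatial_fourier_def f_def)
  ultimately have "AE t in lborel. good t" by eventually_elim (simp add: good_def)
  \<comment> \<open>A set of times of full measure meets every interval, so good times can be taken
    arbitrarily close to 0, and below T.\<close>
  then have "\<exists>t. 0 < t \<and> t < T / real (Suc n) \<and> good t" for n
    using T by (intro AE_lborel_dense) auto
  then obtain \<tau> where \<tau>: "\<And>n. 0 < \<tau> n" "\<And>n. \<tau> n < T / real (Suc n)" "\<And>n. good (\<tau> n)" by metis
  have \<tau>0: "\<tau> \<longlonglongrightarrow> 0"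
  proof (rule tendsto_sandwich[where f="\<lambda>_. 0" and h="\<lambda>n. T / real (Suc n)"])
    show "(\<lambda>n. T / real (Suc n)) \<longlonglongrightarrow> 0"
      using tendsto_mult_right_zero[OF LIMSEQ_inverse_real_of_nat, of T] by (simp add: divide_inverse)
    show "\<forall>\<^sub>F n in sequentially. 0 \<le> \<tau> n" "\<forall>\<^sub>F n in sequentially. \<tau> n \<le> T / real (Suc n)"
      using \<tau> by (auto intro!: always_eventually less_imp_le)
  qed simp
  have \<tau>T: "\<tau> n < T" for n
    using \<tau>(2)[of n] T divide_left_mono[of 1 "real (Suc n)" T] by simp
  \<comment> \<open>Since 0 < \<tau> n < T < 1, neither cutoff is felt at the chosen times.\<close>
  have \<eta>1: "\<eta> (\<tau> n) = 1" "\<eta> (\<tau> n / T) = 1" for n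
    using \<tau>(1)[of n] T \<tau>T[of n] by (auto intro!: \<eta> simp: divide_le_eq_1)
  obtain m :: "real \<Rightarrow> real" where m: "integrable lborel m" "\<And>t'. m t' \<ge> 0"
    "\<And>t \<xi>. cmod (duhamel_fourier \<alpha> \<beta> u u t \<xi>) \<le> \<bar>\<xi>\<bar> * (\<integral>t'. indicator {-\<bar>t\<bar>..\<bar>t\<bar>} t' * m t' \<partial>lborel)"
    using duhamel_fourier_bound[OF su] by blast
  \<comment> \<open>Pair the equation at \<tau> n with the transform of \<psi> and let n grow. The
    left side converges by continuity in t; the right side splits on the frequency side into the
    free part A, which tends to the pairing of f with \<psi>, and the Duhamel part D, which
    vanishes.\<close>
  have test: "(\<integral>x. v (x, 0) * fourier \<psi> x \<partial>lborel) = (\<integral>x. u\<^sub>0 x * fourier \<psi> x \<partial>lborel)"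
    if \<psi>_def: "\<psi> = (\<lambda>\<xi>. complex_of_real (gaussian (- a + \<xi>)))" for a \<psi>
  proof -
    note \<psi> = translated_gaussian[of a, folded \<psi>_def]
    have [measurable]: "\<psi> \<in> borel_measurable borel" unfolding \<psi>_def by measurable
    \<comment> \<open>The modulus is the Gaussian for every a, so the weight in the bound by E is
      exactly the one required.\<close>
    have \<psi>n: "cmod (fourier \<psi> x) = gaussian x" for x
      by (simp add: \<psi>(3) norm_mult abs_of_pos[OF gaussian_pos])
    have 1: "(\<lambda>n. \<integral>x. v (x, \<tau> n) * fourier \<psi> x \<partial>lborel) \<longlonglongrightarrow> (\<integral>x. v (x, 0) * fourier \<psi> x \<partial>lborel)"
    proof (rule integral_dominated_convergence[OF _ _ E])
      show "AE x in lborel. (\<lambda>n. v (x, \<tau> n) * fourier \<psi> x) \<longlonglongrightarrow> v (x, 0) * fourier \<psi> x"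
        using vE
      proof eventually_elim
        fix x assume "continuous_on UNIV (\<lambda>t. v (x, t)) \<and> (\<forall>t. gaussian x * cmod (v (x, t)) \<le> E x)"
        then have "isCont (\<lambda>t. v (x, t)) 0" by (simp add: continuous_on_eq_continuous_at)
        from isCont_tendsto_compose[OF this \<tau>0]
        show "(\<lambda>n. v (x, \<tau> n) * fourier \<psi> x) \<longlonglongrightarrow> v (x, 0) * fourier \<psi> x"
          by (intro tendsto_mult_right)
      qed
      show "AE x in lborel. norm (v (x, \<tau> n) * fourier \<psi> x) \<le> E x" for n
        using vE by eventually_elim (simp add: norm_mult \<psi>n mult.commute)
    qed measurable
    define A where "A = (\<lambda>n. \<integral>\<xi>. (U_symbol \<alpha> \<beta> (\<tau> n) \<xi> * f \<xi>) * \<psi> \<xi> \<partial>lborel)"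
    define D where "D = (\<lambda>n. \<integral>\<xi>. duhamel_fourier \<alpha> \<beta> u u (\<tau> n) \<xi> * \<psi> \<xi> \<partial>lborel)"
    have 2: "(\<integral>x. v (x, \<tau> n) * fourier \<psi> x \<partial>lborel) = A n - D n" for n
    proof -
      have g: "AE x in lborel. v (x, \<tau> n) = y (x, \<tau> n) - z (x, \<tau> n)"
        and hy: "has_fourier_L2 (\<lambda>x. y (x, \<tau> n)) (\<lambda>\<xi>. U_symbol \<alpha> \<beta> (\<tau> n) \<xi> * f \<xi>)"
        and hz: "has_fourier_L2 (\<lambda>x. z (x, \<tau> n)) (duhamel_fourier \<alpha> \<beta> u u (\<tau> n))"
        using \<tau>(3)[of n] by (simp_all add: good_def \<eta>1)
      have syz: "sq_integrable (\<lambda>x. y (x, \<tau> n))" "sq_integrable (\<lambda>x. z (x, \<tau> n))"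
        using hy hz by (auto simp: has_fourier_L2_def)
      then have [measurable]: "(\<lambda>x. y (x, \<tau> n)) \<in> borel_measurable borel" "(\<lambda>x. z (x, \<tau> n)) \<in> borel_measurable borel"
        by (auto simp: sq_integrable_def)
      have "(\<integral>x. v (x, \<tau> n) * fourier \<psi> x \<partial>lborel) = (\<integral>x. y (x, \<tau> n) * fourier \<psi> x - z (x, \<tau> n) * fourier \<psi> x \<partial>lborel)"
      proof (rule integral_cong_AE)
        show "AE x in lborel. v (x, \<tau> n) * fourier \<psi> x = y (x, \<tau> n) * fourier \<psi> x - z (x, \<tau> n) * fourier \<psi> x"
          using g by eventually_elim (simp add: left_diff_distrib)
      qed measurable
      also have "\<dots> = (\<integral>x. y (x, \<tau> n) * fourier \<psi> x \<partial>lborel) - (\<integral>x. z (x, \<tau> n) * fourier \<psi> x \<partial>lborel)"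
        by (rule Bochner_Integration.integral_diff[OF L2_Cauchy_Schwarz(1)[OF syz(1) \<psi>(4)] L2_Cauchy_Schwarz(1)[OF syz(2) \<psi>(4)]])
      also have "\<dots> = A n - D n"
        unfolding A_def D_def
        using has_fourier_L2_multiplication[OF hy \<psi>(1,2,4)] has_fourier_L2_multiplication[OF hz \<psi>(1,2,4)] by simp
      finally show ?thesis .
    qed
    have A: "A \<longlonglongrightarrow> (\<integral>\<xi>. f \<xi> * \<psi> \<xi> \<partial>lborel)"
      unfolding A_def
    proof (rule integral_dominated_convergence[where w="\<lambda>\<xi>. cmod (f \<xi> * \<psi> \<xi>)"])
      show "integrable lborel (\<lambda>\<xi>. cmod (f \<xi> * \<psi> \<xi>))"
        by (intro integrable_norm L2_Cauchy_Schwarz(1)[OF sf \<psi>(2)])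
      show "AE \<xi> in lborel. (\<lambda>n. U_symbol \<alpha> \<beta> (\<tau> n) \<xi> * f \<xi> * \<psi> \<xi>) \<longlonglongrightarrow> f \<xi> * \<psi> \<xi>"
      proof (rule AE_I2)
        fix \<xi>
        have "(\<lambda>n. U_symbol \<alpha> \<beta> (\<tau> n) \<xi>) \<longlonglongrightarrow> exp (- (\<i> * complex_of_real (0 * phase \<alpha> \<beta> \<xi>)))"
          unfolding U_symbol_def by (intro tendsto_intros \<tau>0)
        then have "(\<lambda>n. U_symbol \<alpha> \<beta> (\<tau> n) \<xi>) \<longlonglongrightarrow> 1" by simp
        from tendsto_mult_right[OF tendsto_mult_right[OF this, of "f \<xi>"], of "\<psi> \<xi>"]
        show "(\<lambda>n. U_symbol \<alpha> \<beta> (\<tau> n) \<xi> * f \<xi> * \<psi> \<xi>) \<longlonglongrightarrow> f \<xi> * \<psi> \<xi>" by simp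
      qed
      show "AE \<xi> in lborel. norm (U_symbol \<alpha> \<beta> (\<tau> n) \<xi> * f \<xi> * \<psi> \<xi>) \<le> cmod (f \<xi> * \<psi> \<xi>)" for n
        by (simp add: norm_mult U_symbol_def)
      show "(\<lambda>\<xi>. U_symbol \<alpha> \<beta> (\<tau> n) \<xi> * f \<xi> * \<psi> \<xi>) \<in> borel_measurable lborel" for n
        unfolding U_symbol_def by measurable
    qed measurable
    \<comment> \<open>The bound separates: K is finite although it contains |\<xi>|, and all
      dependence on n sits in the integral of m over the shrinking strip.\<close>
    have D: "D \<longlonglongrightarrow> 0"
    proof -
      define g where "g = (\<lambda>n. \<integral>t'. indicator {-\<bar>\<tau> n\<bar>..\<bar>\<tau> n\<bar>} t' * m t' \<partial>lborel)"
      define K where "K = (\<integral>\<xi>. \<bar>\<xi>\<bar> * gaussian (- a + \<xi>) \<partial>lborel)"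
      have g0: "0 \<le> g n" for n unfolding g_def using m(2) by (intro integral_nonneg_AE) auto
      have gK: "cmod (D n) \<le> g n * K" for n
      proof -
        have "cmod (D n) \<le> (\<integral>\<xi>. cmod (duhamel_fourier \<alpha> \<beta> u u (\<tau> n) \<xi> * \<psi> \<xi>) \<partial>lborel)"
          unfolding D_def by (rule integral_norm_bound)
        also have "\<dots> \<le> (\<integral>\<xi>. g n * (\<bar>\<xi>\<bar> * gaussian (- a + \<xi>)) \<partial>lborel)"
        proof (rule Bochner_Integration.integral_mono')
          show "integrable lborel (\<lambda>\<xi>. g n * (\<bar>\<xi>\<bar> * gaussian (- a + \<xi>)))"
            by (intro integrable_mult_right \<psi>(5))
          fix \<xi>
          have "cmod (duhamel_fourier \<alpha> \<beta> u u (\<tau> n) \<xi>) * gaussian (- a + \<xi>) \<le> (\<bar>\<xi>\<bar> * g n) * gaussian (- a + \<xi>)"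
            unfolding g_def by (intro mult_right_mono m(3) less_imp_le[OF gaussian_pos])
          then show "cmod (duhamel_fourier \<alpha> \<beta> u u (\<tau> n) \<xi> * \<psi> \<xi>) \<le> g n * (\<bar>\<xi>\<bar> * gaussian (- a + \<xi>))"
            by (simp add: norm_mult \<psi>_def abs_of_pos[OF gaussian_pos] mult_ac)
        qed (use g0 in \<open>auto simp: less_imp_le[OF gaussian_pos]\<close>)
        finally show ?thesis by (simp add: K_def)
      qed
      have "g \<longlonglongrightarrow> 0" unfolding g_def by (rule shrinking_integral_tendsto_0[OF m(1) \<tau>0])
      from Lim_null_comparison[OF always_eventually[OF allI[OF gK]] tendsto_mult_left_zero[OF this]]
      show ?thesis .
    qed
    have "(\<integral>x. v (x, 0) * fourier \<psi> x \<partial>lborel) = (\<integral>\<xi>. f \<xi> * \<psi> \<xi> \<partial>lborel)"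
      using LIMSEQ_unique[OF 1[unfolded 2] tendsto_diff[OF A D]] by simp
    also have "\<dots> = (\<integral>x. u\<^sub>0 x * fourier \<psi> x \<partial>lborel)"
      by (rule has_fourier_L2_multiplication[OF f \<psi>(1,2,4), symmetric])
    finally show ?thesis .
  qed
  \<comment> \<open>Multiplied by the Gaussian G, both functions are integrable: the one by the
    majorant E, the other by Cauchy-Schwarz. Uniqueness applies to the products, and G, being
    positive, cancels.\<close>
  have init: "AE x in lborel. v (x, 0) = u\<^sub>0 x"
  proof -
    define G where "G = (\<lambda>x::real. complex_of_real (gaussian x))"
    have [measurable]: "G \<in> borel_measurable borel" unfolding G_def by measurable
    have vG: "integrable lborel (\<lambda>x. v (x, 0) * G x)"
    proof (rule Bochner_Integration.integrable_bound[OF E])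
      show "AE x in lborel. norm (v (x, 0) * G x) \<le> norm (E x)"
        using vE by eventually_elim
          (auto simp: G_def norm_mult abs_of_pos[OF gaussian_pos] mult.commute intro: order.trans[OF _ abs_ge_self])
    qed measurable
    have uG: "integrable lborel (\<lambda>x. u\<^sub>0 x * G x)"
      using L2_Cauchy_Schwarz(1)[OF su0 translated_gaussian(2)[of 0]] by (simp add: G_def)
    have ie: "integrable lborel (\<lambda>x. iexp (t * x) * F x)" if "integrable lborel F" for F :: "real \<Rightarrow> complex" and t
      by (rule integrable_exp_mult(2)[OF that]) simp
    have "AE x in lborel. v (x, 0) * G x - u\<^sub>0 x * G x = 0"
    proof (rule integrable_fourier_unique)
      show "integrable lborel (\<lambda>x. v (x, 0) * G x - u\<^sub>0 x * G x)" using vG uG by simp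
      fix t
      \<comment> \<open>Centring the Gaussian at -t gives the character exp (i t x) with the sign
        used in \<open>integrable_fourier_unique\<close>.\<close>
      have F: "fourier (\<lambda>\<xi>. complex_of_real (gaussian (- (- t) + \<xi>))) x = iexp (t * x) * G x" for x
        unfolding translated_gaussian(3) G_def by simp
      have "(\<integral>x. v (x, 0) * (iexp (t * x) * G x) \<partial>lborel) = (\<integral>x. u\<^sub>0 x * (iexp (t * x) * G x) \<partial>lborel)"
        using test[OF refl, of "- t"] unfolding F .
      then have "(\<integral>x. iexp (t * x) * (v (x, 0) * G x) \<partial>lborel) = (\<integral>x. iexp (t * x) * (u\<^sub>0 x * G x) \<partial>lborel)"
        by (simp only: mult.left_commute)
      then show "(\<integral>x. iexp (t * x) * (v (x, 0) * G x - u\<^sub>0 x * G x) \<partial>lborel) = 0"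
        unfolding right_diff_distrib Bochner_Integration.integral_diff[OF ie[OF vG] ie[OF uG]] by simp
    qed
    then show ?thesis
      by eventually_elim (simp add: G_def gaussian_def left_diff_distrib[symmetric])
  qed
  have "AE x in lborel. ((\<lambda>t. v (x, t)) \<longlongrightarrow> u\<^sub>0 x) (at 0)"
    using vE init
  proof eventually_elim
    fix x assume "continuous_on UNIV (\<lambda>t. v (x, t)) \<and> (\<forall>t. gaussian x * cmod (v (x, t)) \<le> E x)" and 0: "v (x, 0) = u\<^sub>0 x"
    then have "isCont (\<lambda>t. v (x, t)) 0" by (simp add: continuous_on_eq_continuous_at)
    then show "((\<lambda>t. v (x, t)) \<longlongrightarrow> u\<^sub>0 x) (at 0)" unfolding isCont_def 0 .
  qed
  moreover have "AE p in lborel. snd p \<in> {-T<..<T} \<longrightarrow> v p = u p" using vu by eventually_elim simp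
  ultimately show ?thesis using v by blast
qed

end
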